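(* Let $\mathcal U$ be a free ultrafilter on $(0,1]$ with $(0,\delta]\in\mathcal U$ for each $\delta>0$. Let the mollifier $\phi\in{}^*\mathcal C^\infty(\mathbb R)$ be an internal smooth function, represented by a family $(\phi^{(\varepsilon)})_{\varepsilon\in(0,1]}$ in $\mathcal C^\infty(\mathbb R)$, whose Fourier transform satisfies, for each $p\in\mathbb N$, $|\widehat\phi(\xi)|\le C_p\langle\xi\rangle^{-p}$ for some $C_p\in\mathbb R$; in terms of representatives: for each $p\in\mathbb N$ there exist $C_p\in\mathbb R$ and $S_p\in\mathcal U$ with $$|\widehat{\phi^{(\varepsilon)}}(\xi)|\le C_p\langle\xi\rangle^{-p}\qquad\text{for all }\xi\in\mathbb R\text{ and all }\varepsilon\in S_p .$$ (In particular, this includes the case $\phi\in\mathcal S(\mathbb R)$.) Put $\phi_\varepsilon(x):=\varepsilon^{-1}\phi^{(\varepsilon)}(x/\varepsilon)$ and, for $T\in\mathcal E'(\mathbb R)$, let $\iota(T):=[T\ast\phi_\varepsilon]$ be the class of $(T\ast\phi_\varepsilon)_{\varepsilon}$ in ${}^\rho\mathcal E(\mathbb R)$. Let $\varepsilon_n:=1/2^{(n^n)}$ for $n\in\mathbb N$, let $S:=\bigcup_{n\in\mathbb N}(\varepsilon_{6n+3},\varepsilon_{6n}]$ and $S^c:=(0,1]\setminus S$. Define $T$ through its Fourier transform by $$\widehat T(\xi):=\sum_{m=1}^\infty\psi(\xi-\varepsilon_{6m-1}^{-1})\quad\text{if } S\in\mathcal U,\qquad \widehat T(\xi):=\sum_{m=0}^\infty\psi(\xi-\varepsilon_{6m+2}^{-1})\quad\text{if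 } S^c\in\mathcal U ,$$ where $\psi\in\mathcal S(\mathbb R)$ with $\widehat\psi\in\mathcal D(\mathbb R)$. Then $T\in\mathcal E'(\mathbb R)\setminus\mathcal C^\infty(\mathbb R)$, but $\iota(T)=[T\ast\phi_\varepsilon]\in{}^\rho\mathcal E^\infty(\mathbb R)$.
   Context: Conventions: $\mathbb N=\{0,1,2,\dots\}$, with $0^0=1$; $\langle\xi\rangle:=(1+|\xi|^2)^{1/2}$; $\widehat{f}=\mathcal F f$ is the Fourier transform, $\widehat f(\xi)=\int_{\mathbb R}f(x)e^{-ix\xi}\,dx$, extended to tempered distributions in the usual way; $\mathcal D(\mathbb R)$ is the space of compactly supported smooth functions, $\mathcal S(\mathbb R)$ the Schwartz space, and $\mathcal E'(\mathbb R)$ the space of compactly supported distributions. A distribution is said to be in $\mathcal C^\infty(\mathbb R)$ if it is given by a smooth function. $K\subset\subset\mathbb R$ means that $K$ is a compact subset of $\mathbb R$. Since $\mathcal U$ is an ultrafilter, exactly one of $S\in\mathcal U$, $S^c\in\mathcal U$ holds. The nonstandard version of the special Colombeau algebra (for the nonstandard model constructed with the ultrafilter $\mathcal U$ on $(0,1]$, with $\rho$ the positive infinitesimal represented by $(\varepsilon)_{\varepsilon\in(0,1]}$) is the quotient ${}^\rho\mathcal E(\mathbb R)=\mathcal M(\mathbb R)/\mathcal N(\mathbb R)$, where $$\mathcal M(\mathbb R)=\{(u_\varepsilon)_\varepsilon\in\mathcal C^\infty(\mathbb R)^{(0,1]}: (\forall K\subset\subset\mathbb R)(\forall\alpha\in\mathbb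 N)(\exists N\in\mathbb N)(\exists A\in\mathcal U)(\forall\varepsilon\in A)\ \sup_{x\in K}|\partial^\alpha u_\varepsilon(x)|\le\varepsilon^{-N}\},$$ $$\mathcal N(\mathbb R)=\{(u_\varepsilon)_\varepsilon\in\mathcal C^\infty(\mathbb R)^{(0,1]}: (\forall K\subset\subset\mathbb R)(\forall\alpha\in\mathbb N)(\forall m\in\mathbb N)(\exists A\in\mathcal U)(\forall\varepsilon\in A)\ \sup_{x\in K}|\partial^\alpha u_\varepsilon(x)|\le\varepsilon^{m}\}.$$ The class of $(u_\varepsilon)_\varepsilon\in\mathcal M(\mathbb R)$ is denoted $[u_\varepsilon]$. The subalgebra ${}^\rho\mathcal E^\infty(\mathbb R)$ consists of those $u\in{}^\rho\mathcal E(\mathbb R)$ having a representative $(u_\varepsilon)_\varepsilon$ such that $$(\forall K\subset\subset\mathbb R)(\exists N\in\mathbb N)(\forall\alpha\in\mathbb N)(\exists A\in\mathcal U)(\forall\varepsilon\in A)\ \sup_{x\in K}|\partial^\alpha u_\varepsilon(x)|\le\varepsilon^{-N}.$$ An internal smooth function $\phi\in{}^*\mathcal C^\infty(\mathbb R)$ is the class modulo $\mathcal U$ (equality for all $\varepsilon$ in some set of $\mathcal U$) of a family $(\phi^{(\varepsilon)})_{\varepsilon\in(0,1]}$ in $\mathcal C^\infty(\mathbb R)$; its Fourier transform $\widehat\phi$ is taken representative-wise. The case of a fixed $\phi\in\mathcal S(\mathbb R)$ corresponds to $\phi^{(\varepsilon)}=\phi$ for all $\varepsilon$.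
   Formalization: The function ψ is additionally assumed not to be identically zero; for ψ = 0 one gets T = 0, which is smooth, so the claim that T is not in C^∞ fails. *)

theory Defs
  imports "HOL-Analysis.Analysis"
begin

section \<open>Smooth, test and Schwartz functions\<close>

definition nth_deriv :: "nat \<Rightarrow> (real \<Rightarrow> complex) \<Rightarrow> real \<Rightarrow> complex" where
  "nth_deriv k f = ((\<lambda>g x. vector_derivative g (at x)) ^^ k) f"

definition smooth_fun :: "(real \<Rightarrow> complex) \<Rightarrow> bool" where
  "smooth_fun f \<longleftrightarrow> (\<forall>k x. nth_deriv k f differentiable (at x))"

definition fun_support :: "(real \<Rightarrow> complex) \<Rightarrow> real set" where
  "fun_support f = closure {x. f x \<noteq> 0}"

definition test_funs :: "(real \<Rightarrow> complex) set" where
  "test_funs = {f. smooth_fun f \<and> compact (fun_support f)}"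

definition schwartz_funs :: "(real \<Rightarrow> complex) set" where
  "schwartz_funs =
     {f. smooth_fun f \<and> (\<forall>j k. bounded (range (\<lambda>x. \<bar>x\<bar> ^ j * norm (nth_deriv k f x))))}"


section \<open>Distributions\<close>

text \<open>A distribution is represented by a HOL function on all functions; only its values on test
  functions (for tempered distributions: on Schwartz functions) are meaningful.
  Since test functions are Schwartz functions, a tempered distribution is used as a
  distribution without an explicit restriction map.\<close>

type_synonym functional = "(real \<Rightarrow> complex) \<Rightarrow> complex"

definition linear_on_funs :: "(real \<Rightarrow> complex) set \<Rightarrow> functional \<Rightarrow> bool" where
  "linear_on_funs X T \<longleftrightarrow>
     (\<forall>f\<in>X. \<forall>g\<in>X. \<forall>a b. T (\<lambda>x. a * f x + b * g x) = a * T f + b * T g)"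

definition distribution :: "functional \<Rightarrow> bool" where
  "distribution T \<longleftrightarrow> linear_on_funs test_funs T \<and>
     (\<forall>K. compact K \<longrightarrow> (\<exists>C N. \<forall>\<theta>\<in>test_funs. fun_support \<theta> \<subseteq> K \<longrightarrow>
        norm (T \<theta>) \<le> C * (\<Sum>k\<le>N. SUP x. norm (nth_deriv k \<theta> x))))"

definition tempered_distribution :: "functional \<Rightarrow> bool" where
  "tempered_distribution T \<longleftrightarrow> linear_on_funs schwartz_funs T \<and>
     (\<exists>C N. \<forall>\<theta>\<in>schwartz_funs.
        norm (T \<theta>) \<le> C * (\<Sum>j\<le>N. \<Sum>k\<le>N. SUP x. \<bar>x\<bar> ^ j * norm (nth_deriv k \<theta> x)))"

definition dist_support :: "functional \<Rightarrow> real set" where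
  "dist_support T =
     {x. \<forall>V. open V \<and> x \<in> V \<longrightarrow> (\<exists>\<theta>\<in>test_funs. fun_support \<theta> \<subseteq> V \<and> T \<theta> \<noteq> 0)}"

definition compactly_supported_dists :: "functional set" where
  "compactly_supported_dists = {T. distribution T \<and> compact (dist_support T)}"

definition dist_given_by :: "(real \<Rightarrow> complex) \<Rightarrow> functional \<Rightarrow> bool" where
  "dist_given_by f T \<longleftrightarrow> (\<forall>\<theta>\<in>test_funs.
     integrable lborel (\<lambda>x. f x * \<theta> x) \<and> T \<theta> = (LINT x|lborel. f x * \<theta> x))"

definition tempered_given_by :: "(real \<Rightarrow> complex) \<Rightarrow> functional \<Rightarrow> bool" where
  "tempered_given_by f T \<longleftrightarrow> (\<forall>\<theta>\<in>schwartz_funs.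
     integrable lborel (\<lambda>x. f x * \<theta> x) \<and> T \<theta> = (LINT x|lborel. f x * \<theta> x))"

definition smooth_dists :: "functional set" where
  "smooth_dists = {T. \<exists>f. smooth_fun f \<and> dist_given_by f T}"


section \<open>Fourier transform\<close>

definition fourier :: "(real \<Rightarrow> complex) \<Rightarrow> real \<Rightarrow> complex" where
  "fourier f \<xi> = (LINT x|lborel. f x * exp (- (\<i> * complex_of_real (x * \<xi>))))"

definition fourier_dist :: "functional \<Rightarrow> functional" where
  "fourier_dist T = (\<lambda>\<theta>. T (fourier \<theta>))"

text \<open>The function \<open>f\<close> need not be integrable (nor polynomially bounded): it is only required to
  define a distribution that extends to a tempered one, whose Fourier transform is the
  function \<open>g\<close>. By density of the test functions the extension \<open>T\<close> is unique on Schwartz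
  functions.\<close>

definition has_fourier_fun :: "(real \<Rightarrow> complex) \<Rightarrow> (real \<Rightarrow> complex) \<Rightarrow> bool" where
  "has_fourier_fun f g \<longleftrightarrow>
     (\<exists>T. tempered_distribution T \<and> dist_given_by f T \<and> tempered_given_by g (fourier_dist T))"

definition japanese_bracket :: "real \<Rightarrow> real" where
  "japanese_bracket \<xi> = sqrt (1 + \<bar>\<xi>\<bar>\<^sup>2)"


section \<open>Convolution of a compactly supported distribution with a smooth function\<close>

definition cutoff_for :: "functional \<Rightarrow> (real \<Rightarrow> complex) \<Rightarrow> bool" where
  "cutoff_for T \<kappa> \<longleftrightarrow>
     \<kappa> \<in> test_funs \<and> (\<exists>V. open V \<and> dist_support T \<subseteq> V \<and> (\<forall>x\<in>V. \<kappa> x = 1))"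

text \<open>The canonical extension of a compactly supported distribution to smooth functions; the
  value does not depend on the chosen cutoff.\<close>

definition extend_to_smooth :: "functional \<Rightarrow> functional" where
  "extend_to_smooth T f = T (\<lambda>x. (SOME \<kappa>. cutoff_for T \<kappa>) x * f x)"

definition dist_conv :: "functional \<Rightarrow> (real \<Rightarrow> complex) \<Rightarrow> real \<Rightarrow> complex" where
  "dist_conv T f x = extend_to_smooth T (\<lambda>y. f (x - y))"


section \<open>Ultrafilters and the Colombeau algebra\<close>

text \<open>An ultrafilter on a set \<open>X\<close> is encoded as a filter on the whole type that contains \<open>X\<close>:
  a set \<open>A\<close> belongs to it iff \<open>eventually (\<lambda>x. x \<in> A) U\<close>, so that
  \<open>eventually P U\<close> says that \<open>P\<close> holds on some member of \<open>U\<close>.\<close>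

definition free_ultrafilter_on :: "'a set \<Rightarrow> 'a filter \<Rightarrow> bool" where
  "free_ultrafilter_on X U \<longleftrightarrow>
     eventually (\<lambda>x. x \<in> X) U \<and> U \<noteq> bot \<and>
     (\<forall>P. eventually P U \<or> eventually (\<lambda>x. \<not> P x) U) \<and>
     (\<forall>a. eventually (\<lambda>x. x \<noteq> a) U)"

text \<open>Nets indexed by \<open>(0,1]\<close> are total functions of \<open>\<epsilon>\<close>; values outside \<open>(0,1]\<close> are irrelevant.\<close>

type_synonym net = "real \<Rightarrow> real \<Rightarrow> complex"

definition smooth_nets :: "net set" where
  "smooth_nets = {u. \<forall>\<epsilon>\<in>{0<..1}. smooth_fun (u \<epsilon>)}"

definition moderate_nets :: "real filter \<Rightarrow> net set" where
  "moderate_nets U = {u\<in>smooth_nets. \<forall>K k. compact K \<longrightarrow>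
     (\<exists>N::nat. \<forall>\<^sub>F \<epsilon> in U. \<forall>x\<in>K. norm (nth_deriv k (u \<epsilon>) x) \<le> \<epsilon> powr (- real N))}"

definition negligible_nets :: "real filter \<Rightarrow> net set" where
  "negligible_nets U = {u\<in>smooth_nets. \<forall>K k. compact K \<longrightarrow>
     (\<forall>m::nat. \<forall>\<^sub>F \<epsilon> in U. \<forall>x\<in>K. norm (nth_deriv k (u \<epsilon>) x) \<le> \<epsilon> ^ m)}"

definition colombeau_rel :: "real filter \<Rightarrow> (net \<times> net) set" where
  "colombeau_rel U = {(u, v). u \<in> moderate_nets U \<and> v \<in> moderate_nets U \<and>
     (\<lambda>\<epsilon> x. u \<epsilon> x - v \<epsilon> x) \<in> negligible_nets U}"

definition colombeau :: "real filter \<Rightarrow> net set set" where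
  "colombeau U = moderate_nets U // colombeau_rel U"

text \<open>For a net that is not moderate this is the empty set, which is not an element of
  \<open>colombeau U\<close>.\<close>

definition colombeau_class :: "real filter \<Rightarrow> net \<Rightarrow> net set" where
  "colombeau_class U u = colombeau_rel U `` {u}"

definition colombeau_regular :: "real filter \<Rightarrow> net set set" where
  "colombeau_regular U = {c\<in>colombeau U. \<exists>u\<in>c. \<forall>K. compact K \<longrightarrow>
     (\<exists>N::nat. \<forall>k. \<forall>\<^sub>F \<epsilon> in U. \<forall>x\<in>K. norm (nth_deriv k (u \<epsilon>) x) \<le> \<epsilon> powr (- real N))}"

definition scaled_mollifier :: "net \<Rightarrow> net" where
  "scaled_mollifier \<phi> = (\<lambda>\<epsilon> x. complex_of_real (1 / \<epsilon>) * \<phi> \<epsilon> (x / \<epsilon>))"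

definition colombeau_embed :: "real filter \<Rightarrow> net \<Rightarrow> functional \<Rightarrow> net set" where
  "colombeau_embed U \<phi> T = colombeau_class U (\<lambda>\<epsilon>. dist_conv T (scaled_mollifier \<phi> \<epsilon>))"


section \<open>The lacunary sequence and the set \<open>S\<close>\<close>

definition eps_seq :: "nat \<Rightarrow> real" where
  "eps_seq n = 1 / 2 ^ (n ^ n)"

definition S_set :: "real set" where
  "S_set = (\<Union>n. {eps_seq (6 * n + 3)<..eps_seq (6 * n)})"

text \<open>If \<open>U\<close> is an ultrafilter, the second case is the one where the complement of \<open>S_set\<close>
  belongs to \<open>U\<close>.\<close>

definition T_hat :: "real filter \<Rightarrow> (real \<Rightarrow> complex) \<Rightarrow> real \<Rightarrow> complex" where
  "T_hat U \<psi> \<xi> =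
     (if eventually (\<lambda>\<epsilon>. \<epsilon> \<in> S_set) U
      then (\<Sum>m. \<psi> (\<xi> - 1 / eps_seq (6 * Suc m - 1)))
      else (\<Sum>m. \<psi> (\<xi> - 1 / eps_seq (6 * m + 2))))"

end

theory Submission
  imports Defs "HOL-Probability.Probability"
begin

text \<open>Let \<open>\<eta>\<close> be the inverse Fourier transform of \<open>\<psi>\<close>, a test function, and let \<open>a\<^sub>m\<close> be the
  frequencies occurring in \<open>T_hat\<close>. Then \<open>T\<close> is the product of \<open>\<eta>\<close> with the lacunary series
  \<open>\<Sum>m. exp (\<i> a\<^sub>m x)\<close>, whose termwise primitive converges absolutely; so \<open>T\<close> is a derivative of
  order one of a bounded function, cut off by \<open>\<eta>\<close>. Testing \<open>T\<close> against \<open>exp (- \<i> a\<^sub>M x) \<zeta> x\<close> and letting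
  \<open>M\<close> tend to infinity isolates the integral of \<open>\<eta> \<zeta>\<close>. A smooth function would give the limit zero
  by the Riemann--Lebesgue lemma, so \<open>T\<close> is not smooth; and the support of \<open>T\<close> is all of the support of
  \<open>\<eta>\<close>, so that cutoffs do not change \<open>\<eta>\<close>.

  For \<open>\<epsilon>\<close> in the set belonging to \<open>U\<close>, there is a window around \<open>1/\<epsilon>\<close> without frequencies: each \<open>a\<^sub>m\<close>
  either satisfies \<open>a\<^sub>m ^ k \<le> 1/\<epsilon>\<close>, or is so large that the decay of the Fourier transform of
  the mollifier at \<open>\<epsilon> a\<^sub>m\<close> beats every power of \<open>a\<^sub>m\<close>. Hence all derivatives of the mollified
  distribution are \<open>O(1/\<epsilon>)\<close>.\<close>

section \<open>Iterated derivatives and smooth functions\<close>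

text \<open>Two obstacles shape the route. The mollifier is only smooth, with its Fourier transform
  in the tempered sense; it need not be integrable, so no convolution theorem applies to it
  directly. It is paired instead with the test functions \<open>exp (i a_m x) * \<eta> x\<close>,
  one frequency at a time, and the results are summed. Moreover its decay is known only on members
  of \<open>U\<close>, whereas a net has to be smooth for every \<epsilon> in (0,1]; smoothness
  therefore comes from the bounded primitive, and only the estimates from the Fourier side. The
  constants: for \<epsilon> in (eps_{N+3}, eps_N] the index step 6 keeps the indices N to N+4 free
  of frequencies, with N a multiple of 6 inside S and N = 3 mod 6 outside. The exponents satisfy j *
  j^j <= N^N for j < N, and even N * j^j <= N^N, so the power k+3 of a frequency of index below N
  stays under 1/\<epsilon> once N >= k+3. This threshold may depend on k: regularity only asks that
  the exponent of 1/\<epsilon> be the same for all k, and here it is 2.\<close>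

lemma nth_deriv_0 [simp]: "nth_deriv 0 f = f"
  by (simp add: nth_deriv_def)

lemma nth_deriv_Suc: "nth_deriv (Suc k) f x = vector_derivative (nth_deriv k f) (at x)"
  by (simp add: nth_deriv_def)

lemma nth_deriv_nth_deriv: "nth_deriv k (nth_deriv j f) = nth_deriv (k + j) f"
  by (simp add: nth_deriv_def funpow_add)

lemma smooth_fun_has_vector_derivative:
  "smooth_fun f \<Longrightarrow> (nth_deriv k f has_vector_derivative nth_deriv (Suc k) f x) (at x)"
  by (simp add: smooth_fun_def nth_deriv_Suc vector_derivative_works)

lemma smooth_fun_has_vector_derivative_0:
  "smooth_fun f \<Longrightarrow> (f has_vector_derivative nth_deriv 1 f x) (at x)"
  using smooth_fun_has_vector_derivative[of f 0] by simp

lemma smooth_fun_nth_deriv: "smooth_fun f \<Longrightarrow> smooth_fun (nth_deriv k f)"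
  by (simp add: smooth_fun_def nth_deriv_nth_deriv)

lemma continuous_on_nth_deriv: "smooth_fun f \<Longrightarrow> continuous_on A (nth_deriv k f)"
  by (intro continuous_at_imp_continuous_on ballI differentiable_imp_continuous_within)
     (simp add: smooth_fun_def)

lemma continuous_on_smooth_fun: "smooth_fun f \<Longrightarrow> continuous_on A f"
  using continuous_on_nth_deriv[of f A 0] by simp

text \<open>Guess and check: a chain in which each member is the derivative of the previous one is
  determined by its start. The closed forms below for scaled, dilated and convolved functions are
  instances of \<open>F\<close>, and \<open>smooth_funI\<close> reads off smoothness from the same
  chain.\<close>

lemma nth_deriv_eqI:
  assumes "F 0 = f"
    and "\<And>k x. (F k has_vector_derivative F (Suc k) x) (at x)"
  shows "nth_deriv k f = F k"
proof (induction k)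
  case (Suc k)
  show ?case
    by (rule ext) (simp add: nth_deriv_Suc Suc vector_derivative_at[OF assms(2)])
qed (simp add: assms)

lemma smooth_funI:
  assumes "F 0 = f"
    and "\<And>k x. (F k has_vector_derivative F (Suc k) x) (at x)"
  shows "smooth_fun f"
  unfolding smooth_fun_def nth_deriv_eqI[of F, OF assms]
  by (intro allI differentiableI_vector[OF assms(2)])

lemma nth_deriv_Suc_shift: "nth_deriv (Suc k) f = nth_deriv k (nth_deriv 1 f)"
  by (simp add: nth_deriv_nth_deriv)

lemma smooth_fun_add:
  assumes "smooth_fun f" "smooth_fun g"
  shows "smooth_fun (\<lambda>x. f x + g x)"
  by (rule smooth_funI[of "\<lambda>k x. nth_deriv k f x + nth_deriv k g x"])
     (auto intro!: has_vector_derivative_add smooth_fun_has_vector_derivative assms)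

lemma smooth_fun_const: "smooth_fun (\<lambda>_. c)"
  by (rule smooth_funI[of "\<lambda>k x. if k = 0 then c else 0"]) auto

lemma
  assumes "smooth_fun f"
  shows nth_deriv_cmult: "nth_deriv k (\<lambda>x. c * f x) x = c * nth_deriv k f x"
    and smooth_fun_cmult: "smooth_fun (\<lambda>x. c * f x)"
proof -
  have *: "((\<lambda>x. c * nth_deriv k f x) has_vector_derivative c * nth_deriv (Suc k) f x) (at x)" for k x
    by (intro has_vector_derivative_mult_right smooth_fun_has_vector_derivative assms)
  show "nth_deriv k (\<lambda>x. c * f x) x = c * nth_deriv k f x"
    using nth_deriv_eqI[of "\<lambda>k x. c * nth_deriv k f x" "\<lambda>x. c * f x", OF _ *] by simp
  show "smooth_fun (\<lambda>x. c * f x)"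
    by (rule smooth_funI[of "\<lambda>k x. c * nth_deriv k f x", OF _ *]) simp
qed

lemma
  assumes "smooth_fun f"
  shows nth_deriv_affine:
      "nth_deriv k (\<lambda>x. f (a + c * x)) x = complex_of_real c ^ k * nth_deriv k f (a + c * x)"
    and smooth_fun_affine: "smooth_fun (\<lambda>x. f (a + c * x))"
proof -
  let ?F = "\<lambda>k x. complex_of_real c ^ k * nth_deriv k f (a + c * x)"
  have *: "(?F k has_vector_derivative ?F (Suc k) x) (at x)" for k x
  proof -
    have "((\<lambda>x. a + c * x) has_vector_derivative c) (at x)"
      by (auto intro!: derivative_eq_intros simp: has_real_derivative_iff_has_vector_derivative[symmetric])
    then have "((nth_deriv k f \<circ> (\<lambda>x. a + c * x)) has_vector_derivative
        c *\<^sub>R nth_deriv (Suc k) f (a + c * x)) (at x)"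
      by (rule vector_diff_chain_at) (intro smooth_fun_has_vector_derivative assms)
    from has_vector_derivative_mult_right[OF this, of "complex_of_real c ^ k"]
    show ?thesis
      by (simp add: o_def scaleR_conv_of_real mult_ac)
  qed
  show "nth_deriv k (\<lambda>x. f (a + c * x)) x = ?F k x"
    using nth_deriv_eqI[of ?F "\<lambda>x. f (a + c * x)", OF _ *] by simp
  show "smooth_fun (\<lambda>x. f (a + c * x))"
    by (rule smooth_funI[of ?F, OF _ *]) simp
qed

lemma smooth_fun_minus_arg: "smooth_fun f \<Longrightarrow> smooth_fun (\<lambda>y. f (x - y))"
  using smooth_fun_affine[of f x "-1"] by simp

lemma smooth_fun_cnj:
  assumes "smooth_fun f"
  shows "smooth_fun (\<lambda>x. cnj (f x))"
  by (rule smooth_funI[of "\<lambda>k x. cnj (nth_deriv k f x)"])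
     (auto intro!: smooth_fun_has_vector_derivative assms
       bounded_linear.has_vector_derivative[OF bounded_linear_cnj])

text \<open>Induction on the order with both factors arbitrary: the derivative of the product is
  again a sum of two products of smooth functions. This avoids the general Leibniz formula.\<close>

lemma smooth_fun_mult:
  assumes "smooth_fun f" "smooth_fun g"
  shows "smooth_fun (\<lambda>x. f x * g x)"
proof -
  \<comment> \<open>A version of additivity for finite order: inside the induction the two products
    are known to be differentiable only up to order \<open>n\<close>, so
    \<open>smooth_fun_add\<close> does not apply to them.\<close>
  have add: "\<forall>j x. j \<le> n \<longrightarrow> nth_deriv j (\<lambda>x. u x + v x) x = nth_deriv j u x + nth_deriv j v x \<and>
      nth_deriv j (\<lambda>x. u x + v x) differentiable at x"
    if "\<forall>j x. j \<le> n \<longrightarrow> nth_deriv j u differentiable at x"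
      and "\<forall>j x. j \<le> n \<longrightarrow> nth_deriv j v differentiable at x" for n u v
    using that
  proof (induction n)
    case 0
    then show ?case by auto
  next
    case (Suc n)
    have IH: "nth_deriv j (\<lambda>x. u x + v x) x = nth_deriv j u x + nth_deriv j v x" if "j \<le> n" for j x
      using Suc that by simp
    have *: "nth_deriv (Suc n) (\<lambda>x. u x + v x) x = nth_deriv (Suc n) u x + nth_deriv (Suc n) v x" for x
      unfolding nth_deriv_Suc
    proof -
      have "nth_deriv n (\<lambda>x. u x + v x) = (\<lambda>x. nth_deriv n u x + nth_deriv n v x)"
        using IH by blast
      then show "vector_derivative (nth_deriv n (\<lambda>x. u x + v x)) (at x) =
          vector_derivative (nth_deriv n u) (at x) + vector_derivative (nth_deriv n v) (at x)"
        using Suc.prems by (simp add: vector_derivative_add_at)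
    qed
    have "nth_deriv (Suc n) (\<lambda>x. u x + v x) = (\<lambda>x. nth_deriv (Suc n) u x + nth_deriv (Suc n) v x)"
      using * by auto
    with Suc * show ?case
      by (auto simp: le_Suc_eq)
  qed
  have "\<forall>j x. j \<le> n \<longrightarrow> nth_deriv j (\<lambda>x. f x * g x) differentiable at x" for n
    using assms
  proof (induction n arbitrary: f g)
    case 0
    then show ?case
      using differentiable_mult[OF differentiableI_vector[OF smooth_fun_has_vector_derivative_0]
          differentiableI_vector[OF smooth_fun_has_vector_derivative_0]] by simp
  next
    case (Suc n)
    let ?h = "\<lambda>x. f x * nth_deriv 1 g x + nth_deriv 1 f x * g x"
    have "((\<lambda>x. f x * g x) has_vector_derivative ?h x) (at x)" for x
      by (intro has_vector_derivative_mult smooth_fun_has_vector_derivative_0 Suc)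
    then have d: "nth_deriv 1 (\<lambda>x. f x * g x) = ?h"
      by (intro ext) (simp add: nth_deriv_Suc vector_derivative_at)
    have "\<forall>j x. j \<le> n \<longrightarrow> nth_deriv j ?h differentiable at x"
      using add[OF Suc.IH[OF Suc.prems(1) smooth_fun_nth_deriv[OF Suc.prems(2)]]
          Suc.IH[OF smooth_fun_nth_deriv[OF Suc.prems(1)] Suc.prems(2)]] by blast
    then have "nth_deriv (Suc j) (\<lambda>x. f x * g x) differentiable at x" if "j \<le> n" for j x
      using that unfolding nth_deriv_Suc_shift d by blast
    moreover have "nth_deriv 0 (\<lambda>x. f x * g x) differentiable at x" for x
      using Suc.IH[OF Suc.prems] by blast
    ultimately have "nth_deriv j (\<lambda>x. f x * g x) differentiable at x" if "j \<le> Suc n" for j x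
      using that by (cases j) auto
    then show ?case by blast
  qed
  then show ?thesis
    unfolding smooth_fun_def by blast
qed

lemma
  shows smooth_fun_cexp: "smooth_fun (\<lambda>x. exp (\<i> * complex_of_real (a * x)))"
    and has_vector_derivative_cexp:
      "((\<lambda>x. exp (\<i> * complex_of_real (a * x))) has_vector_derivative
          \<i> * complex_of_real a * exp (\<i> * complex_of_real (a * x))) (at x)"
proof -
  have *: "((\<lambda>x. exp (\<i> * complex_of_real (a * x))) has_vector_derivative
          \<i> * complex_of_real a * exp (\<i> * complex_of_real (a * x))) (at x)" for x
  proof -
    have "((\<lambda>x. \<i> * complex_of_real (a * x)) has_vector_derivative \<i> * complex_of_real a) (at x)"
      by (auto intro!: derivative_eq_intros simp: has_vector_derivative_def scaleR_conv_of_real)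
    from field_vector_diff_chain_at[OF this DERIV_exp] show ?thesis
      by (simp add: o_def)
  qed
  then show "((\<lambda>x. exp (\<i> * complex_of_real (a * x))) has_vector_derivative
          \<i> * complex_of_real a * exp (\<i> * complex_of_real (a * x))) (at x)" .
  show "smooth_fun (\<lambda>x. exp (\<i> * complex_of_real (a * x)))"
  proof (rule smooth_funI[of "\<lambda>k x. (\<i> * complex_of_real a)^k * exp (\<i> * complex_of_real (a * x))"])
    show "((\<lambda>x. (\<i> * complex_of_real a) ^ k * exp (\<i> * complex_of_real (a * x))) has_vector_derivative
        (\<i> * complex_of_real a) ^ Suc k * exp (\<i> * complex_of_real (a * x))) (at x)" for k x
      using has_vector_derivative_mult_right[OF *, of "(\<i> * complex_of_real a) ^ k"]
      by (simp only: power_Suc2 mult.assoc)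
  qed simp
qed

section \<open>Test functions and Schwartz functions\<close>

lemma fun_support_bounded:
  assumes "f \<in> test_funs"
  obtains R where "R > 0" "\<And>x. f x \<noteq> 0 \<Longrightarrow> \<bar>x\<bar> \<le> R"
proof -
  have "bounded (fun_support f)"
    using assms by (simp add: test_funs_def compact_imp_bounded)
  then obtain R where "R > 0" "\<forall>x\<in>fun_support f. norm x \<le> R"
    using bounded_pos by blast
  then show ?thesis
    using that[of R] closure_subset[of "{x. f x \<noteq> 0}"] by (auto simp: fun_support_def)
qed

lemma test_funsI:
  assumes "smooth_fun f" "\<And>x. f x \<noteq> 0 \<Longrightarrow> \<bar>x\<bar> \<le> R"
  shows "f \<in> test_funs"
proof -
  have "{x. f x \<noteq> 0} \<subseteq> {-R..R}"
    using assms(2) by (auto simp: abs_le_iff minus_le_iff)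
  then have "bounded {x. f x \<noteq> 0}"
    by (rule bounded_subset[OF compact_imp_bounded[OF compact_Icc]])
  then show ?thesis
    using assms(1) by (simp add: test_funs_def fun_support_def)
qed

text \<open>The complement of the support is open, so a function vanishing there has zero derivative
  there, and the argument repeats.\<close>

lemma nth_deriv_support: "nth_deriv k f x \<noteq> 0 \<Longrightarrow> x \<in> fun_support f"
proof (rule ccontr)
  assume x: "nth_deriv k f x \<noteq> 0" "x \<notin> fun_support f"
  have "\<forall>x\<in>- fun_support f. nth_deriv k f x = 0"
  proof (induction k)
    case 0
    then show ?case
      using closure_subset[of "{x. f x \<noteq> 0}"] by (auto simp: fun_support_def)
  next
    case (Suc k)
    have "open (- fun_support f)"
      by (simp add: fun_support_def open_Compl)
    then have "(nth_deriv k f has_vector_derivative 0) (at x)" if "x \<in> - fun_support f" for x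
      using has_vector_derivative_transform_within_open[of "\<lambda>_. 0" 0 x "- fun_support f" "nth_deriv k f"]
        Suc that by auto
    then show ?case
      by (simp add: nth_deriv_Suc vector_derivative_at)
  qed
  with x show False by simp
qed

lemma mult_test_funs:
  assumes "f \<in> test_funs" "smooth_fun g"
  shows "(\<lambda>x. f x * g x) \<in> test_funs"
proof -
  obtain R where "\<And>x. f x \<noteq> 0 \<Longrightarrow> \<bar>x\<bar> \<le> R"
    using fun_support_bounded[OF assms(1)] by metis
  moreover have "smooth_fun (\<lambda>x. f x * g x)"
    using assms by (intro smooth_fun_mult) (auto simp: test_funs_def)
  ultimately show ?thesis
    by (intro test_funsI[of _ R]) auto
qed

lemma affine_test_funs:
  assumes "f \<in> test_funs" "c \<noteq> 0"
  shows "(\<lambda>x. f (a + c * x)) \<in> test_funs"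
proof -
  obtain R where R: "\<And>x. f x \<noteq> 0 \<Longrightarrow> \<bar>x\<bar> \<le> R"
    using fun_support_bounded[OF assms(1)] by metis
  have "\<bar>x\<bar> \<le> (R + \<bar>a\<bar>) / \<bar>c\<bar>" if "f (a + c * x) \<noteq> 0" for x
  proof -
    have "\<bar>c * x\<bar> \<le> R + \<bar>a\<bar>"
      using R[OF that] by linarith
    then show ?thesis
      using assms(2) by (simp add: abs_mult field_simps)
  qed
  then show ?thesis
    using assms(1) by (intro test_funsI smooth_fun_affine) (auto simp: test_funs_def)
qed

lemma integrable_inverse_square_weight:
  "integrable lborel (\<lambda>x::real. 1 / (1 + \<bar>x\<bar>) ^ 2)"
proof (rule Bochner_Integration.integrable_bound)
  show "integrable lborel (\<lambda>x::real. inverse (1 + x^2))"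
    using integrable_inverse_1_plus_square by (simp add: set_integrable_def)
  show "AE x in lborel. norm (1 / (1 + \<bar>x\<bar>) ^ 2) \<le> norm (inverse (1 + x ^ 2) :: real)"
  proof (intro AE_I2)
    fix x :: real
    have "0 < 1 + x ^ 2" "1 + x ^ 2 \<le> (1 + \<bar>x\<bar>) ^ 2"
      by (simp_all add: power2_sum add_pos_nonneg)
    then show "norm (1 / (1 + \<bar>x\<bar>) ^ 2) \<le> norm (inverse (1 + x ^ 2))"
      by (simp add: inverse_eq_divide frac_le)
  qed
qed auto

lemma integrable_decay:
  fixes f :: "real \<Rightarrow> complex"
  assumes "f \<in> borel_measurable borel" "\<And>x. norm (f x) \<le> C / (1 + \<bar>x\<bar>) ^ 2"
  shows "integrable lborel f"
proof (rule Bochner_Integration.integrable_bound)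
  show "integrable lborel (\<lambda>x::real. C * (1 / (1 + \<bar>x\<bar>) ^ 2))"
    by (intro integrable_mult_right integrable_inverse_square_weight)
  show "AE x in lborel. norm (f x) \<le> norm (C * (1 / (1 + \<bar>x\<bar>) ^ 2))"
    using assms(2) order_trans[OF assms(2) abs_ge_self] by auto
qed (use assms(1) in auto)

lemma schwartz_fun_smooth: "f \<in> schwartz_funs \<Longrightarrow> smooth_fun f"
  by (simp add: schwartz_funs_def)

lemma schwartz_fun_decay:
  assumes "f \<in> schwartz_funs"
  obtains C where "C > 0" "\<And>x. norm (nth_deriv k f x) \<le> C / (1 + \<bar>x\<bar>) ^ q"
proof -
  have "\<exists>B. \<forall>x. \<bar>x\<bar> ^ j * norm (nth_deriv k f x) \<le> B" for j
  proof -
    have "bounded (range (\<lambda>x. \<bar>x\<bar> ^ j * norm (nth_deriv k f x)))"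
      using assms by (simp add: schwartz_funs_def)
    then show ?thesis
      unfolding bounded_iff by (auto simp: abs_mult)
  qed
  then obtain B where B: "\<And>j x. \<bar>x\<bar> ^ j * norm (nth_deriv k f x) \<le> B j"
    by metis
  \<comment> \<open>The factor \<open>2 ^ q\<close> comes from
    \<open>(1 + |x|) ^ q <= 2 ^ q * (1 + |x| ^ q)\<close>; the summand 1 makes \<open>C\<close>
    positive.\<close>
  define C where "C = 2 ^ q * (\<bar>B 0\<bar> + \<bar>B q\<bar>) + 1"
  have "norm (nth_deriv k f x) \<le> C / (1 + \<bar>x\<bar>) ^ q" for x
  proof -
    have "(1 + \<bar>x\<bar>) ^ q \<le> 2 ^ q * (1 + \<bar>x\<bar> ^ q)"
    proof (cases "\<bar>x\<bar> \<le> 1")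
      case True
      then have "(1 + \<bar>x\<bar>) ^ q \<le> 2 ^ q" by (intro power_mono) auto
      also have "\<dots> \<le> 2 ^ q * (1 + \<bar>x\<bar> ^ q)" by simp
      finally show ?thesis .
    next
      case False
      then have "(1 + \<bar>x\<bar>) ^ q \<le> (2 * \<bar>x\<bar>) ^ q" by (intro power_mono) auto
      then show ?thesis by (simp add: power_mult_distrib algebra_simps) (smt (verit) zero_le_power)
    qed
    then have "(1 + \<bar>x\<bar>) ^ q * norm (nth_deriv k f x) \<le> 2 ^ q * (1 + \<bar>x\<bar> ^ q) * norm (nth_deriv k f x)"
      by (intro mult_right_mono) auto
    also have "\<dots> = 2 ^ q * (\<bar>x\<bar> ^ 0 * norm (nth_deriv k f x) + \<bar>x\<bar> ^ q * norm (nth_deriv k f x))"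
      by (simp add: algebra_simps)
    also have "\<dots> \<le> 2 ^ q * (\<bar>B 0\<bar> + \<bar>B q\<bar>)"
      using B[of x 0] B[of x q] by (intro mult_left_mono add_mono) auto
    also have "\<dots> \<le> C"
      by (simp add: C_def)
    finally show ?thesis
      by (simp add: field_simps)
  qed
  moreover have "C > 0"
    unfolding C_def by (intro add_nonneg_pos mult_nonneg_nonneg) auto
  ultimately show ?thesis
    using that by blast
qed

lemma integrable_schwartz_weighted:
  assumes "f \<in> schwartz_funs"
  shows "integrable lborel (\<lambda>x. complex_of_real (x ^ j) * nth_deriv k f x)"
proof -
  obtain C where C: "C > 0" "\<And>x. norm (nth_deriv k f x) \<le> C / (1 + \<bar>x\<bar>) ^ (j + 2)"
    using schwartz_fun_decay[OF assms, where k="k" and q="j + 2"] by blast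
  show ?thesis
  proof (rule integrable_decay)
    show "norm (complex_of_real (x ^ j) * nth_deriv k f x) \<le> C / (1 + \<bar>x\<bar>) ^ 2" for x
    proof -
      have "\<bar>x\<bar> ^ j * norm (nth_deriv k f x) \<le> (1 + \<bar>x\<bar>) ^ j * (C / (1 + \<bar>x\<bar>) ^ (j + 2))"
        using C by (intro mult_mono power_mono) auto
      also have "\<dots> = C / (1 + \<bar>x\<bar>) ^ 2"
      proof -
        have "1 + \<bar>x\<bar> \<noteq> 0" by linarith
        then show ?thesis by (simp add: power_add power2_eq_square)
      qed
      finally show ?thesis
        by (simp add: norm_mult norm_power)
    qed
    show "(\<lambda>x. complex_of_real (x ^ j) * nth_deriv k f x) \<in> borel_measurable borel"
      by (intro borel_measurable_continuous_onI continuous_intros continuous_on_nth_deriv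
          schwartz_fun_smooth assms)
  qed
qed

lemma integrable_schwartz_nth_deriv: "f \<in> schwartz_funs \<Longrightarrow> integrable lborel (nth_deriv k f)"
  using integrable_schwartz_weighted[of f 0] by simp

lemma integrable_schwartz: "f \<in> schwartz_funs \<Longrightarrow> integrable lborel f"
  using integrable_schwartz_weighted[of f 0 0] by simp

lemma schwartz_funsI:
  assumes "smooth_fun f" "\<And>j k. \<exists>C. \<forall>x. \<bar>x\<bar> ^ j * norm (nth_deriv k f x) \<le> C"
  shows "f \<in> schwartz_funs"
proof -
  have "bounded (range (\<lambda>x. \<bar>x\<bar> ^ j * norm (nth_deriv k f x)))" for j k
  proof -
    obtain C where "\<And>x. \<bar>x\<bar> ^ j * norm (nth_deriv k f x) \<le> C"
      using assms(2) by metis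
    then show ?thesis
      by (intro boundedI[of _ C]) auto
  qed
  then show ?thesis
    using assms(1) by (simp add: schwartz_funs_def)
qed

lemma test_funs_subset_schwartz: "test_funs \<subseteq> schwartz_funs"
proof
  fix f assume f: "f \<in> test_funs"
  then have sm: "smooth_fun f" and K: "compact (fun_support f)"
    by (auto simp: test_funs_def)
  show "f \<in> schwartz_funs"
  proof (rule schwartz_funsI[OF sm])
    fix j k
    have "compact ((\<lambda>x. \<bar>x\<bar> ^ j * norm (nth_deriv k f x)) ` fun_support f)"
      by (intro compact_continuous_image continuous_intros continuous_on_nth_deriv sm K)
    from compact_imp_bounded[OF this] obtain C
      where C: "\<forall>y\<in>(\<lambda>x. \<bar>x\<bar> ^ j * norm (nth_deriv k f x)) ` fun_support f. norm y \<le> C"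
      unfolding bounded_iff by (elim exE)
    have "\<bar>x\<bar> ^ j * norm (nth_deriv k f x) \<le> max C 0" for x
      using bspec[OF C imageI, of x] nth_deriv_support[of k f x]
      by (cases "nth_deriv k f x = 0") (auto simp: abs_mult)
    then show "\<exists>C. \<forall>x. \<bar>x\<bar> ^ j * norm (nth_deriv k f x) \<le> C" by blast
  qed
qed

lemma schwartz_nth_deriv: "f \<in> schwartz_funs \<Longrightarrow> nth_deriv i f \<in> schwartz_funs"
  by (simp add: schwartz_funs_def smooth_fun_nth_deriv nth_deriv_nth_deriv)

lemma schwartz_cmult:
  assumes "f \<in> schwartz_funs"
  shows "(\<lambda>x. c * f x) \<in> schwartz_funs"
proof (rule schwartz_funsI)
  show "smooth_fun (\<lambda>x. c * f x)"
    using assms by (simp add: schwartz_fun_smooth smooth_fun_cmult)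
  fix j k
  obtain C where C: "\<And>x. norm (nth_deriv k f x) \<le> C / (1 + \<bar>x\<bar>) ^ j" "C > 0"
    using schwartz_fun_decay[OF assms, where k="k" and q="j"] by blast
  have "\<bar>x\<bar> ^ j * norm (nth_deriv k (\<lambda>x. c * f x) x) \<le> norm c * C" for x
  proof -
    have "\<bar>x\<bar> ^ j * norm (nth_deriv k f x) \<le> (1 + \<bar>x\<bar>) ^ j * (C / (1 + \<bar>x\<bar>) ^ j)"
      using C by (intro mult_mono power_mono) auto
    then have "\<bar>x\<bar> ^ j * norm (nth_deriv k f x) \<le> C"
      by simp
    from mult_left_mono[OF this, of "norm c"] show ?thesis
      by (simp add: nth_deriv_cmult schwartz_fun_smooth assms norm_mult mult_ac)
  qed
  then show "\<exists>C. \<forall>x. \<bar>x\<bar> ^ j * norm (nth_deriv k (\<lambda>x. c * f x) x) \<le> C" by blast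
qed

lemma schwartz_affine:
  assumes f: "f \<in> schwartz_funs" and c: "c \<noteq> 0"
  shows "(\<lambda>x. f (a + c * x)) \<in> schwartz_funs"
proof (rule schwartz_funsI)
  show "smooth_fun (\<lambda>x. f (a + c * x))"
    using f by (simp add: schwartz_fun_smooth smooth_fun_affine)
  fix j k
  obtain C where C: "\<And>x. norm (nth_deriv k f x) \<le> C / (1 + \<bar>x\<bar>) ^ j" "C > 0"
    using schwartz_fun_decay[OF f, where k="k" and q="j"] by blast
  let ?B = "(1 + \<bar>a\<bar>) / \<bar>c\<bar>"
  have "\<bar>x\<bar> ^ j * norm (nth_deriv k (\<lambda>x. f (a + c * x)) x) \<le> \<bar>c\<bar> ^ k * (?B ^ j * C)" for x
  proof -
    let ?z = "a + c * x"
    have "\<bar>c\<bar> * \<bar>x\<bar> \<le> \<bar>?z\<bar> + \<bar>a\<bar>"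
      by (simp add: abs_mult[symmetric])
    also have "\<dots> \<le> (1 + \<bar>a\<bar>) * (1 + \<bar>?z\<bar>)"
      by (simp add: algebra_simps)
    finally have "\<bar>x\<bar> \<le> ?B * (1 + \<bar>?z\<bar>)"
      using c by (simp add: field_simps)
    then have "\<bar>x\<bar> ^ j * norm (nth_deriv k f ?z) \<le> (?B * (1 + \<bar>?z\<bar>)) ^ j * (C / (1 + \<bar>?z\<bar>) ^ j)"
      using C by (intro mult_mono power_mono) auto
    also have "\<dots> = ?B ^ j * C"
    proof -
      have "(1 + \<bar>?z\<bar>) ^ j \<noteq> 0" by auto
      then show ?thesis unfolding power_mult_distrib by simp
    qed
    finally have "\<bar>x\<bar> ^ j * norm (nth_deriv k f ?z) \<le> ?B ^ j * C" .
    from mult_left_mono[OF this, of "\<bar>c\<bar> ^ k"] show ?thesis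
      unfolding nth_deriv_affine[OF schwartz_fun_smooth[OF f]] by (simp add: norm_mult norm_power mult_ac)
  qed
  then show "\<exists>C. \<forall>x. \<bar>x\<bar> ^ j * norm (nth_deriv k (\<lambda>x. f (a + c * x)) x) \<le> C" by blast
qed

lemma schwartz_mult_id:
  assumes f: "f \<in> schwartz_funs"
  shows "(\<lambda>x. complex_of_real x * f x) \<in> schwartz_funs"
proof -
  note sm = schwartz_fun_smooth[OF f]
  \<comment> \<open>Leibniz formula with a factor whose second derivative vanishes. At
    \<open>k = 0\<close> the truncated \<open>k - 1\<close> is 0, and the factor
    \<open>of_nat k\<close> removes that term.\<close>
  let ?F = "\<lambda>k x. complex_of_real x * nth_deriv k f x + of_nat k * nth_deriv (k - 1) f x"
  have *: "(?F k has_vector_derivative ?F (Suc k) x) (at x)" for k x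
  proof -
    have "((\<lambda>x. complex_of_real x) has_vector_derivative 1) (at x)"
      by (auto intro!: derivative_eq_intros simp: has_vector_derivative_def scaleR_conv_of_real)
    from has_vector_derivative_mult[OF this smooth_fun_has_vector_derivative[OF sm, of k]]
    have 1: "((\<lambda>x. complex_of_real x * nth_deriv k f x) has_vector_derivative
        complex_of_real x * nth_deriv (Suc k) f x + nth_deriv k f x) (at x)"
      by simp
    have 2: "((\<lambda>x. of_nat k * nth_deriv (k - 1) f x) has_vector_derivative
        of_nat k * nth_deriv k f x) (at x)"
      using has_vector_derivative_mult_right[OF smooth_fun_has_vector_derivative[OF sm, of "k - 1"], of "of_nat k" x]
      by (cases k) auto
    from has_vector_derivative_add[OF 1 2] show ?thesis
      by (simp add: algebra_simps)
  qed
  have eq: "nth_deriv k (\<lambda>x. complex_of_real x * f x) x = ?F k x" for k x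
    using nth_deriv_eqI[of ?F "\<lambda>x. complex_of_real x * f x", OF _ *] by simp
  show ?thesis
  proof (rule schwartz_funsI)
    show "smooth_fun (\<lambda>x. complex_of_real x * f x)"
      by (rule smooth_funI[of ?F, OF _ *]) simp
    fix j k
    obtain C where C: "\<And>x. norm (nth_deriv k f x) \<le> C / (1 + \<bar>x\<bar>) ^ Suc j" "C > 0"
      using schwartz_fun_decay[OF f, where k="k" and q="Suc j"] by blast
    obtain D where D: "\<And>x. norm (nth_deriv (k-1) f x) \<le> D / (1 + \<bar>x\<bar>) ^ j" "D > 0"
      using schwartz_fun_decay[OF f, where k="k - 1" and q="j"] by blast
    have "\<bar>x\<bar> ^ j * norm (nth_deriv k (\<lambda>x. complex_of_real x * f x) x) \<le> C + real k * D" for x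
    proof -
      have "\<bar>x\<bar> ^ Suc j * norm (nth_deriv k f x) \<le> (1 + \<bar>x\<bar>) ^ Suc j * (C / (1 + \<bar>x\<bar>) ^ Suc j)"
        using C by (intro mult_mono power_mono) auto
      then have 1: "\<bar>x\<bar> ^ Suc j * norm (nth_deriv k f x) \<le> C"
        by simp
      have "\<bar>x\<bar> ^ j * norm (nth_deriv (k-1) f x) \<le> (1 + \<bar>x\<bar>) ^ j * (D / (1 + \<bar>x\<bar>) ^ j)"
        using D by (intro mult_mono power_mono) auto
      then have 2: "\<bar>x\<bar> ^ j * norm (nth_deriv (k-1) f x) \<le> D"
        by simp
      have "norm (?F k x) \<le> \<bar>x\<bar> * norm (nth_deriv k f x) + real k * norm (nth_deriv (k - 1) f x)"
        by (rule norm_triangle_le) (simp add: norm_mult)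
      then have "\<bar>x\<bar> ^ j * norm (?F k x) \<le>
          \<bar>x\<bar> ^ j * (\<bar>x\<bar> * norm (nth_deriv k f x) + real k * norm (nth_deriv (k - 1) f x))"
        by (intro mult_left_mono) auto
      also have "\<dots> = \<bar>x\<bar> ^ Suc j * norm (nth_deriv k f x) + real k * (\<bar>x\<bar> ^ j * norm (nth_deriv (k-1) f x))"
        by (simp add: algebra_simps)
      also have "\<dots> \<le> C + real k * D"
        using 1 2 by (intro add_mono mult_left_mono) auto
      finally show ?thesis by (simp add: eq)
    qed
    then show "\<exists>C. \<forall>x. \<bar>x\<bar> ^ j * norm (nth_deriv k (\<lambda>x. complex_of_real x * f x) x) \<le> C" by blast
  qed
qed

lemma schwartz_mult_power:
  assumes "f \<in> schwartz_funs"
  shows "(\<lambda>x. complex_of_real (x ^ k) * f x) \<in> schwartz_funs"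
proof (induction k)
  case (Suc k)
  from schwartz_mult_id[OF this] show ?case
    by (simp add: mult.assoc)
qed (use assms in simp)

section \<open>Integrals depending on a parameter\<close>

text \<open>Differentiation under the integral sign by dominated convergence of difference
  quotients. It serves both the Fourier transform and the convolution.\<close>

lemma has_vector_derivative_integral:
  fixes f f' :: "real \<Rightarrow> 'a \<Rightarrow> complex"
  assumes r: "r > 0"
    and int: "\<And>t. t \<in> ball t0 r \<Longrightarrow> integrable M (f t)"
    and der: "\<And>t x. t \<in> ball t0 r \<Longrightarrow> x \<in> space M \<Longrightarrow> ((\<lambda>t. f t x) has_vector_derivative f' t x) (at t)"
    and bnd: "\<And>t x. t \<in> ball t0 r \<Longrightarrow> x \<in> space M \<Longrightarrow> norm (f' t x) \<le> w x"
    and w: "integrable M w"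
    and meas: "f' t0 \<in> borel_measurable M"
  shows "((\<lambda>t. integral\<^sup>L M (f t)) has_vector_derivative integral\<^sup>L M (f' t0)) (at t0)"
proof -
  let ?F = "\<lambda>t. integral\<^sup>L M (f t)" and ?D = "integral\<^sup>L M (f' t0)"
  have t0: "t0 \<in> ball t0 r" using r by simp
  \<comment> \<open>The mean value inequality on the convex ball turns the bound on
    \<open>f'\<close> into a bound on difference quotients, so the same \<open>w\<close> dominates
    them.\<close>
  have lip: "norm (f t x - f t0 x) \<le> w x * \<bar>t - t0\<bar>" if "t \<in> ball t0 r" "x \<in> space M" for t x
  proof -
    have "norm (f t x - f t0 x) \<le> w x * norm (t - t0)"
    proof (rule differentiable_bound[where S="ball t0 r" and f'="\<lambda>t h. h *\<^sub>R f' t x"])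
      fix s assume s: "s \<in> ball t0 r"
      show "((\<lambda>t. f t x) has_derivative (\<lambda>h. h *\<^sub>R f' s x)) (at s within ball t0 r)"
        using der[OF s that(2)] unfolding has_vector_derivative_def by (rule has_derivative_at_withinI)
      have "0 \<le> w x" using bnd[OF s that(2)] norm_ge_zero by (rule order_trans[rotated])
      then show "onorm (\<lambda>h. h *\<^sub>R f' s x) \<le> w x"
        by (rule onorm_bound) (use bnd[OF s that(2)] in \<open>auto simp: mult.commute intro!: mult_left_mono\<close>)
    qed (use that t0 in auto)
    then show ?thesis by simp
  qed
  \<comment> \<open>The limit is first taken within the ball, so that every sequence considered
    stays where the hypotheses hold.\<close>
  have "((\<lambda>t. (?F t - ?F t0) /\<^sub>R (t - t0)) \<longlongrightarrow> ?D) (at t0 within ball t0 r)"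
    unfolding tendsto_at_iff_sequentially
  proof (intro allI impI)
    fix X :: "nat \<Rightarrow> real" assume X: "\<forall>i. X i \<in> ball t0 r - {t0}" and lim: "X \<longlonglongrightarrow> t0"
    let ?q = "\<lambda>i x. (f (X i) x - f t0 x) /\<^sub>R (X i - t0)"
    have "(\<lambda>i. integral\<^sup>L M (?q i)) \<longlonglongrightarrow> ?D"
    proof (rule integral_dominated_convergence[OF meas _ w])
      show "?q i \<in> borel_measurable M" for i
      proof -
        have "X i \<in> ball t0 r" using X by auto
        from borel_measurable_integrable[OF int[OF this]] borel_measurable_integrable[OF int[OF t0]]
        show ?thesis by measurable
      qed
      show "AE x in M. (\<lambda>i. ?q i x) \<longlonglongrightarrow> f' t0 x"
      proof (intro AE_I2)
        fix x assume x: "x \<in> space M"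
        have "((\<lambda>t. norm ((f t x - f t0 x) - (t - t0) *\<^sub>R f' t0 x) / norm (t - t0)) \<longlongrightarrow> 0) (at t0)"
          using der[OF t0 x] unfolding has_vector_derivative_def has_derivative_iff_norm by blast
        then have "(\<lambda>i. norm ((f (X i) x - f t0 x) - (X i - t0) *\<^sub>R f' t0 x) / norm (X i - t0)) \<longlonglongrightarrow> 0"
          using X lim unfolding tendsto_at_iff_sequentially by (auto simp: comp_def)
        moreover have "norm ((f (X i) x - f t0 x) - (X i - t0) *\<^sub>R f' t0 x) / norm (X i - t0)
            = norm (?q i x - f' t0 x)" for i
        proof -
          have "X i - t0 \<noteq> 0" using X by auto
          then have "?q i x - f' t0 x = ((f (X i) x - f t0 x) - (X i - t0) *\<^sub>R f' t0 x) /\<^sub>R (X i - t0)"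
            by (simp add: scaleR_diff_right del: right_minus_eq)
          then show ?thesis by (simp add: divide_inverse mult.commute)
        qed
        ultimately have "(\<lambda>i. norm (?q i x - f' t0 x)) \<longlonglongrightarrow> 0" by simp
        then show "(\<lambda>i. ?q i x) \<longlonglongrightarrow> f' t0 x"
          by (simp add: tendsto_norm_zero_iff LIM_zero_iff)
      qed
      show "AE x in M. norm (?q i x) \<le> w x" for i
      proof (intro AE_I2)
        fix x assume x: "x \<in> space M"
        have Xi: "X i \<in> ball t0 r" "X i - t0 \<noteq> 0" using X by auto
        show "norm (?q i x) \<le> w x"
        proof -
          have "norm (?q i x) = norm (f (X i) x - f t0 x) / \<bar>X i - t0\<bar>"
            unfolding norm_scaleR by (simp add: divide_inverse mult.commute)
          then show ?thesis
            using lip[OF Xi(1) x] Xi(2) by (simp add: pos_divide_le_eq)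
        qed
      qed
    qed
    moreover have "integral\<^sup>L M (?q i) = (?F (X i) - ?F t0) /\<^sub>R (X i - t0)" for i
      using int[of "X i"] int[OF t0] X by simp
    ultimately show "((\<lambda>t. (?F t - ?F t0) /\<^sub>R (t - t0)) \<circ> X) \<longlonglongrightarrow> ?D"
      by (simp only: comp_def)
  qed
  then have "((\<lambda>t. (?F t - ?F t0) /\<^sub>R (t - t0)) \<longlongrightarrow> ?D) (at t0)"
    using at_within_open[OF t0 open_ball] by simp
  then have "((\<lambda>t. norm ((?F t - ?F t0) /\<^sub>R (t - t0) - ?D)) \<longlongrightarrow> 0) (at t0)"
    by (simp add: tendsto_norm_zero_iff LIM_zero_iff)
  then have "((\<lambda>t. norm ((?F t - ?F t0) - (t - t0) *\<^sub>R ?D) / norm (t - t0)) \<longlongrightarrow> 0) (at t0)"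
  proof (rule Lim_transform_eventually)
    show "\<forall>\<^sub>F t in at t0. norm ((?F t - ?F t0) /\<^sub>R (t - t0) - ?D)
        = norm ((?F t - ?F t0) - (t - t0) *\<^sub>R ?D) / norm (t - t0)"
      unfolding eventually_at_filter
    proof (intro always_eventually allI impI)
      fix t assume "t \<noteq> t0"
      then have "t - t0 \<noteq> 0" by simp
      then have "(?F t - ?F t0) /\<^sub>R (t - t0) - ?D = ((?F t - ?F t0) - (t - t0) *\<^sub>R ?D) /\<^sub>R (t - t0)"
        by (simp add: scaleR_diff_right del: right_minus_eq)
      then show "norm ((?F t - ?F t0) /\<^sub>R (t - t0) - ?D)
        = norm ((?F t - ?F t0) - (t - t0) *\<^sub>R ?D) / norm (t - t0)"
        by (simp add: divide_inverse mult.commute)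
    qed
  qed
  then show ?thesis
    unfolding has_vector_derivative_def has_derivative_iff_norm
    by (simp add: bounded_linear_scaleR_left)
qed

lemma integrable_prod_kernel:
  fixes f g :: "real \<Rightarrow> complex"
  assumes f: "integrable lborel f" and g: "integrable lborel g"
    and K[measurable]: "case_prod K \<in> borel_measurable (lborel \<Otimes>\<^sub>M lborel)"
    and K1: "\<And>x y. norm (K x y) \<le> (1::real)"
  shows "integrable (lborel \<Otimes>\<^sub>M lborel) (\<lambda>(x, y). f x * g y * K x y)"
proof (rule Bochner_Integration.integrable_bound)
  have [measurable]: "f \<in> borel_measurable lborel" "g \<in> borel_measurable lborel"
    using f g by auto
  show "integrable (lborel \<Otimes>\<^sub>M lborel) (\<lambda>p. f (fst p) * g (snd p))"
  proof (rule lborel_pair.Fubini_integrable)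
    show "integrable lborel (\<lambda>x. LINT y|lborel. norm (f (fst (x, y)) * g (snd (x, y))))"
      using f g by (simp add: norm_mult)
    show "AE x in lborel. integrable lborel (\<lambda>y. f (fst (x, y)) * g (snd (x, y)))"
      using g by simp
  qed measurable
  show "(\<lambda>(x, y). f x * g y * K x y) \<in> borel_measurable (lborel \<Otimes>\<^sub>M lborel)"
    by measurable
  show "AE p in lborel \<Otimes>\<^sub>M lborel. norm (case p of (x, y) \<Rightarrow> f x * g y * K x y) \<le> norm (f (fst p) * g (snd p))"
    using K1 by (auto simp: norm_mult mult_left_le)
qed

text \<open>Integration by parts without boundary terms: for \<open>F\<close> a product,
  \<open>f\<close> is the two-term product rule.\<close>

lemma integral_derivative_eq_0:
  fixes F f :: "real \<Rightarrow> complex"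
  assumes F: "\<And>x. (F has_vector_derivative f x) (at x)"
    and cont: "continuous_on UNIV f" and int: "integrable lborel f"
    and top: "(F \<longlongrightarrow> 0) at_top" and bot: "(F \<longlongrightarrow> 0) at_bot"
  shows "integral\<^sup>L lborel f = 0"
proof -
  have "(LBINT x=-\<infinity>..\<infinity>. f x) = 0 - 0"
  proof (rule interval_integral_FTC_integrable[of _ _ F])
    show "((F \<circ> real_of_ereal) \<longlongrightarrow> 0) (at_right (- \<infinity>))"
      using bot by (simp add: ereal_tendsto_simps)
    show "((F \<circ> real_of_ereal) \<longlongrightarrow> 0) (at_left \<infinity>)"
      using top by (simp add: ereal_tendsto_simps)
    show "set_integrable lborel (einterval (- \<infinity>) \<infinity>) f"
      using int by (simp add: set_integrable_def)
  qed (use F cont in \<open>auto simp: continuous_on_eq_continuous_at\<close>)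
  then show ?thesis
    by (simp add: interval_lebesgue_integral_def set_lebesgue_integral_def)
qed

section \<open>The Fourier transform\<close>

lemma exp_cis_measurable [measurable]:
  "(\<lambda>x. exp (- (\<i> * complex_of_real (x * \<xi>)))) \<in> borel_measurable borel"
  by (intro borel_measurable_continuous_onI continuous_intros)

lemma norm_exp_minus_i [simp]: "norm (exp (- (\<i> * complex_of_real t))) = 1"
  using norm_exp_i_times[of "- t"] by simp

lemma integrable_mult_unimodular:
  fixes f :: "real \<Rightarrow> complex"
  assumes "integrable lborel f" "g \<in> borel_measurable borel" "\<And>x. norm (g x) \<le> 1"
  shows "integrable lborel (\<lambda>x. f x * g x)"
proof (rule Bochner_Integration.integrable_bound[OF assms(1)])
  show "AE x in lborel. norm (f x * g x) \<le> norm (f x)"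
    using assms(3) by (auto simp: norm_mult mult_left_le)
qed (use assms in auto)

lemma integrable_fourier_integrand:
  "integrable lborel f \<Longrightarrow> integrable lborel (\<lambda>x. f x * exp (- (\<i> * complex_of_real (x * \<xi>))))"
  by (rule integrable_mult_unimodular) auto

lemma norm_fourier_le: "norm (fourier f \<xi>) \<le> (LINT x|lborel. norm (f x))"
proof -
  have "norm (fourier f \<xi>) \<le> (LINT x|lborel. norm (f x * exp (- (\<i> * complex_of_real (x * \<xi>)))))"
    unfolding fourier_def by (rule integral_norm_bound)
  then show ?thesis by (simp only: norm_mult norm_exp_minus_i mult_1_right)
qed

lemma has_vector_derivative_fourier:
  assumes f: "integrable lborel f" and xf: "integrable lborel (\<lambda>x. complex_of_real x * f x)"
  shows "(fourier f has_vector_derivative fourier (\<lambda>x. - \<i> * complex_of_real x * f x) \<xi>) (at \<xi>)"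
  unfolding fourier_def
proof (rule has_vector_derivative_integral[where r=1 and w="\<lambda>x. norm (complex_of_real x * f x)"])
  fix t x :: real
  have "((\<lambda>t. exp (\<i> * complex_of_real (- x * t))) has_vector_derivative
      \<i> * complex_of_real (- x) * exp (\<i> * complex_of_real (- x * t))) (at t)"
    by (rule has_vector_derivative_cexp)
  from has_vector_derivative_mult_right[OF this, of "f x"]
  show "((\<lambda>t. f x * exp (- (\<i> * complex_of_real (x * t)))) has_vector_derivative
     - \<i> * complex_of_real x * f x * exp (- (\<i> * complex_of_real (x * t)))) (at t)"
    by (simp add: mult_ac)
  show "norm (- \<i> * complex_of_real x * f x * exp (- (\<i> * complex_of_real (x * t))))
      \<le> norm (complex_of_real x * f x)"
    unfolding norm_mult norm_exp_minus_i by simp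
next
  have "integrable lborel (\<lambda>x. - \<i> * (complex_of_real x * f x))"
    using xf by simp
  from borel_measurable_integrable[OF integrable_fourier_integrand[OF this]]
  show "(\<lambda>x. - \<i> * complex_of_real x * f x * exp (- (\<i> * complex_of_real (x * \<xi>)))) \<in> borel_measurable lborel"
    by (simp add: mult.assoc)
qed (use f xf integrable_fourier_integrand integrable_norm[OF xf] in auto)

text \<open>Only the moments up to order \<open>k\<close> are assumed, since on the mollified side
  the estimates for order \<open>k\<close> control no further moments.\<close>

lemma nth_deriv_fourier:
  assumes "\<And>j. j \<le> k \<Longrightarrow> integrable lborel (\<lambda>x. complex_of_real (x ^ j) * f x)"
  shows "nth_deriv k (fourier f) = fourier (\<lambda>x. (- \<i>) ^ k * complex_of_real (x ^ k) * f x)"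
  using assms
proof (induction k)
  case (Suc k)
  let ?g = "\<lambda>x. (- \<i>) ^ k * complex_of_real (x ^ k) * f x"
  have "integrable lborel (\<lambda>x. (- \<i>) ^ k * (complex_of_real (x ^ k) * f x))"
    using Suc.prems[of k] by (intro integrable_mult_right) auto
  then have 1: "integrable lborel ?g" by (simp add: mult.assoc)
  have "integrable lborel (\<lambda>x. (- \<i>) ^ k * (complex_of_real (x ^ Suc k) * f x))"
    using Suc.prems[of "Suc k"] by (intro integrable_mult_right) auto
  then have 2: "integrable lborel (\<lambda>x. complex_of_real x * ?g x)" by (simp add: mult_ac)
  have "nth_deriv k (fourier f) = fourier ?g"
    using Suc by simp
  then have "nth_deriv (Suc k) (fourier f) \<xi> = fourier (\<lambda>x. - \<i> * complex_of_real x * ?g x) \<xi>" for \<xi>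
    unfolding nth_deriv_Suc by (simp only: vector_derivative_at[OF has_vector_derivative_fourier[OF 1 2]])
  moreover have "- \<i> * complex_of_real x * ?g x = (- \<i>) ^ Suc k * complex_of_real (x ^ Suc k) * f x" for x
    by (simp add: mult_ac)
  ultimately show ?case
    by (simp only: ext)
qed simp

lemma smooth_fun_fourier:
  assumes "\<And>j. integrable lborel (\<lambda>x. complex_of_real (x ^ j) * f x)"
  shows "smooth_fun (fourier f)"
  unfolding smooth_fun_def
proof (intro allI)
  fix k \<xi>
  let ?g = "\<lambda>x. (- \<i>) ^ k * complex_of_real (x ^ k) * f x"
  have "integrable lborel (\<lambda>x. (- \<i>) ^ k * (complex_of_real (x ^ k) * f x))"
    by (intro integrable_mult_right assms)
  then have 1: "integrable lborel ?g" by (simp add: mult.assoc)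
  have "integrable lborel (\<lambda>x. (- \<i>) ^ k * (complex_of_real (x ^ Suc k) * f x))"
    by (intro integrable_mult_right assms)
  then have 2: "integrable lborel (\<lambda>x. complex_of_real x * ?g x)" by (simp add: mult_ac)
  show "nth_deriv k (fourier f) differentiable at \<xi>"
    unfolding nth_deriv_fourier[OF assms]
    by (rule differentiableI_vector[OF has_vector_derivative_fourier[OF 1 2]])
qed

lemma schwartz_tendsto_0:
  assumes "f \<in> schwartz_funs"
  shows "(f \<longlongrightarrow> 0) at_top" "(f \<longlongrightarrow> 0) at_bot"
proof -
  obtain C where C: "C > 0" "\<And>x. norm (nth_deriv 0 f x) \<le> C / (1 + \<bar>x\<bar>) ^ 1"
    using schwartz_fun_decay[OF assms, where k=0 and q=1] by blast
  have 1: "((\<lambda>x::real. C / (1 + \<bar>x\<bar>)) \<longlongrightarrow> 0) at_top" by real_asymp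
  have 2: "((\<lambda>x::real. C / (1 + \<bar>x\<bar>)) \<longlongrightarrow> 0) at_bot" by real_asymp
  show "(f \<longlongrightarrow> 0) at_top" "(f \<longlongrightarrow> 0) at_bot"
    using C by (auto intro: Lim_null_comparison[OF _ 1] Lim_null_comparison[OF _ 2])
qed

lemma fourier_deriv:
  assumes f: "f \<in> schwartz_funs"
  shows "fourier (nth_deriv 1 f) \<xi> = \<i> * complex_of_real \<xi> * fourier f \<xi>"
proof -
  note sm = schwartz_fun_smooth[OF f]
  let ?e = "\<lambda>x. exp (\<i> * complex_of_real (- \<xi> * x))"
  let ?D = "\<lambda>x. f x * (\<i> * complex_of_real (- \<xi>) * ?e x) + nth_deriv 1 f x * ?e x"
  have eq: "?e x = exp (- (\<i> * complex_of_real (x * \<xi>)))" for x by (simp add: mult.commute)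
  have i1: "integrable lborel (\<lambda>x. nth_deriv 1 f x * ?e x)"
    unfolding eq by (intro integrable_fourier_integrand integrable_schwartz_nth_deriv f)
  have i2: "integrable lborel (\<lambda>x. (\<i> * complex_of_real (- \<xi>)) * (f x * ?e x))"
    unfolding eq by (intro integrable_mult_right integrable_fourier_integrand integrable_schwartz f)
  have i2': "integrable lborel (\<lambda>x. f x * (\<i> * complex_of_real (- \<xi>) * ?e x))"
    using i2 by (simp only: mult_ac)
  have "integral\<^sup>L lborel ?D = 0"
  proof (rule integral_derivative_eq_0[where F="\<lambda>x. f x * ?e x"])
    show "((\<lambda>x. f x * ?e x) has_vector_derivative ?D x) (at x)" for x
      by (intro has_vector_derivative_mult smooth_fun_has_vector_derivative_0 sm has_vector_derivative_cexp)
    show "continuous_on UNIV ?D"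
      by (intro continuous_intros continuous_on_nth_deriv continuous_on_smooth_fun sm)
    show "integrable lborel ?D"
      using i2' i1 by (rule Bochner_Integration.integrable_add)
    have n: "norm (f x * ?e x) = norm (f x)" for x
      unfolding norm_mult norm_exp_i_times by simp
    show "((\<lambda>x. f x * ?e x) \<longlongrightarrow> 0) at_top" "((\<lambda>x. f x * ?e x) \<longlongrightarrow> 0) at_bot"
      using schwartz_tendsto_0[OF f]
      by (auto intro!: tendsto_norm_zero_cancel[of "\<lambda>x. f x * ?e x"] simp only: n intro: tendsto_norm_zero)
  qed
  also have "integral\<^sup>L lborel ?D = (LINT x|lborel. f x * (\<i> * complex_of_real (- \<xi>) * ?e x))
      + (LINT x|lborel. nth_deriv 1 f x * ?e x)"
    by (rule Bochner_Integration.integral_add[OF i2' i1])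
  also have "(LINT x|lborel. f x * (\<i> * complex_of_real (- \<xi>) * ?e x)) =
      (LINT x|lborel. (\<i> * complex_of_real (- \<xi>)) * (f x * ?e x))"
    by (simp only: mult_ac)
  also have "\<dots> = (\<i> * complex_of_real (- \<xi>)) * fourier f \<xi>"
    unfolding fourier_def eq by (rule integral_mult_right_zero)
  also have "(LINT x|lborel. nth_deriv 1 f x * ?e x) = fourier (nth_deriv 1 f) \<xi>"
    unfolding fourier_def eq ..
  finally show ?thesis by (simp add: algebra_simps)
qed

lemma fourier_nth_deriv:
  assumes "f \<in> schwartz_funs"
  shows "fourier (nth_deriv k f) \<xi> = (\<i> * complex_of_real \<xi>) ^ k * fourier f \<xi>"
proof (induction k)
  case (Suc k)
  have "nth_deriv (Suc k) f = nth_deriv 1 (nth_deriv k f)"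
    by (simp add: nth_deriv_nth_deriv)
  then show ?case
    using fourier_deriv[OF schwartz_nth_deriv[OF assms], of k \<xi>] Suc by simp
qed simp

text \<open>Derivatives of the transform become powers of \<open>x\<close> inside, and powers of
  \<xi> outside become derivatives inside. Each seminorm is thus bounded by an L1 norm of a Schwartz
  function.\<close>

lemma fourier_schwartz:
  assumes f: "f \<in> schwartz_funs"
  shows "fourier f \<in> schwartz_funs"
proof (rule schwartz_funsI)
  have int: "integrable lborel (\<lambda>x. complex_of_real (x ^ j) * f x)" for j
    using integrable_schwartz_weighted[OF f, of j 0] by simp
  show "smooth_fun (fourier f)"
    by (rule smooth_fun_fourier[OF int])
  fix j k
  let ?g = "\<lambda>x. (- \<i>) ^ k * (complex_of_real (x ^ k) * f x)"
  have g: "?g \<in> schwartz_funs"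
    by (intro schwartz_cmult schwartz_mult_power f)
  have "\<bar>\<xi>\<bar> ^ j * norm (nth_deriv k (fourier f) \<xi>) \<le> (LINT x|lborel. norm (nth_deriv j ?g x))" for \<xi>
  proof -
    have "\<bar>\<xi>\<bar> ^ j * norm (nth_deriv k (fourier f) \<xi>) = norm (fourier (nth_deriv j ?g) \<xi>)"
      unfolding fourier_nth_deriv[OF g] nth_deriv_fourier[OF int]
      by (simp add: norm_mult norm_power mult.assoc)
    also have "\<dots> \<le> (LINT x|lborel. norm (nth_deriv j ?g x))"
      by (rule norm_fourier_le)
    finally show ?thesis .
  qed
  then show "\<exists>C. \<forall>\<xi>. \<bar>\<xi>\<bar> ^ j * norm (nth_deriv k (fourier f) \<xi>) \<le> C" by blast
qed

lemma kernel_measurable [measurable]: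
  "(\<lambda>(x, y). exp (- (\<i> * complex_of_real (x * y)))) \<in> borel_measurable (lborel \<Otimes>\<^sub>M lborel)"
  "(\<lambda>(x, y). exp (- (\<i> * complex_of_real (y * x)))) \<in> borel_measurable (lborel \<Otimes>\<^sub>M lborel)"
  by (simp_all add: lborel_prod split_beta') (intro borel_measurable_continuous_onI continuous_intros)+

text \<open>Fubini for a kernel of modulus one, with the product of \<open>f\<close> and
  \<open>g\<close> as integrable majorant.\<close>

lemma fourier_multiplication_formula:
  assumes f: "integrable lborel f" and g: "integrable lborel g"
  shows "(LINT x|lborel. f x * fourier g x) = (LINT \<xi>|lborel. fourier f \<xi> * g \<xi>)"
proof -
  let ?h = "\<lambda>x y. f x * g y * exp (- (\<i> * complex_of_real (x * y)))"
  have "integrable (lborel \<Otimes>\<^sub>M lborel) (case_prod ?h)"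
    using integrable_prod_kernel[OF f g, of "\<lambda>x y. exp (- (\<i> * complex_of_real (x * y)))"] by simp
  from lborel_pair.Fubini_integral[OF this]
  have "(LINT y|lborel. LINT x|lborel. ?h x y) = (LINT x|lborel. LINT y|lborel. ?h x y)" .
  moreover have "(LINT x|lborel. ?h x y) = fourier f y * g y" for y
    unfolding fourier_def by (subst integral_mult_left_zero[symmetric]) (simp only: mult_ac)
  moreover have "(LINT y|lborel. ?h x y) = f x * fourier g x" for x
    unfolding fourier_def by (subst integral_mult_right_zero[symmetric]) (simp only: mult_ac)
  ultimately show ?thesis by simp
qed

text \<open>The characteristic function of the standard normal distribution, freed from the
  normalising factor \<open>sqrt (2 * pi)\<close>.\<close>

lemma gaussian_fourier:
  "integrable lborel (\<lambda>s. complex_of_real (exp (- (s\<^sup>2) / 2)))"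
  "(LINT s|lborel. complex_of_real (exp (- (s\<^sup>2) / 2)) * exp (\<i> * complex_of_real (t * s)))
     = complex_of_real (sqrt (2 * pi) * exp (- (t\<^sup>2) / 2))"
proof -
  have d: "std_normal_density s = exp (- (s\<^sup>2) / 2) / sqrt (2 * pi)" for s
    by (simp add: std_normal_density_def)
  have "integrable lborel std_normal_density"
    using integrable_normal_density[of 1 0] by simp
  then have "integrable lborel (\<lambda>s. complex_of_real (sqrt (2 * pi) * std_normal_density s))"
    by (intro integrable_of_real integrable_mult_right)
  then show "integrable lborel (\<lambda>s. complex_of_real (exp (- (s\<^sup>2) / 2)))"
    by (simp add: d)
  have "complex_of_real (exp (- (t\<^sup>2) / 2)) =
      (LINT s|lborel. std_normal_density s *\<^sub>R exp (\<i> * complex_of_real (t * s)))"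
    using fun_cong[OF char_std_normal_distribution, of t]
    unfolding char_def by (subst (asm) integral_density) (auto simp: normal_density_nonneg)
  also have "\<dots> = (LINT s|lborel. complex_of_real (exp (- (s\<^sup>2) / 2)) * exp (\<i> * complex_of_real (t * s)))
      / complex_of_real (sqrt (2 * pi))"
    by (subst integral_divide_zero[symmetric]) (simp add: d scaleR_conv_of_real)
  finally show "(LINT s|lborel. complex_of_real (exp (- (s\<^sup>2) / 2)) * exp (\<i> * complex_of_real (t * s)))
     = complex_of_real (sqrt (2 * pi) * exp (- (t\<^sup>2) / 2))"
    by (simp add: field_simps)
qed

text \<open>Gaussian summation: the factor \<open>?G (d * \<xi>)\<close> makes Fubini applicable,
  and \<open>d\<close> tends to 0 on both sides by dominated convergence. Integrability of
  \<open>fourier f\<close> gives the majorant on the left, boundedness of \<open>f\<close> the one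
  on the right, and continuity of \<open>f\<close> identifies the limit.\<close>

lemma fourier_inversion:
  assumes f: "integrable lborel f" and cont: "continuous_on UNIV f" and bdd: "\<And>x. norm (f x) \<le> B"
    and ff: "integrable lborel (fourier f)"
  shows "f y = (LINT \<xi>|lborel. fourier f \<xi> * exp (\<i> * complex_of_real (y * \<xi>))) / (2 * pi)"
proof -
  let ?G = "\<lambda>s. complex_of_real (exp (- (s\<^sup>2) / 2))"
  let ?e = "\<lambda>\<xi>. exp (\<i> * complex_of_real (y * \<xi>))"
  have [measurable]: "f \<in> borel_measurable borel" "fourier f \<in> borel_measurable borel"
    using f ff by auto
  have em [measurable]: "?e \<in> borel_measurable borel"
    by (intro borel_measurable_continuous_onI continuous_intros)
  have e1: "norm (?e \<xi>) = 1" for \<xi>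
    by (rule norm_exp_i_times)
  have G1: "norm (?G s) \<le> 1" for s
    by (simp del: of_real_exp)
  have Gm [measurable]: "?G \<in> borel_measurable borel"
    using gaussian_fourier(1) by auto
  \<comment> \<open>the regularised inversion integral, by Fubini an average of \<open>f\<close> around \<open>y\<close>\<close>
  have reg: "(LINT \<xi>|lborel. fourier f \<xi> * (?e \<xi> * ?G (d * \<xi>))) =
      complex_of_real (sqrt (2 * pi)) * (LINT u|lborel. f (y + d * u) * ?G u)" if d: "d > 0" for d :: real
  proof -
    have Gd: "integrable lborel (\<lambda>\<xi>. ?G (d * \<xi>))"
      using lborel_integrable_real_affine[OF gaussian_fourier(1), of d 0] d by simp
    have g: "integrable lborel (\<lambda>\<xi>. ?G (d * \<xi>) * ?e \<xi>)"
      by (rule integrable_mult_unimodular[OF Gd em]) (simp only: e1 order_refl)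
    then have g': "integrable lborel (\<lambda>\<xi>. ?e \<xi> * ?G (d * \<xi>))"
      by (simp only: mult_ac)
    have "fourier (\<lambda>\<xi>. ?e \<xi> * ?G (d * \<xi>)) x =
        complex_of_real (sqrt (2 * pi) / d) * ?G ((y - x) / d)" for x
    proof -
      have "fourier (\<lambda>\<xi>. ?e \<xi> * ?G (d * \<xi>)) x =
          (LINT \<xi>|lborel. ?G (d * \<xi>) * exp (\<i> * complex_of_real ((y - x) / d * (d * \<xi>))))"
        unfolding fourier_def
      proof (rule Bochner_Integration.integral_cong[OF refl])
        fix \<xi>
        have "?e \<xi> * exp (- (\<i> * complex_of_real (\<xi> * x))) =
            exp (\<i> * complex_of_real ((y - x) / d * (d * \<xi>)))"
        proof -
          have eq: "(y - x) / d * (d * \<xi>) = y * \<xi> - \<xi> * x"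
          proof -
            have "(y - x) / d * (d * \<xi>) = (y - x) * \<xi>"
              using d by simp
            then show ?thesis by (simp add: algebra_simps)
          qed
          show ?thesis
            unfolding exp_add[symmetric] eq by (simp add: algebra_simps)
        qed
        from this[symmetric] show "?e \<xi> * ?G (d * \<xi>) * exp (- (\<i> * complex_of_real (\<xi> * x))) =
            ?G (d * \<xi>) * exp (\<i> * complex_of_real ((y - x) / d * (d * \<xi>)))"
          by (simp only: mult_ac)
      qed
      also have "\<dots> = (LINT s|lborel. ?G s * exp (\<i> * complex_of_real ((y - x) / d * s))) / d"
        using lborel_integral_real_affine[of d "\<lambda>s. ?G s * exp (\<i> * complex_of_real ((y - x) / d * s))" 0] d
        by (simp add: scaleR_conv_of_real)
      finally show ?thesis
        unfolding gaussian_fourier(2) by simp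
    qed
    then have "(LINT \<xi>|lborel. fourier f \<xi> * (?e \<xi> * ?G (d * \<xi>))) =
        (LINT x|lborel. f x * (complex_of_real (sqrt (2 * pi) / d) * ?G ((y - x) / d)))"
      using fourier_multiplication_formula[OF f g'] by simp
    also have "\<dots> = d *\<^sub>R (LINT u|lborel. f (y + d * u) *
        (complex_of_real (sqrt (2 * pi) / d) * ?G ((y - (y + d * u)) / d)))"
      using d by (subst lborel_integral_real_affine[where c=d and t=y]) auto
    also have "\<dots> = complex_of_real (sqrt (2 * pi)) * (LINT u|lborel. f (y + d * u) * ?G u)"
      using d by (simp add: scaleR_conv_of_real mult.left_commute[of "f _"] del: of_real_exp)
    finally show ?thesis .
  qed
  let ?d = "\<lambda>n. 1 / real (Suc n)"
  have d0: "?d \<longlonglongrightarrow> 0" by (rule lim_1_over_n[THEN LIMSEQ_Suc])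
  have Gcont: "isCont ?G s" for s
    by (intro continuous_intros) auto
  have lim1: "(\<lambda>n. LINT \<xi>|lborel. fourier f \<xi> * (?e \<xi> * ?G (?d n * \<xi>))) \<longlonglongrightarrow>
      (LINT \<xi>|lborel. fourier f \<xi> * (?e \<xi> * ?G 0))"
  proof (rule integral_dominated_convergence[where w="\<lambda>\<xi>. norm (fourier f \<xi>)"])
    show "AE \<xi> in lborel. (\<lambda>n. fourier f \<xi> * (?e \<xi> * ?G (?d n * \<xi>))) \<longlonglongrightarrow> fourier f \<xi> * (?e \<xi> * ?G 0)"
    proof (intro AE_I2 tendsto_mult tendsto_const)
      fix \<xi>
      have "(\<lambda>n. ?d n * \<xi>) \<longlonglongrightarrow> 0"
        using tendsto_mult_right[OF d0, of \<xi>] by simp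
      from isCont_tendsto_compose[OF Gcont this] show "(\<lambda>n. ?G (?d n * \<xi>)) \<longlonglongrightarrow> ?G 0" .
    qed
    show "AE \<xi> in lborel. norm (fourier f \<xi> * (?e \<xi> * ?G (?d n * \<xi>))) \<le> norm (fourier f \<xi>)" for n
      using G1 unfolding norm_mult e1 mult_1_left by (intro AE_I2 mult_left_le) auto
  qed (use ff in \<open>auto simp del: of_real_exp\<close>)
  have lim2: "(\<lambda>n. LINT u|lborel. f (y + ?d n * u) * ?G u) \<longlonglongrightarrow> (LINT u|lborel. f y * ?G u)"
  proof (rule integral_dominated_convergence[where w="\<lambda>u. B * norm (?G u)"])
    show "AE u in lborel. (\<lambda>n. f (y + ?d n * u) * ?G u) \<longlonglongrightarrow> f y * ?G u"
    proof (intro AE_I2 tendsto_mult tendsto_const)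
      fix u
      have "(\<lambda>n. y + ?d n * u) \<longlonglongrightarrow> y + 0"
        using tendsto_mult_right[OF d0, of u] by (intro tendsto_add) auto
      then have "(\<lambda>n. y + ?d n * u) \<longlonglongrightarrow> y" by simp
      moreover have "isCont f y" using cont by (simp add: continuous_on_eq_continuous_at)
      ultimately show "(\<lambda>n. f (y + ?d n * u)) \<longlonglongrightarrow> f y"
        by (rule isCont_tendsto_compose[rotated])
    qed
    show "AE u in lborel. norm (f (y + ?d n * u) * ?G u) \<le> B * norm (?G u)" for n
      unfolding norm_mult by (intro AE_I2 mult_right_mono bdd) auto
    show "integrable lborel (\<lambda>u. B * norm (?G u))"
      by (intro integrable_mult_right integrable_norm gaussian_fourier(1))
  qed measurable
  have "(LINT \<xi>|lborel. fourier f \<xi> * (?e \<xi> * ?G 0)) =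
      complex_of_real (sqrt (2 * pi)) * (LINT u|lborel. f y * ?G u)"
  proof (rule LIMSEQ_unique[OF lim1])
    have "?d n > 0" for n by simp
    from tendsto_mult_left[OF lim2, of "complex_of_real (sqrt (2 * pi))", folded reg[OF this]]
    show "(\<lambda>n. LINT \<xi>|lborel. fourier f \<xi> * (?e \<xi> * ?G (?d n * \<xi>))) \<longlonglongrightarrow>
        complex_of_real (sqrt (2 * pi)) * (LINT u|lborel. f y * ?G u)" .
  qed
  also have "(LINT u|lborel. f y * ?G u) = f y * complex_of_real (sqrt (2 * pi))"
    using gaussian_fourier(2)[of 0] by (simp del: of_real_exp)
  \<comment> \<open>One factor \<open>sqrt (2 * pi)\<close> comes from the transform of the
    Gaussian, the other from its integral; together they are the constant of the inversion
    formula.\<close>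
  also have "complex_of_real (sqrt (2 * pi)) * (f y * complex_of_real (sqrt (2 * pi))) = f y * (2 * pi)"
  proof -
    have "complex_of_real (sqrt (2 * pi)) * complex_of_real (sqrt (2 * pi)) = complex_of_real (2 * pi)"
      unfolding of_real_mult[symmetric] by (subst real_sqrt_mult_self) simp
    then show ?thesis by (simp add: mult_ac)
  qed
  also have "(LINT \<xi>|lborel. fourier f \<xi> * (?e \<xi> * ?G 0)) = (LINT \<xi>|lborel. fourier f \<xi> * ?e \<xi>)"
    by simp
  finally show ?thesis by simp
qed

section \<open>Inverse transform on Schwartz functions, and modulations\<close>

lemma integral_reflect: "(LINT x|lborel. f (- x)) = (LINT x|lborel. (f x :: complex))" for f :: "real \<Rightarrow> complex"
  using lborel_integral_real_affine[of "-1" f 0] by simp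

text \<open>The shape \<open>c * f (a + c' * x)\<close> fits \<open>schwartz_cmult\<close> and
  \<open>schwartz_affine\<close> literally; \<open>inverse_fourier_altdef\<close> is the usual
  form.\<close>

definition inverse_fourier :: "(real \<Rightarrow> complex) \<Rightarrow> real \<Rightarrow> complex" where
  "inverse_fourier f x = 1 / (2 * pi) * fourier f (0 + (- 1) * x)"

lemma inverse_fourier_altdef: "inverse_fourier f x = fourier f (- x) / (2 * pi)"
  by (simp add: inverse_fourier_def)

lemma inverse_fourier_schwartz: "f \<in> schwartz_funs \<Longrightarrow> inverse_fourier f \<in> schwartz_funs"
  unfolding inverse_fourier_def[abs_def] by (intro schwartz_cmult schwartz_affine fourier_schwartz) auto

lemma schwartz_bounded:
  assumes "f \<in> schwartz_funs"
  obtains B where "B > 0" "\<And>x. norm (nth_deriv k f x) \<le> B"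
  using schwartz_fun_decay[OF assms, where k=k and q=0] by auto

text \<open>This is surjectivity of the transform on Schwartz functions: a functional known through
  its Fourier transform can then be evaluated on any test function.\<close>

lemma fourier_inverse_fourier:
  assumes f: "f \<in> schwartz_funs"
  shows "fourier (inverse_fourier f) = f"
proof
  fix y
  obtain B where B: "\<And>x. norm (nth_deriv 0 f x) \<le> B"
    using schwartz_bounded[OF f, where k=0] by blast
  have "fourier (inverse_fourier f) y =
      (LINT x|lborel. fourier f (- x) * exp (\<i> * complex_of_real (y * (- x))) / (2 * pi))"
    unfolding fourier_def[of "inverse_fourier f"] inverse_fourier_altdef by (simp add: mult_ac)
  also have "\<dots> = (LINT x|lborel. fourier f x * exp (\<i> * complex_of_real (y * x)) / (2 * pi))"
    by (rule integral_reflect)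
  also have "\<dots> = f y"
    using fourier_inversion[of f B y] B
    by (simp add: integrable_schwartz f fourier_schwartz schwartz_fun_smooth continuous_on_smooth_fun)
  finally show "fourier (inverse_fourier f) y = f y" .
qed

lemma fourier_modulation:
  "fourier (\<lambda>x. exp (\<i> * complex_of_real (a * x)) * f x) \<xi> = fourier f (\<xi> - a)"
  unfolding fourier_def
proof (rule Bochner_Integration.integral_cong[OF refl])
  fix x
  have "exp (\<i> * complex_of_real (a * x)) * exp (- (\<i> * complex_of_real (x * \<xi>))) =
      exp (- (\<i> * complex_of_real (x * (\<xi> - a))))"
    unfolding exp_add[symmetric] by (intro arg_cong[where f=exp]) (simp add: algebra_simps)
  from this[symmetric] show "exp (\<i> * complex_of_real (a * x)) * f x * exp (- (\<i> * complex_of_real (x * \<xi>))) =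
      f x * exp (- (\<i> * complex_of_real (x * (\<xi> - a))))"
    by (simp only: mult_ac)
qed

section \<open>Convolution with a smooth function\<close>

text \<open>Nothing is assumed about the growth of \<open>f\<close>, and \<open>A\<close> is merely
  integrable; the bounded support of \<open>A\<close> alone supplies the majorant for
  differentiating under the integral.\<close>

lemma
  fixes A :: "real \<Rightarrow> complex"
  assumes A: "integrable lborel A" and supp: "\<And>y. A y \<noteq> 0 \<Longrightarrow> \<bar>y\<bar> \<le> R" and f: "smooth_fun f"
  shows integrable_convolution: "integrable lborel (\<lambda>y. A y * f (x - y))"
    and has_vector_derivative_convolution:
      "((\<lambda>x. LINT y|lborel. A y * f (x - y)) has_vector_derivative
          (LINT y|lborel. A y * nth_deriv 1 f (x - y))) (at x)"
proof -
  \<comment> \<open>For \<open>t\<close> within 1 of \<open>x\<close> and \<open>|y| <= R\<close>,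
    the point \<open>t - y\<close> stays in a fixed compact ball around \<open>x\<close>, where
    \<open>h\<close> is bounded.\<close>
  have bdd: "\<exists>B\<ge>0. \<forall>t\<in>ball x 1. \<forall>y. norm (A y * h (t - y)) \<le> B * norm (A y)"
    if h: "continuous_on UNIV h" for x and h :: "real \<Rightarrow> complex"
  proof -
    have "compact (h ` cball x (1 + \<bar>R\<bar>))"
      using h by (intro compact_continuous_image) (auto intro: continuous_on_subset)
    from compact_imp_bounded[OF this] obtain B where B: "B > 0" "\<And>z. z \<in> cball x (1 + \<bar>R\<bar>) \<Longrightarrow> norm (h z) \<le> B"
      unfolding bounded_pos by auto
    have "norm (A y * h (t - y)) \<le> B * norm (A y)" if t: "t \<in> ball x 1" for t y
    proof (cases "A y = 0")
      case False
      then have "\<bar>y\<bar> \<le> R" by (rule supp)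
      then have "t - y \<in> cball x (1 + \<bar>R\<bar>)"
        using t by (simp add: dist_real_def)
      then show ?thesis
        using mult_right_mono[OF B(2) norm_ge_zero[of "A y"], of "t - y"] by (simp add: norm_mult mult.commute)
    qed simp
    then show ?thesis using B(1) by (intro exI[of _ B]) auto
  qed
  have meas: "(\<lambda>y. A y * h (x - y)) \<in> borel_measurable lborel" if "continuous_on UNIV h" for x and h :: "real \<Rightarrow> complex"
  proof -
    have "continuous_on UNIV (\<lambda>y. h (x - y))"
      by (intro continuous_on_compose2[OF that] continuous_intros) auto
    then have "(\<lambda>y. h (x - y)) \<in> borel_measurable borel"
      by (rule borel_measurable_continuous_onI)
    then show ?thesis using borel_measurable_integrable[OF A] by simp
  qed
  have int: "integrable lborel (\<lambda>y. A y * f (x - y))" for x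
  proof -
    obtain B where "B \<ge> 0" and B: "\<forall>t\<in>ball x 1. \<forall>y. norm (A y * f (t - y)) \<le> B * norm (A y)"
      using bdd[OF continuous_on_smooth_fun[OF f]] by blast
    show ?thesis
    proof (rule Bochner_Integration.integrable_bound)
      show "integrable lborel (\<lambda>y. B * norm (A y))"
        using A by simp
      have "x \<in> ball x 1" by simp
      with B \<open>B \<ge> 0\<close> show "AE y in lborel. norm (A y * f (x - y)) \<le> norm (B * norm (A y))"
        by auto
    qed (rule meas[OF continuous_on_smooth_fun[OF f]])
  qed
  then show "integrable lborel (\<lambda>y. A y * f (x - y))" .
  obtain B where B: "\<forall>t\<in>ball x 1. \<forall>y. norm (A y * nth_deriv 1 f (t - y)) \<le> B * norm (A y)"
    using bdd[OF continuous_on_nth_deriv[OF f]] by blast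
  show "((\<lambda>x. LINT y|lborel. A y * f (x - y)) has_vector_derivative
          (LINT y|lborel. A y * nth_deriv 1 f (x - y))) (at x)"
  proof (rule has_vector_derivative_integral[where r=1 and w="\<lambda>y. B * norm (A y)"
        and f="\<lambda>x y. A y * f (x - y)" and f'="\<lambda>x y. A y * nth_deriv 1 f (x - y)"])
    fix t y :: real
    have "((\<lambda>t. t - y) has_vector_derivative 1) (at t)"
      by (auto intro!: derivative_eq_intros)
    from vector_diff_chain_at[OF this smooth_fun_has_vector_derivative_0[OF f]]
    have "((\<lambda>t. f (t - y)) has_vector_derivative nth_deriv 1 f (t - y)) (at t)"
      by (simp add: o_def)
    then show "((\<lambda>t. A y * f (t - y)) has_vector_derivative A y * nth_deriv 1 f (t - y)) (at t)"
      by (rule has_vector_derivative_mult_right)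
  next
    show "(\<lambda>y. A y * nth_deriv 1 f (x - y)) \<in> borel_measurable lborel"
      by (intro meas continuous_on_nth_deriv f)
  qed (use B int A in auto)
qed

lemma smooth_fun_convolution:
  fixes A :: "real \<Rightarrow> complex"
  assumes "integrable lborel A" "\<And>y. A y \<noteq> 0 \<Longrightarrow> \<bar>y\<bar> \<le> R" "smooth_fun f"
  shows "smooth_fun (\<lambda>x. LINT y|lborel. A y * f (x - y))"
proof (rule smooth_funI[where F="\<lambda>k x. LINT y|lborel. A y * nth_deriv k f (x - y)"])
  fix k x
  show "((\<lambda>x. LINT y|lborel. A y * nth_deriv k f (x - y)) has_vector_derivative
      (LINT y|lborel. A y * nth_deriv (Suc k) f (x - y))) (at x)"
    using has_vector_derivative_convolution[OF assms(1,2) smooth_fun_nth_deriv[OF assms(3), of k]]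
    by (simp add: nth_deriv_nth_deriv)
qed simp

lemma integral_pos_of_continuous:
  fixes f :: "real \<Rightarrow> real"
  assumes int: "integrable lborel f" and cont: "continuous_on UNIV f"
    and nonneg: "\<And>x. f x \<ge> 0" and y: "f y > 0"
  shows "integral\<^sup>L lborel f > 0"
proof -
  have "isCont f y" using cont by (simp add: continuous_on_eq_continuous_at)
  then have "\<forall>\<^sub>F x in nhds y. f x > f y / 2"
    using y by (intro order_tendstoD(1)[of f "f y"]) (auto simp: isCont_def tendsto_at_iff_tendsto_nhds)
  then obtain d where d: "d > 0" "\<And>x. dist x y < d \<Longrightarrow> f x > f y / 2"
    unfolding eventually_nhds_metric by blast
  let ?I = "{y - d/2..y + d/2}"
  have "0 < f y / 2 * measure lborel ?I"
    using d(1) y by simp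
  also have "\<dots> = (LINT x|lborel. f y / 2 * indicator ?I x)"
    by simp
  also have "\<dots> \<le> integral\<^sup>L lborel f"
  proof (rule integral_mono[OF _ int])
    show "integrable lborel (\<lambda>x. f y / 2 * indicator ?I x)"
      by (intro integrable_mult_right integrable_real_indicator) (auto simp: emeasure_lborel_Icc_eq)
    fix x
    show "f y / 2 * indicator ?I x \<le> f x"
    proof (cases "x \<in> ?I")
      case True
      then have "dist x y < d" using d(1) by (auto simp: dist_real_def)
      from d(2)[OF this] show ?thesis using True by simp
    qed (use nonneg in auto)
  qed
  finally show ?thesis .
qed

section \<open>Nonzero integrals and cutoffs made from a given test function\<close>

lemma integrable_test_fun: "f \<in> test_funs \<Longrightarrow> integrable lborel f"
  using integrable_schwartz test_funs_subset_schwartz by blast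

lemma test_fun_smooth: "f \<in> test_funs \<Longrightarrow> smooth_fun f"
  by (simp add: test_funs_def)

lemma cnj_test_funs: "f \<in> test_funs \<Longrightarrow> (\<lambda>x. cnj (f x)) \<in> test_funs"
proof -
  assume f: "f \<in> test_funs"
  then obtain R where "\<And>x. f x \<noteq> 0 \<Longrightarrow> \<bar>x\<bar> \<le> R"
    using fun_support_bounded by blast
  then show "(\<lambda>x. cnj (f x)) \<in> test_funs"
    using test_funsI[OF smooth_fun_cnj[OF test_fun_smooth[OF f]], of R] by simp
qed

lemma integral_norm_square_nonzero:
  assumes f: "f \<in> test_funs" and nz: "f y \<noteq> 0"
  shows "(LINT x|lborel. f x * cnj (f x)) \<noteq> 0"
proof -
  have eq: "f x * cnj (f x) = complex_of_real ((cmod (f x))\<^sup>2)" for x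
    by (simp only: complex_norm_square)
  have "(\<lambda>x. f x * cnj (f x)) \<in> test_funs"
    by (rule mult_test_funs[OF f smooth_fun_cnj[OF test_fun_smooth[OF f]]])
  then have "integrable lborel (\<lambda>x. (cmod (f x))\<^sup>2)"
    using integrable_test_fun[of "\<lambda>x. f x * cnj (f x)"]
    by (simp only: eq complex_of_real_integrable_eq)
  then have "0 < (LINT x|lborel. (cmod (f x))\<^sup>2)"
    using nz continuous_on_smooth_fun[OF test_fun_smooth[OF f]]
    by (intro integral_pos_of_continuous[of _ y] continuous_intros) auto
  then show ?thesis
    unfolding eq by (simp only: integral_complex_of_real of_real_eq_0_iff)
qed

text \<open>No explicit bump function is built: the square modulus of the given \<eta>, normalised
  by its integral, smooths the indicator of an interval.\<close>

lemma exists_cutoff: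
  assumes \<eta>: "\<eta> \<in> test_funs" and nz: "\<eta> y \<noteq> 0"
  obtains \<kappa> where "\<kappa> \<in> test_funs" "\<And>x. \<bar>x\<bar> < R \<Longrightarrow> \<kappa> x = 1"
proof -
  let ?g = "\<lambda>x. \<eta> x * cnj (\<eta> x)"
  have g: "?g \<in> test_funs"
    by (rule mult_test_funs[OF \<eta> smooth_fun_cnj[OF test_fun_smooth[OF \<eta>]]])
  obtain r where r: "r > 0" "\<And>x. ?g x \<noteq> 0 \<Longrightarrow> \<bar>x\<bar> \<le> r"
    using fun_support_bounded[OF g] by blast
  define c where "c = integral\<^sup>L lborel ?g"
  have c: "c \<noteq> 0"
    unfolding c_def by (rule integral_norm_square_nonzero[of \<eta> y, OF \<eta> nz])
  \<comment> \<open>With this half-length, for \<open>|x| < R\<close> the interval contains every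
    \<open>y\<close> with \<open>?g (x - y)\<close> nonzero, so the convolution returns the full
    integral \<open>c\<close>.\<close>
  define A where "A = \<bar>R\<bar> + r"
  let ?i = "\<lambda>y. complex_of_real (indicator {-A..A} y)"
  let ?k = "\<lambda>x. LINT y|lborel. ?i y * ?g (x - y)"
  have i: "integrable lborel ?i"
    by (intro integrable_of_real integrable_real_indicator) (auto simp: emeasure_lborel_Icc_eq)
  have ks: "smooth_fun ?k"
    by (rule smooth_fun_convolution[OF i, where R=A])
       (auto simp: indicator_def test_fun_smooth[OF g] split: if_splits)
  have "(\<lambda>x. (1 / c) * ?k x) \<in> test_funs"
  proof (rule test_funsI[where R="A + r"])
    show "smooth_fun (\<lambda>x. (1 / c) * ?k x)"
      by (rule smooth_fun_cmult[OF ks])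
    show "\<bar>x\<bar> \<le> A + r" if "1 / c * ?k x \<noteq> 0" for x
    proof (rule ccontr)
      assume x: "\<not> \<bar>x\<bar> \<le> A + r"
      have "?i y * ?g (x - y) = 0" for y
      proof (rule ccontr)
        assume "\<not> ?thesis"
        then have "?g (x - y) \<noteq> 0" "y \<in> {-A..A}" by (auto simp: indicator_def)
        then have "\<bar>x - y\<bar> \<le> r" "\<bar>y\<bar> \<le> A" using r(2)[of "x - y"] by auto
        with x show False by linarith
      qed
      then have "?k x = 0" by (simp only: Bochner_Integration.integral_zero)
      with that show False by simp
    qed
  qed
  moreover have "1 / c * ?k x = 1" if x: "\<bar>x\<bar> < R" for x
  proof -
    have eq: "?i y * ?g (x - y) = ?g (x + (-1) * y)" for y
    proof (cases "?g (x - y) = 0")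
      case False
      then have "\<bar>x - y\<bar> \<le> r" using r(2)[of "x - y"] by auto
      then have "y \<in> {-A..A}" using x by (auto simp: A_def)
      then show ?thesis by simp
    qed simp
    have "?k x = (LINT y|lborel. ?g (x + (-1) * y))"
      unfolding eq ..
    also have "\<dots> = c"
      unfolding c_def using lborel_integral_real_affine[of "-1" ?g x] by simp
    finally show ?thesis using c by simp
  qed
  ultimately show ?thesis using that by blast
qed

section \<open>Lacunary modulations of a test function\<close>

lemma norm_fourier_decay:
  assumes "f \<in> schwartz_funs"
  shows "\<bar>\<xi>\<bar> * norm (fourier f \<xi>) \<le> (LINT x|lborel. norm (nth_deriv 1 f x))"
proof -
  have "\<bar>\<xi>\<bar> * norm (fourier f \<xi>) = norm (fourier (nth_deriv 1 f) \<xi>)"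
    unfolding fourier_deriv[OF assms] by (simp add: norm_mult)
  also have "\<dots> \<le> (LINT x|lborel. norm (nth_deriv 1 f x))"
    by (rule norm_fourier_le)
  finally show ?thesis .
qed

lemma geometric_half_bound:
  fixes f :: "nat \<Rightarrow> complex"
  assumes b: "\<And>m. norm (f m) \<le> C * (1 / 2) ^ m"
  shows "summable (\<lambda>m. norm (f m))" "summable f" "norm (suminf f) \<le> 2 * C"
proof -
  have s: "(\<lambda>m. C * (1 / 2) ^ m) sums (C * (1 / (1 - 1 / 2)))"
    by (intro sums_mult geometric_sums) simp
  show n: "summable (\<lambda>m. norm (f m))"
    by (rule summable_comparison_test'[OF sums_summable[OF s], of 0]) (simp add: b)
  then show "summable f" by (rule summable_norm_cancel)
  have "norm (suminf f) \<le> (\<Sum>m. norm (f m))" by (rule summable_norm[OF n])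
  also have "\<dots> \<le> (\<Sum>m. C * (1 / 2) ^ m)" by (rule suminf_le[OF b n sums_summable[OF s]])
  also have "\<dots> = 2 * C" using sums_unique[OF s] by simp
  finally show "norm (suminf f) \<le> 2 * C" .
qed

text \<open>If \<open>w = \<eta> \<theta>\<close>, then \<open>\<Sum>m. fourier w (- a m)\<close> is the pairing of \<open>\<theta>\<close> with
  the function series \<open>\<Sum>m. exp (\<i> a\<^sub>m x) \<eta> x\<close>.\<close>

locale lacunary =
  fixes a :: "nat \<Rightarrow> real"
  assumes a_ge: "\<And>m. a m \<ge> 2 ^ m"
    and a_sep: "\<And>m n. m \<noteq> n \<Longrightarrow> \<bar>a m - a n\<bar> \<ge> 2 ^ m * 2 ^ n"
begin

lemma a_pos: "a m > 0"
  using a_ge[of m] by (rule less_le_trans[rotated]) simp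

text \<open>One derivative of \<open>w\<close> buys decay of order one, which is already summable
  along frequencies growing at least like \<open>2 ^ m\<close>; this fixes the order of the
  distribution.\<close>

lemma norm_fourier_at_a:
  assumes "w \<in> schwartz_funs"
  shows "norm (fourier w (- a m)) \<le> (LINT x|lborel. norm (nth_deriv 1 w x)) * (1 / 2) ^ m"
proof -
  have "2 ^ m * norm (fourier w (- a m)) \<le> \<bar>- a m\<bar> * norm (fourier w (- a m))"
    using a_ge[of m] a_pos[of m] by (intro mult_right_mono) auto
  also have "\<dots> \<le> (LINT x|lborel. norm (nth_deriv 1 w x))"
    by (rule norm_fourier_decay[OF assms])
  finally show ?thesis by (simp add: field_simps)
qed

definition pairing :: "(real \<Rightarrow> complex) \<Rightarrow> complex" where
  "pairing w = (\<Sum>m. fourier w (- a m))"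

lemma
  assumes "w \<in> schwartz_funs"
  shows summable_pairing: "summable (\<lambda>m. fourier w (- a m))"
    and norm_pairing_le: "norm (pairing w) \<le> 2 * (LINT x|lborel. norm (nth_deriv 1 w x))"
proof -
  let ?I = "LINT x|lborel. norm (nth_deriv 1 w x)"
  show "summable (\<lambda>m. fourier w (- a m))"
    by (rule geometric_half_bound(2)[OF norm_fourier_at_a[OF assms]])
  show "norm (pairing w) \<le> 2 * ?I"
    unfolding pairing_def by (rule geometric_half_bound(3)[OF norm_fourier_at_a[OF assms]])
qed

lemma pairing_sums: "w \<in> schwartz_funs \<Longrightarrow> (\<lambda>m. fourier w (- a m)) sums pairing w"
  unfolding pairing_def by (intro summable_sums summable_pairing)

lemma pairing_linear:
  assumes "v \<in> schwartz_funs" "w \<in> schwartz_funs"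
  shows "pairing (\<lambda>x. c * v x + d * w x) = c * pairing v + d * pairing w"
proof -
  have "fourier (\<lambda>x. c * v x + d * w x) \<xi> = c * fourier v \<xi> + d * fourier w \<xi>" for \<xi>
  proof -
    let ?e = "\<lambda>x. exp (- (\<i> * complex_of_real (x * \<xi>)))"
    have "fourier (\<lambda>x. c * v x + d * w x) \<xi> = (LINT x|lborel. c * (v x * ?e x) + d * (w x * ?e x))"
      unfolding fourier_def by (simp only: distrib_right mult.assoc)
    also have "\<dots> = (LINT x|lborel. c * (v x * ?e x)) + (LINT x|lborel. d * (w x * ?e x))"
      by (intro Bochner_Integration.integral_add integrable_mult_right integrable_fourier_integrand
          integrable_schwartz assms)
    finally show ?thesis
      by (simp only: fourier_def integral_mult_right_zero)
  qed
  then have "(\<lambda>m. fourier (\<lambda>x. c * v x + d * w x) (- a m)) sums (c * pairing v + d * pairing w)"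
    by (simp only:) (intro sums_add sums_mult pairing_sums assms)
  then show ?thesis
    by (simp add: pairing_def sums_iff)
qed

text \<open>An absolutely convergent primitive of the series \<open>\<Sum>m. exp (\<i> a\<^sub>m x)\<close>.\<close>

definition primitive :: "real \<Rightarrow> complex" where
  "primitive y = (\<Sum>m. \<i> / complex_of_real (a m) * exp (\<i> * complex_of_real (a m * y)))"

lemma norm_primitive_term:
  "norm (\<i> / complex_of_real (a m) * exp (\<i> * complex_of_real (a m * y))) \<le> (1 / 2) ^ m"
proof -
  have "norm (\<i> / complex_of_real (a m) * exp (\<i> * complex_of_real (a m * y))) = 1 / a m"
    using a_pos[of m] unfolding norm_mult norm_exp_i_times by (simp add: norm_divide)
  also have "\<dots> \<le> 1 / 2 ^ m"
    using a_ge[of m] a_pos[of m] by (intro divide_left_mono) auto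
  finally show ?thesis by (simp add: power_one_over)
qed

lemma summable_primitive_norm:
  "summable (\<lambda>m. norm (\<i> / complex_of_real (a m) * exp (\<i> * complex_of_real (a m * y))))"
  by (rule geometric_half_bound(1)[where C=1]) (simp only: norm_primitive_term mult_1_left)

lemma primitive_measurable [measurable]: "primitive \<in> borel_measurable borel"
  unfolding primitive_def[abs_def]
  by (intro borel_measurable_suminf borel_measurable_continuous_onI continuous_intros)

lemma norm_primitive_le: "norm (primitive y) \<le> 2"
  using geometric_half_bound(3)[where C=1 and f="\<lambda>m. \<i> / complex_of_real (a m) * exp (\<i> * complex_of_real (a m * y))"]
  by (simp only: norm_primitive_term mult_1_left mult_1_right primitive_def simp_thms)

lemma integrable_primitive_mult:
  assumes "integrable lborel f"
  shows "integrable lborel (\<lambda>y. primitive y * f y)"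
proof (rule Bochner_Integration.integrable_bound)
  show "integrable lborel (\<lambda>y. 2 * norm (f y))" using assms by simp
  show "AE y in lborel. norm (primitive y * f y) \<le> norm (2 * norm (f y))"
    using norm_primitive_le by (auto simp: norm_mult intro!: mult_right_mono)
qed (use assms in auto)

text \<open>Termwise integration by parts. The coefficient \<open>i / a m\<close> is minus that of
  an antiderivative of the exponential, so it absorbs the sign; the interchange of sum and integral
  is dominated by \<open>(1/2) ^ m * norm (w' y)\<close>.\<close>

lemma pairing_eq_integral:
  assumes w: "w \<in> schwartz_funs"
  shows "pairing w = (LINT y|lborel. primitive y * nth_deriv 1 w y)"
proof -
  let ?p = "\<lambda>m y. \<i> / complex_of_real (a m) * exp (\<i> * complex_of_real (a m * y))"
  let ?w = "nth_deriv 1 w"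
  have iw: "integrable lborel ?w" by (rule integrable_schwartz_nth_deriv[OF w])
  have int: "integrable lborel (\<lambda>y. ?p m y * ?w y)" for m
  proof (rule Bochner_Integration.integrable_bound)
    show "integrable lborel (\<lambda>y. (1/2) ^ m * norm (?w y))" using iw by simp
    have "?p m \<in> borel_measurable borel"
      by (intro borel_measurable_continuous_onI continuous_intros)
    then show "(\<lambda>y. ?p m y * ?w y) \<in> borel_measurable lborel" using iw by simp
    show "AE y in lborel. norm (?p m y * ?w y) \<le> norm ((1/2) ^ m * norm (?w y))"
    proof (intro AE_I2)
      fix y
      show "norm (?p m y * ?w y) \<le> norm ((1/2) ^ m * norm (?w y))"
        using mult_right_mono[OF norm_primitive_term norm_ge_zero[of "?w y"], of m y]
        unfolding norm_mult[of "?p m y"] by simp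
    qed
  qed
  have bd: "(LINT y|lborel. norm (?p m y * ?w y)) \<le> (1/2) ^ m * (LINT y|lborel. norm (?w y))" for m
  proof -
    have "(LINT y|lborel. norm (?p m y * ?w y)) \<le> (LINT y|lborel. (1/2) ^ m * norm (?w y))"
    proof (rule integral_mono)
      show "norm (?p m y * ?w y) \<le> (1/2) ^ m * norm (?w y)" for y
        unfolding norm_mult[of "?p m y"] by (rule mult_right_mono[OF norm_primitive_term norm_ge_zero])
    qed (use int iw in \<open>auto intro: integrable_norm\<close>)
    then show ?thesis by simp
  qed
  have "(\<lambda>m. LINT y|lborel. ?p m y * ?w y) sums (LINT y|lborel. (\<Sum>m. ?p m y * ?w y))"
  proof (rule sums_integral[OF int])
    show "AE y in lborel. summable (\<lambda>m. norm (?p m y * ?w y))"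
      unfolding norm_mult[of "?p _ _"] by (intro AE_I2 summable_mult2 summable_primitive_norm)
    show "summable (\<lambda>m. LINT y|lborel. norm (?p m y * ?w y))"
    proof (rule summable_comparison_test')
      show "summable (\<lambda>m. (1/2) ^ m * (LINT y|lborel. norm (?w y)))"
        by (intro summable_mult2 summable_geometric) simp
      show "norm (LINT y|lborel. norm (?p m y * ?w y)) \<le> (1/2) ^ m * (LINT y|lborel. norm (?w y))" for m
        using bd[of m] by (simp add: integral_nonneg)
    qed
  qed
  moreover have "(\<Sum>m. ?p m y * ?w y) = primitive y * ?w y" for y
    unfolding primitive_def
    by (rule suminf_mult2[symmetric, OF summable_norm_cancel[OF summable_primitive_norm]])
  moreover have "(LINT y|lborel. ?p m y * ?w y) = fourier w (- a m)" for m
  proof -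
    have "(LINT y|lborel. ?p m y * ?w y) = \<i> / complex_of_real (a m) * fourier ?w (- a m)"
      unfolding fourier_def by (subst integral_mult_right_zero[symmetric]) (simp add: mult_ac)
    also have "\<dots> = fourier w (- a m)"
      using a_pos[of m] unfolding fourier_deriv[OF w] by simp
    finally show ?thesis .
  qed
  ultimately show ?thesis
    by (simp add: pairing_def sums_iff)
qed

text \<open>The frequency \<open>a\<^sub>M\<close> is separated from all the others by at least \<open>2\<^sup>M\<close>.\<close>

lemma pairing_modulated_tendsto:
  assumes w: "w \<in> schwartz_funs"
    and mod: "\<And>M. (\<lambda>x. exp (\<i> * complex_of_real (- a M * x)) * w x) \<in> schwartz_funs"
  shows "(\<lambda>M. pairing (\<lambda>x. exp (\<i> * complex_of_real (- a M * x)) * w x)) \<longlonglongrightarrow> integral\<^sup>L lborel w"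
proof -
  let ?I = "LINT x|lborel. norm (nth_deriv 1 w x)"
  have I0: "?I \<ge> 0" by simp
  have w0: "fourier w 0 = integral\<^sup>L lborel w"
    by (simp add: fourier_def)
  have "norm (pairing (\<lambda>x. exp (\<i> * complex_of_real (- a M * x)) * w x) - fourier w 0) \<le> 2 * ?I * (1/2) ^ M" for M
  proof -
    let ?t = "\<lambda>m. if m = M then 0 else fourier w (a M - a m)"
    \<comment> \<open>Modulation by \<open>- a M\<close> moves the frequency \<open>a M\<close> to
      0, so the term \<open>m = M\<close> is the integral of \<open>w\<close>. It is split off
      below, and the remaining terms are small by \<open>a_sep\<close>.\<close>
    have "(\<lambda>m. fourier w (a M - a m)) sums pairing (\<lambda>x. exp (\<i> * complex_of_real (- a M * x)) * w x)"
      using pairing_sums[OF mod[of M]] by (simp only: fourier_modulation) (simp add: algebra_simps)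
    from sums_diff[OF this sums_single[of M "\<lambda>_. fourier w 0"]]
    have s: "?t sums (pairing (\<lambda>x. exp (\<i> * complex_of_real (- a M * x)) * w x) - fourier w 0)"
      by (rule sums_cong[THEN iffD1, rotated]) simp
    have b: "norm (?t m) \<le> ?I * (1/2) ^ M * (1/2) ^ m" for m
    proof (cases "m = M")
      case False
      have "2 ^ m * 2 ^ M * norm (fourier w (a M - a m)) \<le> \<bar>a M - a m\<bar> * norm (fourier w (a M - a m))"
        using a_sep[of M m] False by (intro mult_right_mono) (auto simp: mult.commute)
      also have "\<dots> \<le> ?I" by (rule norm_fourier_decay[OF w])
      finally have "2 ^ m * 2 ^ M * norm (fourier w (a M - a m)) \<le> ?I" .
      then show ?thesis using False by (simp add: field_simps)
    qed (use I0 in simp)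
    have "norm (suminf ?t) \<le> 2 * (?I * (1/2) ^ M)"
      by (rule geometric_half_bound(3)[OF b])
    then show ?thesis
      using sums_unique[OF s] by (simp add: mult_ac)
  qed
  note bound = this
  have "(\<lambda>M. 2 * ?I * (1/2) ^ M) \<longlonglongrightarrow> 0"
    by (intro tendsto_mult_right_zero LIMSEQ_power_zero) simp
  with bound have "(\<lambda>M. pairing (\<lambda>x. exp (\<i> * complex_of_real (- a M * x)) * w x) - fourier w 0) \<longlonglongrightarrow> 0"
    by (rule Lim_null_comparison[OF always_eventually[OF allI]])
  then show ?thesis
    unfolding w0 by (rule LIM_zero_cancel)
qed

end

section \<open>The distribution with a lacunary series of modulations\<close>

locale lacunary_test_fun = lacunary +
  fixes \<eta> :: "real \<Rightarrow> complex"
  assumes \<eta>: "\<eta> \<in> test_funs"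
begin

text \<open>The explicit model of \<open>T\<close>. Since \<eta> has compact support, it makes sense
  on every smooth function and so is also its own extension to smooth functions.\<close>

definition lac_dist :: functional where
  "lac_dist \<theta> = pairing (\<lambda>x. \<eta> x * \<theta> x)"

lemma \<eta>_mult_schwartz: "smooth_fun \<theta> \<Longrightarrow> (\<lambda>x. \<eta> x * \<theta> x) \<in> schwartz_funs"
  using mult_test_funs[OF \<eta>] test_funs_subset_schwartz by blast

lemma smooth_\<eta>: "smooth_fun \<eta>"
  by (rule test_fun_smooth[OF \<eta>])

lemma schwartz_\<eta>: "\<eta> \<in> schwartz_funs"
  using \<eta> test_funs_subset_schwartz by blast

lemma nth_deriv_1_mult:
  assumes "smooth_fun f" "smooth_fun g"
  shows "nth_deriv 1 (\<lambda>x. f x * g x) x = f x * nth_deriv 1 g x + nth_deriv 1 f x * g x"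
proof -
  have "nth_deriv 1 (\<lambda>x. f x * g x) x = vector_derivative (\<lambda>x. f x * g x) (at x)"
    using nth_deriv_Suc[of 0] by simp
  also have "\<dots> = f x * nth_deriv 1 g x + nth_deriv 1 f x * g x"
    by (intro vector_derivative_at has_vector_derivative_mult smooth_fun_has_vector_derivative_0 assms)
  finally show ?thesis .
qed

definition bound_const :: real where
  "bound_const = 2 * ((LINT x|lborel. norm (\<eta> x)) + (LINT x|lborel. norm (nth_deriv 1 \<eta> x)))"

lemma bound_const_nonneg: "bound_const \<ge> 0"
  by (simp add: bound_const_def)

lemma norm_lac_dist_le:
  assumes \<theta>: "smooth_fun \<theta>" and B0: "\<And>x. norm (\<theta> x) \<le> B0" and B1: "\<And>x. norm (nth_deriv 1 \<theta> x) \<le> B1"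
  shows "norm (lac_dist \<theta>) \<le> bound_const * (B0 + B1)"
proof -
  have B: "B0 \<ge> 0" "B1 \<ge> 0"
    using order_trans[OF norm_ge_zero B0] order_trans[OF norm_ge_zero B1] by auto
  let ?I0 = "LINT x|lborel. norm (\<eta> x)" and ?I1 = "LINT x|lborel. norm (nth_deriv 1 \<eta> x)"
  have i: "integrable lborel (\<lambda>x. norm (\<eta> x))" "integrable lborel (\<lambda>x. norm (nth_deriv 1 \<eta> x))"
    by (intro integrable_norm integrable_schwartz_nth_deriv integrable_schwartz schwartz_\<eta>)+
  have "(LINT x|lborel. norm (nth_deriv 1 (\<lambda>x. \<eta> x * \<theta> x) x)) \<le>
      (LINT x|lborel. B1 * norm (\<eta> x) + B0 * norm (nth_deriv 1 \<eta> x))"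
  proof (rule integral_mono)
    show "integrable lborel (\<lambda>x. norm (nth_deriv 1 (\<lambda>x. \<eta> x * \<theta> x) x))"
      by (intro integrable_norm integrable_schwartz_nth_deriv \<eta>_mult_schwartz \<theta>)
    show "integrable lborel (\<lambda>x. B1 * norm (\<eta> x) + B0 * norm (nth_deriv 1 \<eta> x))"
      using i by (intro Bochner_Integration.integrable_add integrable_mult_right)
    show "norm (nth_deriv 1 (\<lambda>x. \<eta> x * \<theta> x) x) \<le> B1 * norm (\<eta> x) + B0 * norm (nth_deriv 1 \<eta> x)" for x
      unfolding nth_deriv_1_mult[OF smooth_\<eta> \<theta>]
      using mult_left_mono[OF B1[of x] norm_ge_zero[of "\<eta> x"]]
        mult_left_mono[OF B0[of x] norm_ge_zero[of "nth_deriv 1 \<eta> x"]]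
      by (intro norm_triangle_le) (simp add: norm_mult mult.commute)
  qed
  also have "\<dots> = B1 * ?I0 + B0 * ?I1"
    using i by (subst Bochner_Integration.integral_add) auto
  also have "\<dots> \<le> (?I0 + ?I1) * (B0 + B1)"
    using B by (simp add: algebra_simps integral_nonneg)
  finally have "2 * (LINT x|lborel. norm (nth_deriv 1 (\<lambda>x. \<eta> x * \<theta> x) x)) \<le> bound_const * (B0 + B1)"
    unfolding bound_const_def mult.assoc by (rule mult_left_mono) simp
  with norm_pairing_le[OF \<eta>_mult_schwartz[OF \<theta>]] show ?thesis
    unfolding lac_dist_def by (rule order_trans)
qed

lemma schwartz_le_SUP:
  assumes "\<theta> \<in> schwartz_funs"
  shows "\<bar>x\<bar> ^ j * norm (nth_deriv k \<theta> x) \<le> (SUP x. \<bar>x\<bar> ^ j * norm (nth_deriv k \<theta> x))"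
  by (rule cSUP_upper) (use assms in \<open>auto simp: schwartz_funs_def intro: bounded_imp_bdd_above\<close>)

lemma norm_lac_dist_le_SUP:
  assumes "\<theta> \<in> schwartz_funs"
  shows "norm (lac_dist \<theta>) \<le> bound_const * (\<Sum>k\<le>1. SUP x. norm (nth_deriv k \<theta> x))"
  using norm_lac_dist_le[OF schwartz_fun_smooth[OF assms], of "SUP x. norm (nth_deriv 0 \<theta> x)"
      "SUP x. norm (nth_deriv 1 \<theta> x)"]
    schwartz_le_SUP[OF assms, of _ 0 0] schwartz_le_SUP[OF assms, of _ 0 1] by simp

lemma lac_dist_linear: "linear_on_funs schwartz_funs lac_dist"
  unfolding linear_on_funs_def
proof (intro ballI allI)
  fix f g c d assume fg: "f \<in> schwartz_funs" "g \<in> schwartz_funs"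
  have "pairing (\<lambda>x. c * (\<eta> x * f x) + d * (\<eta> x * g x)) = c * lac_dist f + d * lac_dist g"
    unfolding lac_dist_def by (intro pairing_linear \<eta>_mult_schwartz schwartz_fun_smooth fg)
  then show "lac_dist (\<lambda>x. c * f x + d * g x) = c * lac_dist f + d * lac_dist g"
    by (simp add: lac_dist_def algebra_simps)
qed

lemma tempered_lac_dist: "tempered_distribution lac_dist"
  unfolding tempered_distribution_def
proof (intro conjI exI ballI)
  fix \<theta> assume \<theta>: "\<theta> \<in> schwartz_funs"
  let ?s = "\<lambda>j k. SUP x. \<bar>x\<bar> ^ j * norm (nth_deriv k \<theta> x)"
  have s0: "?s j k \<ge> 0" for j k
    by (rule order_trans[OF _ schwartz_le_SUP[OF \<theta>, of 0]]) simp
  have "(\<Sum>k\<le>1. SUP x. norm (nth_deriv k \<theta> x)) = (\<Sum>k\<le>1. ?s 0 k)" by simp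
  also have "\<dots> \<le> (\<Sum>j\<le>1. \<Sum>k\<le>1. ?s j k)"
    by (rule member_le_sum[where f="\<lambda>j. \<Sum>k\<le>1. ?s j k"]) (simp_all only: sum_nonneg s0 atMost_iff le0 finite_atMost)
  finally show "norm (lac_dist \<theta>) \<le> bound_const * (\<Sum>j\<le>1. \<Sum>k\<le>1. ?s j k)"
    using norm_lac_dist_le_SUP[OF \<theta>] bound_const_nonneg by (meson mult_left_mono order_trans)
qed (rule lac_dist_linear)

section \<open>The Fourier transform of \<open>lac_dist\<close>, and uniqueness\<close>

lemma pairing_fourier_term:
  assumes \<theta>: "\<theta> \<in> schwartz_funs"
  shows "fourier (\<lambda>x. \<eta> x * fourier \<theta> x) (- b) = (LINT \<xi>|lborel. fourier \<eta> (\<xi> - b) * \<theta> \<xi>)"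
proof -
  let ?h = "\<lambda>x. exp (\<i> * complex_of_real (b * x)) * \<eta> x"
  have h: "?h \<in> test_funs"
    using mult_test_funs[OF \<eta> smooth_fun_cexp[of b]] by (simp only: mult.commute)
  have "fourier (\<lambda>x. \<eta> x * fourier \<theta> x) (- b) = (LINT x|lborel. ?h x * fourier \<theta> x)"
    unfolding fourier_def[of "\<lambda>x. \<eta> x * fourier \<theta> x"] by (simp add: mult_ac)
  also have "\<dots> = (LINT \<xi>|lborel. fourier ?h \<xi> * \<theta> \<xi>)"
    by (rule fourier_multiplication_formula[OF integrable_test_fun[OF h] integrable_schwartz[OF \<theta>]])
  finally show ?thesis by (simp only: fourier_modulation)
qed

text \<open>Since \<open>2 ^ m <= |\<xi>| + |\<xi> - a m|\<close>, a bump far from \<xi> is small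
  and one near \<xi> is paid for by the weight \<open>1 + |\<xi>|\<close>. A Schwartz function
  absorbs this weight when sum and integral are interchanged.\<close>

lemma norm_fourier_\<eta>_shift:
  obtains C where "C > 0" "\<And>\<xi> m. norm (fourier \<eta> (\<xi> - a m)) \<le> C * (1 + \<bar>\<xi>\<bar>) * (1 / 2) ^ m"
proof -
  obtain C where C: "C > 0" "\<And>\<xi>. norm (nth_deriv 0 (fourier \<eta>) \<xi>) \<le> C / (1 + \<bar>\<xi>\<bar>) ^ 1"
    using schwartz_fun_decay[OF fourier_schwartz[OF schwartz_\<eta>], where k=0 and q=1] by blast
  have "norm (fourier \<eta> (\<xi> - a m)) \<le> C * (1 + \<bar>\<xi>\<bar>) * (1 / 2) ^ m" for \<xi> m
  proof -
    have "2 ^ m \<le> (1 + \<bar>\<xi>\<bar>) * (1 + \<bar>\<xi> - a m\<bar>)"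
    proof -
      have "2 ^ m \<le> \<bar>\<xi>\<bar> + \<bar>\<xi> - a m\<bar>"
        using a_ge[of m] by linarith
      also have "\<dots> \<le> (1 + \<bar>\<xi>\<bar>) * (1 + \<bar>\<xi> - a m\<bar>)"
        by (simp add: algebra_simps)
      finally show ?thesis .
    qed
    then have "1 / (1 + \<bar>\<xi> - a m\<bar>) \<le> (1 + \<bar>\<xi>\<bar>) * (1 / 2) ^ m"
      by (simp add: field_simps)
    from mult_left_mono[OF this, of C] C(1) have "C / (1 + \<bar>\<xi> - a m\<bar>) \<le> C * (1 + \<bar>\<xi>\<bar>) * (1 / 2) ^ m"
      by (simp add: mult.assoc)
    with C(2)[of "\<xi> - a m"] show ?thesis by simp
  qed
  with C(1) show ?thesis using that by blast
qed

lemma lac_dist_fourier: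
  assumes \<theta>: "\<theta> \<in> schwartz_funs"
  shows "integrable lborel (\<lambda>\<xi>. (\<Sum>m. fourier \<eta> (\<xi> - a m)) * \<theta> \<xi>)"
    and "lac_dist (fourier \<theta>) = (LINT \<xi>|lborel. (\<Sum>m. fourier \<eta> (\<xi> - a m)) * \<theta> \<xi>)"
proof -
  obtain C where C: "C > 0" "\<And>\<xi> m. norm (fourier \<eta> (\<xi> - a m)) \<le> C * (1 + \<bar>\<xi>\<bar>) * (1 / 2) ^ m"
    using norm_fourier_\<eta>_shift by blast
  let ?f = "\<lambda>m \<xi>. fourier \<eta> (\<xi> - a m) * \<theta> \<xi>"
  let ?w = "\<lambda>\<xi>. C * (norm (\<theta> \<xi>) + norm (complex_of_real (\<xi> ^ 1) * nth_deriv 0 \<theta> \<xi>))"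
  have w: "integrable lborel ?w"
    by (intro integrable_mult_right Bochner_Integration.integrable_add integrable_norm
        integrable_schwartz_weighted integrable_schwartz \<theta>)
  have fw: "norm (?f m \<xi>) \<le> ?w \<xi> * (1/2) ^ m" for m \<xi>
    using mult_right_mono[OF C(2)[of \<xi> m] norm_ge_zero[of "\<theta> \<xi>"]] by (simp add: norm_mult algebra_simps)
  have sm: "summable (\<lambda>m. fourier \<eta> (\<xi> - a m))" for \<xi>
    by (rule geometric_half_bound(2)[OF C(2)])
  have "continuous_on UNIV (?f m)" for m
  proof -
    have "smooth_fun (\<lambda>\<xi>. fourier \<eta> (- a m + 1 * \<xi>))"
      by (rule smooth_fun_affine[OF schwartz_fun_smooth[OF fourier_schwartz[OF schwartz_\<eta>]]])
    from continuous_on_mult[OF continuous_on_smooth_fun[OF this]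
        continuous_on_smooth_fun[OF schwartz_fun_smooth[OF \<theta>]]]
    show ?thesis by simp
  qed
  then have fm: "?f m \<in> borel_measurable lborel" for m
    by (simp add: borel_measurable_continuous_onI)
  have int: "integrable lborel (?f m)" for m
  proof (rule Bochner_Integration.integrable_bound[OF _ fm])
    show "integrable lborel (\<lambda>\<xi>. ?w \<xi> * (1/2) ^ m)" by (intro integrable_mult_left w)
    show "AE \<xi> in lborel. norm (?f m \<xi>) \<le> norm (?w \<xi> * (1/2) ^ m)"
      unfolding real_norm_def by (intro AE_I2 order_trans[OF fw abs_ge_self])
  qed
  have s1: "AE \<xi> in lborel. summable (\<lambda>m. norm (?f m \<xi>))"
    by (intro AE_I2 geometric_half_bound(1)[OF fw])
  have s2: "summable (\<lambda>m. LINT \<xi>|lborel. norm (?f m \<xi>))"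
  proof (rule summable_comparison_test')
    show "summable (\<lambda>m. integral\<^sup>L lborel ?w * (1/2) ^ m)"
      by (intro summable_mult summable_geometric) simp
    have "(LINT \<xi>|lborel. norm (?f m \<xi>)) \<le> (LINT \<xi>|lborel. ?w \<xi> * (1/2) ^ m)" for m
      by (rule integral_mono[OF integrable_norm[OF int] integrable_mult_left[OF w] fw])
    then show "norm (LINT \<xi>|lborel. norm (?f m \<xi>)) \<le> integral\<^sup>L lborel ?w * (1/2) ^ m" for m
      by (simp add: integral_nonneg)
  qed
  have eq: "(\<Sum>m. ?f m \<xi>) = (\<Sum>m. fourier \<eta> (\<xi> - a m)) * \<theta> \<xi>" for \<xi>
    by (rule suminf_mult2[OF sm, symmetric])
  show "integrable lborel (\<lambda>\<xi>. (\<Sum>m. fourier \<eta> (\<xi> - a m)) * \<theta> \<xi>)"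
    using integrable_suminf[OF int s1 s2] by (simp only: eq)
  show "lac_dist (fourier \<theta>) = (LINT \<xi>|lborel. (\<Sum>m. fourier \<eta> (\<xi> - a m)) * \<theta> \<xi>)"
    using integral_suminf[OF int s1 s2]
    by (simp only: eq lac_dist_def pairing_def pairing_fourier_term[OF \<theta>])
qed

lemma tempered_given_by_lac_dist:
  "tempered_given_by (\<lambda>\<xi>. \<Sum>m. fourier \<eta> (\<xi> - a m)) (fourier_dist lac_dist)"
  unfolding tempered_given_by_def fourier_dist_def using lac_dist_fourier by blast

text \<open>A test function is the transform of its inverse transform, and on transforms of Schwartz
  functions both functionals are integrals against the same function.\<close>

lemma eq_lac_dist_on_test_funs:
  assumes T: "tempered_given_by (\<lambda>\<xi>. \<Sum>m. fourier \<eta> (\<xi> - a m)) (fourier_dist T)"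
    and \<theta>: "\<theta> \<in> test_funs"
  shows "T \<theta> = lac_dist \<theta>"
proof -
  have s: "\<theta> \<in> schwartz_funs" using \<theta> test_funs_subset_schwartz by blast
  note i = inverse_fourier_schwartz[OF s]
  have "T (fourier (inverse_fourier \<theta>)) = lac_dist (fourier (inverse_fourier \<theta>))"
    using T i lac_dist_fourier(2)[OF i] unfolding tempered_given_by_def fourier_dist_def by auto
  then show ?thesis by (simp only: fourier_inverse_fourier[OF s])
qed

lemma modulated_test_fun:
  "f \<in> test_funs \<Longrightarrow> (\<lambda>x. exp (\<i> * complex_of_real (b * x)) * f x) \<in> test_funs"
  using mult_test_funs[OF _ smooth_fun_cexp[of b]] by (simp only: mult.commute)

lemma lac_dist_modulated_tendsto:
  assumes \<zeta>: "\<zeta> \<in> test_funs"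
  shows "(\<lambda>M. lac_dist (\<lambda>x. exp (\<i> * complex_of_real (- a M * x)) * \<zeta> x)) \<longlonglongrightarrow>
    (LINT x|lborel. \<eta> x * \<zeta> x)"
proof -
  have w: "(\<lambda>x. \<eta> x * \<zeta> x) \<in> test_funs"
    by (rule mult_test_funs[OF \<eta> test_fun_smooth[OF \<zeta>]])
  have "(\<lambda>M. pairing (\<lambda>x. exp (\<i> * complex_of_real (- a M * x)) * (\<eta> x * \<zeta> x))) \<longlonglongrightarrow>
    (LINT x|lborel. \<eta> x * \<zeta> x)"
    using w modulated_test_fun[OF w] test_funs_subset_schwartz
    by (intro pairing_modulated_tendsto) blast+
  then show ?thesis
    unfolding lac_dist_def by (simp only: mult.left_commute)
qed

section \<open>Support, non-smoothness and extension of a functional agreeing with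
  \<open>lac_dist\<close> on test functions\<close>

context
  fixes T :: functional
  assumes T: "\<And>\<theta>. \<theta> \<in> test_funs \<Longrightarrow> T \<theta> = lac_dist \<theta>"
begin

lemma distribution_T: "distribution T"
  unfolding distribution_def
proof (intro conjI allI impI exI ballI)
  show "linear_on_funs test_funs T"
    unfolding linear_on_funs_def
  proof (intro ballI allI)
    fix f g c d assume fg: "f \<in> test_funs" "g \<in> test_funs"
    obtain R1 where R1: "\<And>x. f x \<noteq> 0 \<Longrightarrow> \<bar>x\<bar> \<le> R1" using fun_support_bounded[OF fg(1)] by blast
    obtain R2 where R2: "\<And>x. g x \<noteq> 0 \<Longrightarrow> \<bar>x\<bar> \<le> R2" using fun_support_bounded[OF fg(2)] by blast
    have "(\<lambda>x. c * f x + d * g x) \<in> test_funs"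
    proof (rule test_funsI)
      show "smooth_fun (\<lambda>x. c * f x + d * g x)"
        using fg by (intro smooth_fun_add smooth_fun_cmult test_fun_smooth)
      show "\<bar>x\<bar> \<le> max R1 R2" if "c * f x + d * g x \<noteq> 0" for x
        using R1[of x] R2[of x] that by (cases "f x = 0"; cases "g x = 0") auto
    qed
    moreover have "lac_dist (\<lambda>x. c * f x + d * g x) = c * lac_dist f + d * lac_dist g"
      using lac_dist_linear fg test_funs_subset_schwartz unfolding linear_on_funs_def by blast
    ultimately show "T (\<lambda>x. c * f x + d * g x) = c * T f + d * T g"
      using T fg by simp
  qed
  fix K \<theta> assume "\<theta> \<in> test_funs"
  then show "norm (T \<theta>) \<le> bound_const * (\<Sum>k\<le>1. SUP x. norm (nth_deriv k \<theta> x))"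
    using norm_lac_dist_le_SUP[OF subsetD[OF test_funs_subset_schwartz]] by (simp only: T)
qed

lemma dist_support_subset: "dist_support T \<subseteq> fun_support \<eta>"
proof
  fix x assume x: "x \<in> dist_support T"
  show "x \<in> fun_support \<eta>"
  proof (rule ccontr)
    assume "x \<notin> fun_support \<eta>"
    moreover have "open (- fun_support \<eta>)" by (simp add: fun_support_def open_Compl)
    ultimately obtain \<theta> where \<theta>: "\<theta> \<in> test_funs" "fun_support \<theta> \<subseteq> - fun_support \<eta>" "T \<theta> \<noteq> 0"
      using x unfolding dist_support_def by blast
    have "\<eta> y * \<theta> y = 0" for y
      using \<theta>(2) closure_subset[of "{x. \<eta> x \<noteq> 0}"] closure_subset[of "{x. \<theta> x \<noteq> 0}"]
      unfolding fun_support_def by auto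
    then have "lac_dist \<theta> = 0"
      by (simp only: lac_dist_def pairing_def fourier_def mult_zero_left Bochner_Integration.integral_zero suminf_zero)
    with T \<theta> show False by simp
  qed
qed

lemma closed_dist_support: "closed (dist_support T)"
proof -
  have "open (- dist_support T)"
    unfolding open_subopen[of "- dist_support T"]
  proof
    fix x assume "x \<in> - dist_support T"
    then obtain V where "open V" "x \<in> V" "\<forall>\<theta>\<in>test_funs. fun_support \<theta> \<subseteq> V \<longrightarrow> T \<theta> = 0"
      unfolding dist_support_def by blast
    then show "\<exists>V. open V \<and> x \<in> V \<and> V \<subseteq> - dist_support T"
      unfolding dist_support_def by (intro exI[of _ V]) blast
  qed
  then show ?thesis by (simp add: closed_def)
qed

lemma compactly_supported_T: "T \<in> compactly_supported_dists"
proof -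
  have "compact (fun_support \<eta>)" using \<eta> by (simp add: test_funs_def)
  then have "bounded (dist_support T)"
    using dist_support_subset compact_imp_bounded bounded_subset by metis
  then show ?thesis
    using closed_dist_support distribution_T
    by (simp add: compactly_supported_dists_def compact_eq_bounded_closed)
qed

text \<open>By lacunarity \<open>T\<close> is nonzero on every open set on which \<open>\<eta>\<close> is not identically zero; dilates of
  \<open>\<eta>\<close> itself serve as bump functions.\<close>

lemma in_dist_support:
  assumes y: "\<eta> y \<noteq> 0"
  shows "y \<in> dist_support T"
  unfolding dist_support_def
proof (intro CollectI allI impI)
  fix V assume V: "open V \<and> y \<in> V"
  obtain \<delta> where \<delta>: "\<delta> > 0" "cball y \<delta> \<subseteq> V"
    using V open_contains_cball by blast
  obtain R where R: "R > 0" "\<And>x. \<eta> x \<noteq> 0 \<Longrightarrow> \<bar>x\<bar> \<le> R"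
    using fun_support_bounded[OF \<eta>] by blast
  \<comment> \<open>The dilate \<open>?b\<close> about \<open>y\<close> keeps the value
    \<open>\<eta> y\<close> at \<open>y\<close>. This \<open>c\<close> makes it vanish outside
    \<open>cball y \<delta>\<close>: where \<open>?b\<close> is nonzero,
    \<open>|c * (x - y)| <= R + |y| = c * \<delta>\<close>.\<close>
  define c where "c = (R + \<bar>y\<bar>) / \<delta>"
  have c: "c > 0" using R \<delta> by (simp add: c_def add_pos_nonneg)
  let ?b = "\<lambda>x. \<eta> (y - c * y + c * x)"
  have b: "?b \<in> test_funs" using c by (intro affine_test_funs \<eta>) auto
  have b0: "x \<in> cball y \<delta>" if "?b x \<noteq> 0" for x
  proof -
    have "\<bar>y - c * y + c * x\<bar> \<le> R" by (rule R(2)[OF that])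
    then have "\<bar>c * (x - y)\<bar> \<le> R + \<bar>y\<bar>" by (simp add: algebra_simps)
    moreover have "c * \<delta> = R + \<bar>y\<bar>" using \<delta>(1) by (simp add: c_def)
    ultimately have "c * \<bar>x - y\<bar> \<le> c * \<delta>" using c by (simp add: abs_mult)
    then show ?thesis using c by (simp add: dist_real_def abs_minus_commute)
  qed
  let ?f = "\<lambda>x. \<eta> x * ?b x"
  have f: "?f \<in> test_funs" by (rule mult_test_funs[OF \<eta> test_fun_smooth[OF b]])
  \<comment> \<open>Chosen so that \<open>\<eta> * ?\<zeta>\<close> is the square modulus of
    \<open>?f\<close>; the limit of the modulated pairings is then nonzero.\<close>
  let ?\<zeta> = "\<lambda>x. ?b x * cnj (?f x)"
  have \<zeta>: "?\<zeta> \<in> test_funs" by (rule mult_test_funs[OF b smooth_fun_cnj[OF test_fun_smooth[OF f]]])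
  have "(LINT x|lborel. ?f x * cnj (?f x)) \<noteq> 0"
    by (rule integral_norm_square_nonzero[OF f, of y]) (use y in simp)
  then have nz: "(LINT x|lborel. \<eta> x * ?\<zeta> x) \<noteq> 0" by (simp only: mult.assoc simp_thms)
  have "\<exists>M. lac_dist (\<lambda>x. exp (\<i> * complex_of_real (- a M * x)) * ?\<zeta> x) \<noteq> 0"
  proof (rule ccontr)
    assume "\<not> ?thesis"
    then have "(\<lambda>M. lac_dist (\<lambda>x. exp (\<i> * complex_of_real (- a M * x)) * ?\<zeta> x)) = (\<lambda>_. 0)" by blast
    with lac_dist_modulated_tendsto[OF \<zeta>]
    have "(\<lambda>M. 0) \<longlonglongrightarrow> (LINT x|lborel. \<eta> x * ?\<zeta> x)" by (simp only:)
    from LIMSEQ_unique[OF this tendsto_const] nz show False by blast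
  qed
  then obtain M where M: "lac_dist (\<lambda>x. exp (\<i> * complex_of_real (- a M * x)) * ?\<zeta> x) \<noteq> 0" ..
  let ?\<theta> = "\<lambda>x. exp (\<i> * complex_of_real (- a M * x)) * ?\<zeta> x"
  have \<theta>: "?\<theta> \<in> test_funs" by (rule modulated_test_fun[OF \<zeta>])
  have "{x. ?\<theta> x \<noteq> 0} \<subseteq> cball y \<delta>" using b0 by auto
  then have "fun_support ?\<theta> \<subseteq> cball y \<delta>"
    unfolding fun_support_def by (rule closure_minimal) simp
  with \<theta> M \<delta>(2) T show "\<exists>\<theta>\<in>test_funs. fun_support \<theta> \<subseteq> V \<and> T \<theta> \<noteq> 0"
    by (intro bexI[of _ ?\<theta>]) auto
qed

lemma not_smooth_T:
  assumes "\<eta> y \<noteq> 0"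
  shows "T \<notin> smooth_dists"
proof
  assume "T \<in> smooth_dists"
  then obtain f where f: "smooth_fun f" "dist_given_by f T"
    by (auto simp: smooth_dists_def)
  \<comment> \<open>With this choice lacunarity predicts the integral of the square modulus of
    \<eta> as the limit, while smoothness of \<open>f\<close> forces the decay of
    \<open>fourier ?g (a M)\<close>.\<close>
  let ?\<zeta> = "\<lambda>x. cnj (\<eta> x)"
  have \<zeta>: "?\<zeta> \<in> test_funs" by (rule cnj_test_funs[OF \<eta>])
  let ?g = "\<lambda>x. ?\<zeta> x * f x"
  have g: "?g \<in> schwartz_funs"
    using mult_test_funs[OF \<zeta> f(1)] test_funs_subset_schwartz by blast
  let ?I = "LINT x|lborel. norm (nth_deriv 1 ?g x)"
  have eq: "lac_dist (\<lambda>x. exp (\<i> * complex_of_real (- a M * x)) * ?\<zeta> x) = fourier ?g (a M)" for M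
  proof -
    have \<theta>: "(\<lambda>x. exp (\<i> * complex_of_real (- a M * x)) * ?\<zeta> x) \<in> test_funs"
      by (rule modulated_test_fun[OF \<zeta>])
    have "T (\<lambda>x. exp (\<i> * complex_of_real (- a M * x)) * ?\<zeta> x) =
        (LINT x|lborel. f x * (exp (\<i> * complex_of_real (- a M * x)) * ?\<zeta> x))"
      using f(2) \<theta> unfolding dist_given_by_def by blast
    then show ?thesis
      unfolding T[OF \<theta>] fourier_def by (simp add: mult_ac)
  qed
  have "norm (fourier ?g (a M)) \<le> ?I * (1/2) ^ M" for M
  proof -
    have "2 ^ M * norm (fourier ?g (a M)) \<le> \<bar>a M\<bar> * norm (fourier ?g (a M))"
      using a_ge[of M] by (intro mult_right_mono) auto
    also have "\<dots> \<le> ?I" by (rule norm_fourier_decay[OF g])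
    finally show ?thesis by (simp add: field_simps)
  qed
  moreover have "(\<lambda>M. ?I * (1/2) ^ M) \<longlonglongrightarrow> 0"
    by (intro tendsto_mult_right_zero LIMSEQ_power_zero) simp
  ultimately have "(\<lambda>M. fourier ?g (a M)) \<longlonglongrightarrow> 0"
    by (rule Lim_null_comparison[OF always_eventually[OF allI]])
  moreover have "(\<lambda>M. fourier ?g (a M)) \<longlonglongrightarrow> (LINT x|lborel. \<eta> x * ?\<zeta> x)"
    using lac_dist_modulated_tendsto[OF \<zeta>] by (simp only: eq)
  ultimately show False
    using LIMSEQ_unique integral_norm_square_nonzero[OF \<eta> assms] by blast
qed

lemma extend_T_to_smooth:
  assumes f: "smooth_fun f" and y: "\<eta> y \<noteq> 0"
  shows "extend_to_smooth T f = lac_dist f"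
proof -
  obtain R where R: "R > 0" "\<And>x. x \<in> fun_support \<eta> \<Longrightarrow> \<bar>x\<bar> \<le> R"
  proof -
    have "bounded (fun_support \<eta>)" using \<eta> by (simp add: test_funs_def compact_imp_bounded)
    then show ?thesis using that unfolding bounded_pos by auto
  qed
  \<comment> \<open>An actual cutoff has to be exhibited before anything can be said about the one
    picked by \<open>SOME\<close>.\<close>
  obtain \<kappa>0 where "\<kappa>0 \<in> test_funs" "\<And>x. \<bar>x\<bar> < R + 1 \<Longrightarrow> \<kappa>0 x = 1"
    using exists_cutoff[OF \<eta> y] by blast
  moreover have "dist_support T \<subseteq> ball 0 (R + 1)"
    using R(2) dist_support_subset by fastforce
  ultimately have "cutoff_for T \<kappa>0"
    unfolding cutoff_for_def by (intro conjI exI[of _ "ball 0 (R + 1)"]) (auto simp: dist_real_def)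
  then have \<kappa>: "cutoff_for T (SOME \<kappa>. cutoff_for T \<kappa>)" (is "cutoff_for T ?\<kappa>")
    by (rule someI[of "cutoff_for T"])
  then have t: "?\<kappa> \<in> test_funs" by (simp add: cutoff_for_def)
  have "\<eta> x * (?\<kappa> x * f x) = \<eta> x * f x" for x
  proof (cases "\<eta> x = 0")
    case False
    from in_dist_support[OF this] \<kappa> have "?\<kappa> x = 1" unfolding cutoff_for_def by blast
    then show ?thesis by simp
  qed simp
  moreover have "T (\<lambda>x. ?\<kappa> x * f x) = lac_dist (\<lambda>x. ?\<kappa> x * f x)"
    by (rule T[OF mult_test_funs[OF t f]])
  ultimately show ?thesis
    by (simp only: extend_to_smooth_def lac_dist_def)
qed

end

text \<open>Through the primitive, the product rule gives two ordinary convolutions with compactly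
  supported integrable functions, one against \<open>f\<close> and one against its derivative. Every
  smooth \<open>f\<close> is allowed, hence the mollifier at every \<epsilon> in (0,1].\<close>

lemma smooth_fun_lac_dist_conv:
  assumes f: "smooth_fun f"
  shows "smooth_fun (\<lambda>x. lac_dist (\<lambda>y. f (x - y)))"
proof -
  let ?A = "\<lambda>y. primitive y * nth_deriv 1 \<eta> y" and ?B = "\<lambda>y. primitive y * \<eta> y"
  let ?f' = "nth_deriv 1 f"
  have f': "smooth_fun ?f'" by (rule smooth_fun_nth_deriv[OF f])
  obtain R where R: "\<And>x. x \<in> fun_support \<eta> \<Longrightarrow> \<bar>x\<bar> \<le> R"
  proof -
    have "bounded (fun_support \<eta>)" using \<eta> by (simp add: test_funs_def compact_imp_bounded)
    then show ?thesis using that unfolding bounded_pos by auto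
  qed
  have A: "integrable lborel ?A" "\<And>y. ?A y \<noteq> 0 \<Longrightarrow> \<bar>y\<bar> \<le> R"
    using R nth_deriv_support[of 1 \<eta>]
      integrable_primitive_mult[OF integrable_schwartz_nth_deriv[OF schwartz_\<eta>, of 1]]
    by (auto simp del: One_nat_def)
  have B: "integrable lborel ?B" "\<And>y. ?B y \<noteq> 0 \<Longrightarrow> \<bar>y\<bar> \<le> R"
    using R nth_deriv_support[of 0 \<eta>] integrable_primitive_mult[OF integrable_schwartz[OF schwartz_\<eta>]]
    by auto
  have "lac_dist (\<lambda>y. f (x - y)) =
      (LINT y|lborel. ?A y * f (x - y)) + (-1) * (LINT y|lborel. ?B y * ?f' (x - y))" for x
  proof -
    have sf: "smooth_fun (\<lambda>y. f (x - y))" by (rule smooth_fun_minus_arg[OF f])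
    have d: "nth_deriv 1 (\<lambda>y. f (x - y)) y = - ?f' (x - y)" for y
      using nth_deriv_affine[OF f, of 1 x "-1" y] by simp
    have "lac_dist (\<lambda>y. f (x - y)) = (LINT y|lborel. ?A y * f (x - y) - ?B y * ?f' (x - y))"
      unfolding lac_dist_def pairing_eq_integral[OF \<eta>_mult_schwartz[OF sf]]
        nth_deriv_1_mult[OF smooth_\<eta> sf] d
      by (simp add: algebra_simps del: One_nat_def)
    also have "\<dots> = (LINT y|lborel. ?A y * f (x - y)) - (LINT y|lborel. ?B y * ?f' (x - y))"
      by (intro Bochner_Integration.integral_diff integrable_convolution[OF A f] integrable_convolution[OF B f'])
    finally show ?thesis by simp
  qed
  then show ?thesis
    by (simp only:) (intro smooth_fun_add smooth_fun_cmult smooth_fun_convolution[OF A f] smooth_fun_convolution[OF B f'])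
qed

end

section \<open>Mollification on the Fourier side\<close>

text \<open>As \<open>f\<close> need not be integrable, its tempered extension \<open>W\<close> is
  used. The substitution \<open>y = x - e * z\<close> turns the convolution into \<open>W\<close>
  evaluated at a dilated test function; written as the transform of its inverse transform, this is
  an integral against \<open>g\<close>.\<close>

lemma
  assumes ff: "has_fourier_fun f g" and h: "h \<in> test_funs" and e: "e > 0"
  shows integrable_mollified: "integrable lborel (\<lambda>\<xi>. g (e * \<xi>) * fourier h \<xi>)"
    and integral_mollified: "(LINT y|lborel. h y * (complex_of_real (1 / e) * f ((x - y) / e))) =
      (LINT \<xi>|lborel. g (e * \<xi>) * fourier h \<xi> * exp (\<i> * complex_of_real (x * \<xi>))) / (2 * pi)"
proof -
  obtain W where W: "dist_given_by f W" "tempered_given_by g (fourier_dist W)"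
    using ff unfolding has_fourier_fun_def by blast
  let ?\<theta> = "\<lambda>x z. h (x + (- e) * z)"
  have \<theta>: "?\<theta> x \<in> test_funs" for x
    using e by (intro affine_test_funs h) auto
  then have \<theta>s: "?\<theta> x \<in> schwartz_funs" for x
    using test_funs_subset_schwartz by blast
  have inv: "inverse_fourier (?\<theta> x) (e * s) =
      complex_of_real (1 / (2 * pi * e)) * (fourier h s * exp (\<i> * complex_of_real (x * s)))" for x s
  proof -
    have "fourier h s = e *\<^sub>R (LINT z|lborel. h (x + (- e) * z) * exp (- (\<i> * complex_of_real ((x + (- e) * z) * s))))"
      unfolding fourier_def using e by (subst lborel_integral_real_affine[where c="- e" and t=x]) auto
    also have "(LINT z|lborel. h (x + (- e) * z) * exp (- (\<i> * complex_of_real ((x + (- e) * z) * s)))) =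
        (LINT z|lborel. exp (- (\<i> * complex_of_real (x * s))) * (?\<theta> x z * exp (- (\<i> * complex_of_real (z * - (e * s))))))"
    proof (rule Bochner_Integration.integral_cong[OF refl])
      fix z
      have "exp (- (\<i> * complex_of_real ((x + (- e) * z) * s))) =
          exp (- (\<i> * complex_of_real (x * s))) * exp (- (\<i> * complex_of_real (z * - (e * s))))"
        unfolding exp_add[symmetric] by (simp add: algebra_simps)
      then show "h (x + (- e) * z) * exp (- (\<i> * complex_of_real ((x + (- e) * z) * s))) =
          exp (- (\<i> * complex_of_real (x * s))) * (?\<theta> x z * exp (- (\<i> * complex_of_real (z * - (e * s)))))"
        by (simp only: mult_ac)
    qed
    also have "\<dots> = exp (- (\<i> * complex_of_real (x * s))) * fourier (?\<theta> x) (- (e * s))"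
      unfolding fourier_def by (rule integral_mult_right_zero)
    finally have "fourier h s * exp (\<i> * complex_of_real (x * s)) =
        e *\<^sub>R (fourier (?\<theta> x) (- (e * s)) * (exp (- (\<i> * complex_of_real (x * s))) * exp (\<i> * complex_of_real (x * s))))"
      by (simp only: scaleR_conv_of_real mult_ac)
    also have "exp (- (\<i> * complex_of_real (x * s))) * exp (\<i> * complex_of_real (x * s)) = 1"
      unfolding exp_add[symmetric] by simp
    finally show ?thesis
      using e by (simp add: inverse_fourier_altdef scaleR_conv_of_real)
  qed
  have int: "integrable lborel (\<lambda>\<xi>. g \<xi> * inverse_fourier (?\<theta> x) \<xi>)"
    and val: "W (?\<theta> x) = (LINT \<xi>|lborel. g \<xi> * inverse_fourier (?\<theta> x) \<xi>)" for x
    using W(2) inverse_fourier_schwartz[OF \<theta>s[of x]] fourier_inverse_fourier[OF \<theta>s[of x]]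
    unfolding tempered_given_by_def fourier_dist_def by auto
  \<comment> \<open>At \<open>x = 0\<close> the exponential factor in \<open>inv\<close> is 1, so
    integrability of the bare product can be read off.\<close>
  have "integrable lborel (\<lambda>s. g (0 + e * s) * inverse_fourier (?\<theta> 0) (0 + e * s))"
    using e by (intro lborel_integrable_real_affine[OF int]) auto
  then have "integrable lborel (\<lambda>s. complex_of_real (1 / (2 * pi * e)) * (g (e * s) * fourier h s))"
    unfolding add_0_left[of "e * _"] inv by (simp only: mult_zero_left of_real_0 mult_zero_right exp_zero mult_1_right mult_1_left mult_ac)
  then have "integrable lborel (\<lambda>s. complex_of_real (2 * pi * e) *
      (complex_of_real (1 / (2 * pi * e)) * (g (e * s) * fourier h s)))"
    by (rule integrable_mult_right)
  moreover have "complex_of_real (2 * pi * e) * (complex_of_real (1 / (2 * pi * e)) * z) = z" for z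
    using e by simp
  ultimately show "integrable lborel (\<lambda>\<xi>. g (e * \<xi>) * fourier h \<xi>)"
    by (simp only:)
  have "(LINT y|lborel. h y * (complex_of_real (1 / e) * f ((x - y) / e))) =
      e *\<^sub>R (LINT z|lborel. h (x + (- e) * z) * (complex_of_real (1 / e) * f ((x - (x + (- e) * z)) / e)))"
    using e by (subst lborel_integral_real_affine[where c="- e" and t=x]) auto
  also have "\<dots> = e *\<^sub>R (LINT z|lborel. complex_of_real (1 / e) * (f z * ?\<theta> x z))"
    using e by (simp add: mult_ac)
  also have "\<dots> = (LINT z|lborel. f z * ?\<theta> x z)"
    using e by (simp only: integral_mult_right_zero) (simp add: scaleR_conv_of_real)
  also have "\<dots> = W (?\<theta> x)"
    using W(1) \<theta>[of x] unfolding dist_given_by_def by simp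
  also have "\<dots> = e *\<^sub>R (LINT s|lborel. g (0 + e * s) * inverse_fourier (?\<theta> x) (0 + e * s))"
    unfolding val using e by (subst lborel_integral_real_affine[where c=e and t=0]) auto
  also have "(LINT s|lborel. g (0 + e * s) * inverse_fourier (?\<theta> x) (0 + e * s)) =
      (LINT s|lborel. complex_of_real (1 / (2 * pi * e)) *
        (g (e * s) * fourier h s * exp (\<i> * complex_of_real (x * s))))"
    by (simp only: add_0_left inv) (simp only: mult_ac)
  also have "\<dots> = complex_of_real (1 / (2 * pi * e)) *
      (LINT s|lborel. g (e * s) * fourier h s * exp (\<i> * complex_of_real (x * s)))"
    by (rule integral_mult_right_zero)
  finally show "(LINT y|lborel. h y * (complex_of_real (1 / e) * f ((x - y) / e))) =
      (LINT \<xi>|lborel. g (e * \<xi>) * fourier h \<xi> * exp (\<i> * complex_of_real (x * \<xi>))) / (2 * pi)"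
    using e by (simp add: scaleR_conv_of_real)
qed

text \<open>The series is summed on the Fourier side first, so \<open>u\<close> is the transform of
  a single function and no series is differentiated termwise. In the weight, \<open>k\<close> powers
  pay for the derivatives and 2 for integrability.\<close>

lemma norm_nth_deriv_inverse_fourier_series:
  fixes G :: "nat \<Rightarrow> real \<Rightarrow> complex"
  assumes meas: "\<And>m. G m \<in> borel_measurable borel"
    and bound: "\<And>m \<xi>. (1 + \<bar>\<xi>\<bar>) ^ (k + 2) * norm (G m \<xi>) \<le> D * (1 / 2) ^ m"
    and u: "\<And>x. u x = (\<Sum>m. LINT \<xi>|lborel. G m \<xi> * exp (\<i> * complex_of_real (x * \<xi>)))"
  shows "norm (nth_deriv k u x) \<le> 2 * D * (LINT \<xi>|lborel. 1 / (1 + \<bar>\<xi>\<bar>) ^ 2)"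
proof -
  let ?w = "\<lambda>\<xi>::real. 1 / (1 + \<bar>\<xi>\<bar>) ^ 2"
  have D: "D \<ge> 0"
    using order_trans[OF _ bound[of 0 0]] by simp
  have w1: "(1 + \<bar>\<xi>\<bar>) ^ j > 0" for \<xi> :: real and j
    by (intro zero_less_power) linarith
  have b: "(1 + \<bar>\<xi>\<bar>) ^ k * norm (G m \<xi>) \<le> D * ?w \<xi> * (1 / 2) ^ m" for m \<xi>
  proof -
    have "((1 + \<bar>\<xi>\<bar>) ^ k * norm (G m \<xi>)) * (1 + \<bar>\<xi>\<bar>) ^ 2 \<le> D * (1 / 2) ^ m"
      using bound[of \<xi> m] by (simp only: power_add mult_ac)
    then have "(1 + \<bar>\<xi>\<bar>) ^ k * norm (G m \<xi>) \<le> D * (1 / 2) ^ m / (1 + \<bar>\<xi>\<bar>) ^ 2"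
      by (simp only: pos_le_divide_eq[OF w1])
    then show ?thesis by simp
  qed
  have b0: "norm (G m \<xi>) \<le> D * ?w \<xi> * (1 / 2) ^ m" for m \<xi>
  proof -
    have "1 * norm (G m \<xi>) \<le> (1 + \<bar>\<xi>\<bar>) ^ k * norm (G m \<xi>)"
      by (intro mult_right_mono one_le_power) auto
    with b[of \<xi> m] show ?thesis by simp
  qed
  \<comment> \<open>The reflection turns the inverse transforms into \<open>fourier\<close>, to
    which \<open>nth_deriv_fourier\<close> applies.\<close>
  define H where "H \<xi> = (\<Sum>m. G m (- \<xi>))" for \<xi>
  have Gr: "(\<lambda>\<xi>. G m (- \<xi>)) \<in> borel_measurable borel" for m
    using measurable_compose[OF _ meas, of uminus] by simp
  have Hm: "H \<in> borel_measurable borel"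
    unfolding H_def[abs_def] using Gr by (rule borel_measurable_suminf)
  have Hb: "(1 + \<bar>\<xi>\<bar>) ^ k * norm (H \<xi>) \<le> 2 * D * ?w \<xi>" for \<xi>
  proof -
    have "norm (complex_of_real ((1 + \<bar>\<xi>\<bar>) ^ k) * G m (- \<xi>)) \<le> D * ?w \<xi> * (1 / 2) ^ m" for m
      using b[of "- \<xi>" m] by (simp add: norm_mult norm_power del: of_real_power of_real_add)
    from geometric_half_bound(3)[OF this]
    have "norm (\<Sum>m. complex_of_real ((1 + \<bar>\<xi>\<bar>) ^ k) * G m (- \<xi>)) \<le> 2 * (D * ?w \<xi>)" .
    moreover have "summable (\<lambda>m. G m (- \<xi>))"
      using geometric_half_bound(2)[of "\<lambda>m. G m (- \<xi>)" "D * ?w \<xi>"] b0[of _ "- \<xi>"] by simp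
    then have "(\<Sum>m. complex_of_real ((1 + \<bar>\<xi>\<bar>) ^ k) * G m (- \<xi>)) = complex_of_real ((1 + \<bar>\<xi>\<bar>) ^ k) * H \<xi>"
      unfolding H_def by (rule suminf_mult)
    ultimately show ?thesis
      by (simp add: norm_mult norm_power mult.assoc del: of_real_power of_real_add)
  qed
  have pw: "norm (complex_of_real (\<xi> ^ j) * H \<xi>) \<le> 2 * D / (1 + \<bar>\<xi>\<bar>) ^ 2" if "j \<le> k" for j \<xi>
  proof -
    have "\<bar>\<xi>\<bar> ^ j \<le> (1 + \<bar>\<xi>\<bar>) ^ j" by (rule power_mono) auto
    also have "\<dots> \<le> (1 + \<bar>\<xi>\<bar>) ^ k" by (rule power_increasing[OF that]) simp
    finally have "\<bar>\<xi>\<bar> ^ j * norm (H \<xi>) \<le> (1 + \<bar>\<xi>\<bar>) ^ k * norm (H \<xi>)"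
      by (rule mult_right_mono) simp
    with Hb[of \<xi>] show ?thesis by (simp add: norm_mult norm_power)
  qed
  have int: "integrable lborel (\<lambda>\<xi>. complex_of_real (\<xi> ^ j) * H \<xi>)" if "j \<le> k" for j
    by (rule integrable_decay[OF _ pw[OF that]]) (use Hm in simp)
  have "u = fourier H"
  proof
    fix x
    let ?e = "\<lambda>\<xi>. exp (- (\<i> * complex_of_real (\<xi> * x)))"
    let ?f = "\<lambda>m \<xi>. G m (- \<xi>) * ?e \<xi>"
    have fb: "norm (?f m \<xi>) \<le> D * ?w \<xi> * (1 / 2) ^ m" for m \<xi>
      using b0[of m "- \<xi>"] unfolding norm_mult norm_exp_minus_i by simp
    have fint: "integrable lborel (?f m)" for m
    proof (rule integrable_decay)
      show "norm (?f m \<xi>) \<le> (D * (1/2) ^ m) / (1 + \<bar>\<xi>\<bar>) ^ 2" for \<xi>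
        using fb[of m \<xi>] by simp
    qed (use Gr in simp)
    have wint: "integrable lborel (\<lambda>\<xi>. D * ?w \<xi> * (1/2) ^ m)" for m
      by (intro integrable_mult_left integrable_mult_right integrable_inverse_square_weight)
    have "(LINT \<xi>|lborel. (\<Sum>m. ?f m \<xi>)) = (\<Sum>m. integral\<^sup>L lborel (?f m))"
    proof (rule integral_suminf[OF fint])
      show "AE \<xi> in lborel. summable (\<lambda>m. norm (?f m \<xi>))"
        by (intro AE_I2 geometric_half_bound(1)[OF fb])
      show "summable (\<lambda>m. LINT \<xi>|lborel. norm (?f m \<xi>))"
      proof (rule summable_comparison_test')
        show "summable (\<lambda>m. (LINT \<xi>|lborel. D * ?w \<xi>) * (1/2) ^ m)"
          by (intro summable_mult summable_geometric) simp
        have "(LINT \<xi>|lborel. norm (?f m \<xi>)) \<le> (LINT \<xi>|lborel. D * ?w \<xi> * (1/2) ^ m)" for m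
          by (rule integral_mono[OF integrable_norm[OF fint] wint fb])
        then show "norm (LINT \<xi>|lborel. norm (?f m \<xi>)) \<le> (LINT \<xi>|lborel. D * ?w \<xi>) * (1/2) ^ m" for m
          unfolding integral_mult_left_zero by (simp add: integral_nonneg)
      qed
    qed
    moreover have "integral\<^sup>L lborel (?f m) = (LINT \<xi>|lborel. G m \<xi> * exp (\<i> * complex_of_real (x * \<xi>)))" for m
    proof -
      have "(LINT \<xi>|lborel. G m (- \<xi>) * exp (\<i> * complex_of_real (x * (- \<xi>)))) =
          (LINT \<xi>|lborel. G m \<xi> * exp (\<i> * complex_of_real (x * \<xi>)))"
        by (rule integral_reflect)
      then show ?thesis by (simp add: mult.commute[of x])
    qed
    moreover have "(\<Sum>m. ?f m \<xi>) = H \<xi> * ?e \<xi>" for \<xi>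
      unfolding H_def
      using geometric_half_bound(2)[of "\<lambda>m. G m (- \<xi>)" "D * ?w \<xi>"] b0[of _ "- \<xi>"]
      by (intro suminf_mult2[symmetric]) simp
    ultimately show "u x = fourier H x"
      unfolding u fourier_def by (simp only:)
  qed
  then have "nth_deriv k u x = fourier (\<lambda>\<xi>. (- \<i>) ^ k * complex_of_real (\<xi> ^ k) * H \<xi>) x"
    using nth_deriv_fourier[OF int] by simp
  also have "norm \<dots> \<le> (LINT \<xi>|lborel. norm ((- \<i>) ^ k * complex_of_real (\<xi> ^ k) * H \<xi>))"
    by (rule norm_fourier_le)
  also have "\<dots> = (LINT \<xi>|lborel. norm (complex_of_real (\<xi> ^ k) * H \<xi>))"
    by (simp add: norm_mult norm_power)
  also have "\<dots> \<le> (LINT \<xi>|lborel. 2 * D * ?w \<xi>)"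
    using pw[OF order_refl]
    by (intro integral_mono integrable_norm int integrable_mult_right integrable_inverse_square_weight) auto
  also have "\<dots> = 2 * D * (LINT \<xi>|lborel. ?w \<xi>)"
    by (rule integral_mult_right_zero)
  finally show ?thesis .
qed

section \<open>Decay estimates\<close>

lemma japanese_bracket_powr_le:
  "japanese_bracket \<xi> powr (- real p) \<le> 2 ^ p / (1 + \<bar>\<xi>\<bar>) ^ p"
proof -
  have "((1 + \<bar>\<xi>\<bar>) / 2)\<^sup>2 \<le> 1 + \<bar>\<xi>\<bar>\<^sup>2"
    using sum_squares_bound[of 1 "\<bar>\<xi>\<bar>"] by (simp add: power_divide power2_sum)
  then have b: "(1 + \<bar>\<xi>\<bar>) / 2 \<le> japanese_bracket \<xi>"
    unfolding japanese_bracket_def by (rule real_le_rsqrt)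
  have pos: "(1 + \<bar>\<xi>\<bar>) / 2 > 0" by (simp add: add_pos_nonneg)
  have "japanese_bracket \<xi> powr (- real p) = 1 / japanese_bracket \<xi> ^ p"
    using less_le_trans[OF pos b] by (simp add: powr_minus powr_realpow divide_inverse)
  also have "\<dots> \<le> 1 / ((1 + \<bar>\<xi>\<bar>) / 2) ^ p"
    using pos b by (intro divide_left_mono power_mono mult_pos_pos zero_less_power) auto
  also have "\<dots> = 2 ^ p / (1 + \<bar>\<xi>\<bar>) ^ p"
    by (simp add: power_divide)
  finally show ?thesis .
qed

text \<open>A frequency \<open>a\<close> much smaller than \<open>1/\<epsilon>\<close> costs at most a factor \<open>1/\<epsilon>\<close>; a frequency much larger
  than \<open>1/\<epsilon>\<close> is damped by the mollifier.\<close>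

lemma frequency_estimate:
  fixes \<xi> e a :: real
  assumes p_def: "p = 2 * (k + 3)"
    and e: "0 < e" "e \<le> 1" and a: "a \<ge> 2 ^ m"
    and cond: "a ^ (k + 3) \<le> 1 / e \<or> a \<le> (e * a)\<^sup>2"
    and C: "C \<ge> 0" "x \<le> C * japanese_bracket (e * \<xi>) powr (- real p)" and x: "x \<ge> 0"
    and B: "B \<ge> 0" "y \<le> B / (1 + \<bar>\<xi> - a\<bar>) ^ (k + 2 + p)" and y: "y \<ge> 0"
  shows "(1 + \<bar>\<xi>\<bar>) ^ (k + 2) * (x * y) \<le> C * B * 2 ^ p * 2 ^ (k + 2) / e * (1 / 2) ^ m"
proof -
  have a1: "a \<ge> 1" using a by (rule order_trans[rotated]) simp
  let ?s = "1 + \<bar>\<xi> - a\<bar>"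
  have s1: "?s \<ge> 1" by simp
  have inv_a: "1 / a \<le> (1 / 2) ^ m"
    using a a1 by (simp add: power_one_over frac_le)
  have x': "x \<le> C * (2 ^ p / (1 + e * \<bar>\<xi>\<bar>) ^ p)"
    using C(2) mult_left_mono[OF japanese_bracket_powr_le[of "e * \<xi>" p] C(1)] e by (simp add: abs_mult)
  \<comment> \<open>The weight in \<xi> is traded for powers of \<open>a\<close> and of the distance
    to \<open>a\<close>. Of the exponent \<open>k + 2 + p\<close> in the decay of \<open>y\<close>,
    the part \<open>k + 2\<close> cancels the latter and \<open>p\<close> is kept.\<close>
  have "1 + \<bar>\<xi>\<bar> \<le> 1 + a + \<bar>\<xi> - a\<bar>" using a1 by linarith
  also have "\<dots> \<le> (1 + a) * ?s" using a1 by (simp add: algebra_simps)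
  also have "\<dots> \<le> (2 * a) * ?s" using a1 by (intro mult_right_mono) auto
  finally have "(1 + \<bar>\<xi>\<bar>) ^ (k + 2) \<le> ((2 * a) * ?s) ^ (k + 2)"
    by (intro power_mono) auto
  then have \<xi>: "(1 + \<bar>\<xi>\<bar>) ^ (k + 2) \<le> 2 ^ (k + 2) * a ^ (k + 2) * ?s ^ (k + 2)"
    by (simp only: power_mult_distrib)
  have "(1 + \<bar>\<xi>\<bar>) ^ (k + 2) * y \<le> (2 ^ (k + 2) * a ^ (k + 2) * ?s ^ (k + 2)) * (B / ?s ^ (k + 2 + p))"
    using \<xi> B y a1 by (intro mult_mono) auto
  also have "\<dots> = 2 ^ (k + 2) * a ^ (k + 2) * B / ?s ^ p"
  proof -
    have "?s ^ (k + 2) \<noteq> 0" using s1 by auto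
    then show ?thesis unfolding power_add[of ?s "k + 2" p] by simp
  qed
  finally have \<xi>y: "(1 + \<bar>\<xi>\<bar>) ^ (k + 2) * y \<le> 2 ^ (k + 2) * a ^ (k + 2) * B / ?s ^ p" .
  have "(1 + \<bar>\<xi>\<bar>) ^ (k + 2) * (x * y) = x * ((1 + \<bar>\<xi>\<bar>) ^ (k + 2) * y)" by simp
  also have "\<dots> \<le> C * (2 ^ p / (1 + e * \<bar>\<xi>\<bar>) ^ p) * (2 ^ (k + 2) * a ^ (k + 2) * B / ?s ^ p)"
    using x' \<xi>y x y C by (intro mult_mono) (auto intro!: mult_nonneg_nonneg divide_nonneg_nonneg simp: e less_imp_le)
  also have "\<dots> = (C * B * 2 ^ p * 2 ^ (k + 2)) * (a ^ (k + 2) / ((1 + e * \<bar>\<xi>\<bar>) * ?s) ^ p)"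
    by (simp add: power_mult_distrib)
  also have "\<dots> \<le> (C * B * 2 ^ p * 2 ^ (k + 2)) * (1 / e * (1 / 2) ^ m)"
  proof (rule mult_left_mono)
    \<comment> \<open>One power of \<open>a\<close> more than the weight requires is controlled: the
      surplus \<open>1 / a\<close> yields the summable factor \<open>(1 / 2) ^ m\<close>.\<close>
    have k3: "a ^ (k + 2) = a ^ (k + 3) * (1 / a)" using a1 by (simp add: power_add eval_nat_numeral)
    have es: "1 + e * \<bar>\<xi>\<bar> \<ge> 1" using e by simp
    show "a ^ (k + 2) / ((1 + e * \<bar>\<xi>\<bar>) * ?s) ^ p \<le> 1 / e * (1 / 2) ^ m"
      using cond
    proof
      assume low: "a ^ (k + 3) \<le> 1 / e"
      have "1 * 1 \<le> (1 + e * \<bar>\<xi>\<bar>) * ?s" using es s1 by (intro mult_mono) auto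
      then have "1 \<le> ((1 + e * \<bar>\<xi>\<bar>) * ?s) ^ p" by (intro one_le_power) simp
      then have "a ^ (k + 2) / ((1 + e * \<bar>\<xi>\<bar>) * ?s) ^ p \<le> a ^ (k + 2) / 1"
        using a1 by (intro divide_left_mono) auto
      also have "\<dots> \<le> 1 / e * (1 / 2) ^ m"
        unfolding div_by_1 k3 using low inv_a a1 e by (intro mult_mono) auto
      finally show ?thesis .
    next
      assume high: "a \<le> (e * a)\<^sup>2"
      \<comment> \<open>Either \<xi> is far from \<open>a\<close> or \<open>e * |\<xi>|\<close> is
        comparable to \<open>e * a\<close>. The product of the two weights is therefore at least
        \<open>e * a\<close> in all cases, using \<open>e <= 1\<close>.\<close>
      have "e * a \<le> e * (\<bar>\<xi>\<bar> + \<bar>\<xi> - a\<bar>)" using e by (intro mult_left_mono) auto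
      also have "\<dots> \<le> e * \<bar>\<xi>\<bar> + \<bar>\<xi> - a\<bar>"
        using e mult_right_mono[OF e(2), of "\<bar>\<xi> - a\<bar>"] by (simp add: algebra_simps)
      also have "\<dots> \<le> (1 + e * \<bar>\<xi>\<bar>) * ?s"
        using e by (simp add: algebra_simps)
      finally have "(e * a) ^ p \<le> ((1 + e * \<bar>\<xi>\<bar>) * ?s) ^ p"
        using e a1 by (intro power_mono) auto
      \<comment> \<open>This is why \<open>p = 2 * (k + 3)\<close>: the exponent 2 matches the
        square in the condition on high frequencies.\<close>
      moreover have "a ^ (k + 3) \<le> (e * a) ^ p"
        unfolding p_def power_mult using high a1 by (intro power_mono) auto
      ultimately have "a ^ (k + 3) \<le> ((1 + e * \<bar>\<xi>\<bar>) * ?s) ^ p" by linarith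
      then have "a ^ (k + 2) / ((1 + e * \<bar>\<xi>\<bar>) * ?s) ^ p \<le> a ^ (k + 2) / a ^ (k + 3)"
        using a1 by (intro frac_le) auto
      also have "\<dots> = 1 / a" using a1 by (simp add: power_add eval_nat_numeral)
      also have "\<dots> \<le> 1 * (1 / 2) ^ m" using inv_a by simp
      also have "\<dots> \<le> 1 / e * (1 / 2) ^ m" using e by (intro mult_right_mono) auto
      finally show ?thesis .
    qed
  qed (use C B in simp)
  finally show ?thesis by simp
qed

context lacunary_test_fun
begin

text \<open>The derivative order affects only the constant: the bound is uniform in \<open>x\<close>
  and contains \<open>e\<close> only as \<open>1 / e\<close>.\<close>

lemma norm_nth_deriv_lac_dist_conv:
  assumes p_def: "p = 2 * (k + 3)"
    and e: "0 < e" "e \<le> 1"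
    and ff: "has_fourier_fun f g" "\<And>\<xi>. norm (g \<xi>) \<le> C * japanese_bracket \<xi> powr (- real p)"
    and cond: "\<And>m. a m ^ (k + 3) \<le> 1 / e \<or> a m \<le> (e * a m)\<^sup>2"
    and B: "\<And>\<xi>. norm (fourier \<eta> \<xi>) \<le> B / (1 + \<bar>\<xi>\<bar>) ^ (k + 2 + p)"
  shows "norm (nth_deriv k (\<lambda>x. lac_dist (\<lambda>y. complex_of_real (1 / e) * f ((x - y) / e))) x) \<le>
    2 * (C * B * 2 ^ p * 2 ^ (k + 2) / e) * (LINT \<xi>|lborel. 1 / (1 + \<bar>\<xi>\<bar>) ^ 2)"
proof (rule norm_nth_deriv_inverse_fourier_series)
  let ?h = "\<lambda>m x. exp (\<i> * complex_of_real (a m * x)) * \<eta> x"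
  let ?G = "\<lambda>m \<xi>. g (e * \<xi>) * fourier \<eta> (\<xi> - a m) / (2 * pi)"
  have h: "?h m \<in> test_funs" for m by (rule modulated_test_fun[OF \<eta>])
  have C0: "C \<ge> 0"
    using order_trans[OF norm_ge_zero ff(2)[of 0]] by (simp add: japanese_bracket_def)
  have B0: "B \<ge> 0"
    using order_trans[OF norm_ge_zero B[of 0]] by simp
  \<comment> \<open>Measurability is inherited from the integrable product in
    \<open>integrable_mollified\<close>.\<close>
  show "?G m \<in> borel_measurable borel" for m
    using borel_measurable_integrable[OF integrable_mollified[OF ff(1) h[of m] e(1)], unfolded fourier_modulation]
    by simp
  show "(1 + \<bar>\<xi>\<bar>) ^ (k + 2) * norm (?G m \<xi>) \<le> C * B * 2 ^ p * 2 ^ (k + 2) / e * (1 / 2) ^ m" for m \<xi>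
  proof -
    have "norm (?G m \<xi>) = norm (g (e * \<xi>)) * norm (fourier \<eta> (\<xi> - a m)) / (2 * pi)"
      by (simp add: norm_mult norm_divide)
    also have "\<dots> \<le> norm (g (e * \<xi>)) * norm (fourier \<eta> (\<xi> - a m)) / 1"
      using pi_gt3 by (intro divide_left_mono) auto
    finally have "(1 + \<bar>\<xi>\<bar>) ^ (k + 2) * norm (?G m \<xi>) \<le>
        (1 + \<bar>\<xi>\<bar>) ^ (k + 2) * (norm (g (e * \<xi>)) * norm (fourier \<eta> (\<xi> - a m)))"
      by (intro mult_left_mono) auto
    also have "\<dots> \<le> C * B * 2 ^ p * 2 ^ (k + 2) / e * (1 / 2) ^ m"
      by (rule frequency_estimate[OF p_def e a_ge cond C0 ff(2) _ B0 B]) auto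
    finally show ?thesis .
  qed
  fix x
  show "lac_dist (\<lambda>y. complex_of_real (1 / e) * f ((x - y) / e)) =
      (\<Sum>m. LINT \<xi>|lborel. ?G m \<xi> * exp (\<i> * complex_of_real (x * \<xi>)))"
    unfolding lac_dist_def pairing_def
  proof (rule arg_cong[where f=suminf], rule ext)
    fix m
    have "fourier (\<lambda>y. \<eta> y * (complex_of_real (1 / e) * f ((x - y) / e))) (- a m) =
        (LINT y|lborel. ?h m y * (complex_of_real (1 / e) * f ((x - y) / e)))"
      unfolding fourier_def by (simp add: mult_ac)
    also have "\<dots> = (LINT \<xi>|lborel. g (e * \<xi>) * fourier \<eta> (\<xi> - a m) * exp (\<i> * complex_of_real (x * \<xi>))) / (2 * pi)"
      unfolding integral_mollified[OF ff(1) h e(1)] fourier_modulation ..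
    also have "\<dots> = (LINT \<xi>|lborel. ?G m \<xi> * exp (\<i> * complex_of_real (x * \<xi>)))"
      by (subst integral_divide_zero[symmetric]) (simp add: mult_ac)
    finally show "fourier (\<lambda>y. \<eta> y * (complex_of_real (1 / e) * f ((x - y) / e))) (- a m) =
        (LINT \<xi>|lborel. ?G m \<xi> * exp (\<i> * complex_of_real (x * \<xi>)))" .
  qed
qed

end

section \<open>The super-exponential scale\<close>

text \<open>The growth that drives every separation below: \<open>j ^ j\<close> splits off a factor
  \<open>j\<close> and still leaves \<open>j ^ (j - 1) >= i ^ i\<close>.\<close>

lemma mult_self_power_le:
  fixes i j :: nat
  assumes "i < j"
  shows "j * i ^ i \<le> j ^ j"
proof -
  have "i ^ i \<le> j ^ i" using assms by (intro power_mono) auto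
  also have "\<dots> \<le> j ^ (j - 1)" using assms by (intro power_increasing) auto
  finally have "j * i ^ i \<le> j * j ^ (j - 1)" by simp
  also have "\<dots> = j ^ j" using assms by (simp add: power_eq_if)
  finally show ?thesis .
qed

lemma self_power_mono: "(i::nat) \<le> j \<Longrightarrow> i ^ i \<le> j ^ j"
  using mult_self_power_le[of i j] by (cases "i = j") (auto intro: order_trans[rotated])

lemma self_le_self_power: "(j::nat) \<le> j ^ j"
  by (cases "j = 0") (auto intro: self_le_power)

lemma eps_seq_pos: "eps_seq n > 0"
  by (simp add: eps_seq_def)

lemma eps_seq_antimono: "i \<le> j \<Longrightarrow> eps_seq j \<le> eps_seq i"
  unfolding eps_seq_def by (intro divide_left_mono power_increasing self_power_mono) auto

lemma inverse_eps_seq: "1 / eps_seq n = 2 ^ (n ^ n)"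
  by (simp add: eps_seq_def)

lemma lacunary_eps_seq:
  assumes r: "r \<ge> 2"
  shows "lacunary (\<lambda>m. 1 / eps_seq (6 * m + r))"
proof
  have step: "(2::real) ^ m * 2 ^ n \<le> \<bar>1 / eps_seq (6 * m + r) - 1 / eps_seq (6 * n + r)\<bar>" if "m < n" for m n
  proof -
    let ?i = "6 * m + r" and ?j = "6 * n + r"
    \<comment> \<open>The aim is that the smaller frequency and \<open>2 ^ m * 2 ^ n\<close> are
      each at most half of the larger frequency; the difference then exceeds the required
      product.\<close>
    have "1 + ?i ^ ?i \<le> 2 * ?i ^ ?i" using r by simp
    also have "\<dots> \<le> ?j * ?i ^ ?i" using r by (intro mult_right_mono) auto
    also have "\<dots> \<le> ?j ^ ?j" using that by (intro mult_self_power_le) auto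
    finally have "(2::real) ^ (1 + ?i ^ ?i) \<le> 2 ^ (?j ^ ?j)" by (intro power_increasing) auto
    then have 1: "2 * (2::real) ^ (?i ^ ?i) \<le> 2 ^ (?j ^ ?j)" by simp
    have "1 + (m + n) \<le> ?j" using that r by simp
    also have "\<dots> \<le> ?j ^ ?j" by (rule self_le_self_power)
    finally have "(2::real) ^ (1 + (m + n)) \<le> 2 ^ (?j ^ ?j)" by (intro power_increasing) auto
    then have 2: "2 * ((2::real) ^ m * 2 ^ n) \<le> 2 ^ (?j ^ ?j)" by (simp add: power_add)
    show ?thesis unfolding inverse_eps_seq using 1 2 by linarith
  qed
  show "(2::real) ^ m * 2 ^ n \<le> \<bar>1 / eps_seq (6 * m + r) - 1 / eps_seq (6 * n + r)\<bar>" if "m \<noteq> n" for m n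
    using step[of m n] step[of n m] that by (cases "m < n") (auto simp: mult.commute abs_minus_commute)
  show "(2::real) ^ m \<le> 1 / eps_seq (6 * m + r)" for m
    unfolding inverse_eps_seq
    by (intro power_increasing order_trans[OF _ self_le_self_power]) auto
qed

text \<open>Below the window, \<open>(k + 3) * j ^ j <= N * j ^ j <= N ^ N\<close>. Above it,
  \<open>j ^ j >= 2 * (N + 3) ^ (N + 3)\<close>, so the frequency is at least the square of
  \<open>1 / eps_seq (N + 3)\<close>, hence at least \<open>1 / e ^ 2\<close>, which is the second
  alternative.\<close>

lemma frequency_separation:
  assumes e: "eps_seq (N + 3) < e" "e \<le> eps_seq N" and N: "N \<ge> k + 3"
    and j: "j < N \<or> N + 5 \<le> j"
  shows "(1 / eps_seq j) ^ (k + 3) \<le> 1 / e \<or> 1 / eps_seq j \<le> (e * (1 / eps_seq j))\<^sup>2"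
proof -
  have e0: "e > 0" using eps_seq_pos e(1) by (rule less_trans)
  show ?thesis using j
  proof
    assume j: "j < N"
    have "j ^ j * (k + 3) \<le> N * j ^ j" using N by (simp add: mult.commute)
    also have "\<dots> \<le> N ^ N" by (rule mult_self_power_le[OF j])
    finally have "(2::real) ^ (j ^ j * (k + 3)) \<le> 2 ^ (N ^ N)" by (intro power_increasing) auto
    also have "\<dots> = 1 / eps_seq N" by (simp add: inverse_eps_seq)
    also have "\<dots> \<le> 1 / e" using e(2) e0 by (intro divide_left_mono) (auto intro: eps_seq_pos)
    finally have "(1 / eps_seq j) ^ (k + 3) \<le> 1 / e"
      unfolding inverse_eps_seq power_mult .
    then show ?thesis ..
  next
    assume j: "N + 5 \<le> j"
    let ?P = "(N + 3) ^ (N + 3)" and ?a = "1 / eps_seq j"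
    have "?P * 2 \<le> j * ?P" using j by simp
    also have "\<dots> \<le> j ^ j" using j by (intro mult_self_power_le) auto
    finally have "(2::real) ^ (?P * 2) \<le> 2 ^ (j ^ j)" by (intro power_increasing) auto
    then have P: "((2::real) ^ ?P)\<^sup>2 \<le> ?a" by (simp only: inverse_eps_seq power_mult)
    have "1 \<le> e * 2 ^ ?P" using e(1) e0 by (simp add: eps_seq_def field_simps)
    then have "1 \<le> (e * 2 ^ ?P)\<^sup>2" by simp
    also have "\<dots> = e\<^sup>2 * (2 ^ ?P)\<^sup>2" by (simp add: power_mult_distrib)
    also have "\<dots> \<le> e\<^sup>2 * ?a" using P by (intro mult_left_mono) auto
    finally have "1 * ?a \<le> (e\<^sup>2 * ?a) * ?a" using eps_seq_pos[of j] by (intro mult_right_mono) auto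
    then have "?a \<le> (e * ?a)\<^sup>2" by (simp add: power2_eq_square mult_ac)
    then show ?thesis ..
  qed
qed

text \<open>With \<open>N = 6 * n\<close>, the indices congruent to 5 mod 6 jump from
  \<open>N - 1\<close> to \<open>N + 5\<close>.\<close>

lemma window_in_S:
  assumes "e \<in> S_set"
  obtains N where "eps_seq (N + 3) < e" "e \<le> eps_seq N" "\<And>m. 6 * m + 5 < N \<or> N + 5 \<le> 6 * m + 5"
proof -
  obtain n where n: "eps_seq (6 * n + 3) < e" "e \<le> eps_seq (6 * n)"
    using assms by (auto simp: S_set_def)
  show ?thesis by (rule that[of "6 * n"]) (use n in \<open>simp_all, linarith\<close>)
qed

text \<open>Outside \<open>S_set\<close> and up to \<open>eps_seq 0\<close>, the windows run from
  \<open>6 * n + 3\<close> to \<open>6 * n + 6\<close>; with \<open>N = 6 * n + 3\<close> the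
  indices congruent to 2 mod 6 jump from \<open>N - 1\<close> to \<open>N + 5\<close>. As
  \<open>0 ^ 0 = 1\<close>, \<open>eps_seq 0\<close> is 1/2, so the bound on \<open>e\<close>
  excludes the piece (1/2,1].\<close>

lemma window_outside_S:
  assumes "e \<notin> S_set" "0 < e" "e \<le> eps_seq 0"
  obtains N where "eps_seq (N + 3) < e" "e \<le> eps_seq N" "\<And>m. 6 * m + 2 < N \<or> N + 5 \<le> 6 * m + 2"
proof -
  have ex: "\<exists>n. eps_seq (6 * n) < e"
  proof -
    obtain n where n: "(1 / 2) ^ n < e"
      using real_arch_pow_inv[OF assms(2), of "1 / 2"] by auto
    have "n \<le> (6 * n) ^ (6 * n)"
      by (rule order_trans[OF _ self_le_self_power]) simp
    then have "(1 / 2 :: real) ^ ((6 * n) ^ (6 * n)) \<le> (1 / 2) ^ n" by (intro power_decreasing) auto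
    then have "eps_seq (6 * n) \<le> (1 / 2) ^ n" by (simp add: eps_seq_def power_one_over)
    with n show ?thesis by (meson le_less_trans)
  qed
  \<comment> \<open>\<open>M\<close> is positive because \<open>e <= eps_seq 0\<close>; its
    predecessor is the index of the block containing \<open>e\<close>.\<close>
  define M where "M = (LEAST n. eps_seq (6 * n) < e)"
  have M: "eps_seq (6 * M) < e" unfolding M_def by (rule LeastI_ex[OF ex])
  with assms(3) obtain n where n: "M = Suc n" by (cases M) auto
  have "\<not> eps_seq (6 * n) < e" using not_less_Least[of n "\<lambda>n. eps_seq (6 * n) < e"] n by (simp add: M_def)
  then have "\<not> eps_seq (6 * n + 3) < e" using assms(1) by (auto simp: S_set_def)
  moreover have "6 * n + 3 + 3 = 6 * M" using n by simp
  moreover have "6 * m + 2 < 6 * n + 3 \<or> 6 * n + 3 + 5 \<le> 6 * m + 2" for m by arith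
  ultimately show ?thesis
    using M by (intro that[of "6 * n + 3"]) (simp_all only: not_less)
qed

section \<open>Regularity of the embedded distribution\<close>

text \<open>The net itself serves as the regular representative. The constant \<open>D\<close> may
  depend on the order, since it is absorbed into one further power of \<open>1 / \<epsilon>\<close>
  for small \<epsilon>; the exponent 2 thus serves all orders and all compact sets.\<close>

lemma colombeau_embed_regular:
  fixes U :: "real filter" and u :: net
  assumes U: "\<And>\<delta>::real. \<delta> > 0 \<Longrightarrow> \<forall>\<^sub>F \<epsilon> in U. \<epsilon> \<in> {0<..\<delta>}"
    and smooth: "\<And>\<epsilon>. \<epsilon> \<in> {0<..1} \<Longrightarrow> smooth_fun (u \<epsilon>)"
    and bound: "\<And>k. \<exists>D. \<forall>\<^sub>F \<epsilon> in U. \<forall>x. norm (nth_deriv k (u \<epsilon>) x) \<le> D / \<epsilon>"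
  shows "colombeau_class U u \<in> colombeau_regular U"
proof -
  have est: "\<forall>\<^sub>F \<epsilon> in U. \<forall>x\<in>K. norm (nth_deriv k (u \<epsilon>) x) \<le> \<epsilon> powr (- real 2)" for k K
  proof -
    obtain D where D: "\<forall>\<^sub>F \<epsilon> in U. \<forall>x. norm (nth_deriv k (u \<epsilon>) x) \<le> D / \<epsilon>"
      using bound by blast
    \<comment> \<open>Below this threshold \<open>\<epsilon> * D <= 1\<close>, that is
      \<open>D / \<epsilon> <= 1 / \<epsilon> ^ 2\<close>; the absolute value and the summand 1
      cover negative and zero \<open>D\<close>.\<close>
    have "1 / (1 + \<bar>D\<bar>) > 0" by (simp add: add_pos_nonneg)
    from D U[OF this] show ?thesis
    proof eventually_elim
      case (elim \<epsilon>)
      have e: "\<epsilon> > 0" "\<epsilon> \<le> 1 / (1 + \<bar>D\<bar>)" using elim(2) by auto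
      have "1 + \<bar>D\<bar> > 0" by (simp add: add_pos_nonneg)
      with e have "\<epsilon> * (1 + \<bar>D\<bar>) \<le> 1" by (simp add: pos_le_divide_eq)
      then have "\<epsilon> * D \<le> 1" using e(1) mult_left_mono[of D "1 + \<bar>D\<bar>" \<epsilon>] by linarith
      then have "D / \<epsilon> \<le> 1 / \<epsilon>\<^sup>2" using e(1) by (simp add: field_simps power2_eq_square)
      also have "\<dots> = \<epsilon> powr (- real 2)"
        using e(1) powr_realpow[OF e(1), of 2] by (simp add: powr_minus divide_inverse)
      finally show ?case using elim(1) order_trans by blast
    qed
  qed
  have mod: "u \<in> moderate_nets U"
    unfolding moderate_nets_def smooth_nets_def using smooth est by blast
  have zero: "nth_deriv k (\<lambda>_. 0) = (\<lambda>_. 0)" for k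
    by (rule nth_deriv_eqI[where F="\<lambda>k _. 0"]) auto
  have "(\<lambda>\<epsilon> x. u \<epsilon> x - u \<epsilon> x) \<in> negligible_nets U"
    unfolding negligible_nets_def smooth_nets_def
  proof (intro CollectI conjI ballI allI impI)
    fix K :: "real set" and k m :: nat
    show "\<forall>\<^sub>F \<epsilon> in U. \<forall>x\<in>K. norm (nth_deriv k (\<lambda>x. u \<epsilon> x - u \<epsilon> x) x) \<le> \<epsilon> ^ m"
      using U[OF zero_less_one] by (rule eventually_mono) (auto simp: zero)
  qed (simp add: smooth_fun_const)
  with mod have "u \<in> colombeau_class U u"
    by (simp add: colombeau_class_def colombeau_rel_def)
  moreover have "colombeau_class U u \<in> colombeau U"
    unfolding colombeau_def colombeau_class_def by (rule quotientI[OF mod])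
  ultimately show ?thesis
    unfolding colombeau_regular_def using est by blast
qed

context lacunary_test_fun
begin

lemma colombeau_embed_lac_dist_regular:
  fixes U :: "real filter"
  assumes \<eta>0: "\<eta> y0 \<noteq> 0"
    and T: "\<And>\<theta>. \<theta> \<in> test_funs \<Longrightarrow> T \<theta> = lac_dist \<theta>"
    and U: "\<And>\<delta>::real. \<delta> > 0 \<Longrightarrow> \<forall>\<^sub>F \<epsilon> in U. \<epsilon> \<in> {0<..\<delta>}"
    and smooth: "\<And>\<epsilon>. \<epsilon> \<in> {0<..1} \<Longrightarrow> smooth_fun (\<phi> \<epsilon>)"
    and decay: "\<And>p::nat. \<exists>C::real. \<forall>\<^sub>F \<epsilon> in U. \<exists>g. has_fourier_fun (\<phi> \<epsilon>) g \<and>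
           (\<forall>\<xi>. norm (g \<xi>) \<le> C * japanese_bracket \<xi> powr (- real p))"
    and sep: "\<And>k. \<forall>\<^sub>F \<epsilon> in U. \<forall>m. a m ^ (k + 3) \<le> 1 / \<epsilon> \<or> a m \<le> (\<epsilon> * a m)\<^sup>2"
  shows "colombeau_embed U \<phi> T \<in> colombeau_regular U"
  unfolding colombeau_embed_def
proof (rule colombeau_embed_regular[OF U])
  have moll: "smooth_fun (scaled_mollifier \<phi> \<epsilon>)" if "\<epsilon> \<in> {0<..1}" for \<epsilon>
  proof -
    have "smooth_fun (\<lambda>x. complex_of_real (1 / \<epsilon>) * \<phi> \<epsilon> (0 + (1 / \<epsilon>) * x))"
      by (rule smooth_fun_cmult[OF smooth_fun_affine[OF smooth[OF that]]])
    then show ?thesis by (simp add: scaled_mollifier_def)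
  qed
  have conv: "dist_conv T (scaled_mollifier \<phi> \<epsilon>) = (\<lambda>x. lac_dist (\<lambda>y. scaled_mollifier \<phi> \<epsilon> (x - y)))"
    if "\<epsilon> \<in> {0<..1}" for \<epsilon>
    by (rule ext)
       (simp add: dist_conv_def extend_T_to_smooth[OF T smooth_fun_minus_arg[OF moll[OF that]] \<eta>0])
  show "smooth_fun (dist_conv T (scaled_mollifier \<phi> \<epsilon>))" if "\<epsilon> \<in> {0<..1}" for \<epsilon>
    unfolding conv[OF that] by (rule smooth_fun_lac_dist_conv[OF moll[OF that]])
  fix k
  define p :: nat where "p = 2 * (k + 3)"
  obtain C where C: "\<forall>\<^sub>F \<epsilon> in U. \<exists>g. has_fourier_fun (\<phi> \<epsilon>) g \<and>
           (\<forall>\<xi>. norm (g \<xi>) \<le> C * japanese_bracket \<xi> powr (- real p))"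
    using decay by blast
  obtain B where B: "\<And>\<xi>. norm (nth_deriv 0 (fourier \<eta>) \<xi>) \<le> B / (1 + \<bar>\<xi>\<bar>) ^ (k + 2 + p)"
    using schwartz_fun_decay[OF fourier_schwartz[OF schwartz_\<eta>], where k=0 and q="k + 2 + p"] by blast
  define D where "D = 2 * (C * B * 2 ^ p * 2 ^ (k + 2)) * (LINT \<xi>|lborel. 1 / (1 + \<bar>\<xi>\<bar>) ^ 2)"
  have "\<forall>\<^sub>F \<epsilon> in U. \<epsilon> \<in> {0<..1}" by (rule U) simp
  with C sep[of k] have "\<forall>\<^sub>F \<epsilon> in U. \<forall>x. norm (nth_deriv k (dist_conv T (scaled_mollifier \<phi> \<epsilon>)) x) \<le> D / \<epsilon>"
  proof eventually_elim
    case (elim \<epsilon>)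
    then obtain g where g: "has_fourier_fun (\<phi> \<epsilon>) g"
      "\<And>\<xi>. norm (g \<xi>) \<le> C * japanese_bracket \<xi> powr (- real p)" by blast
    have e: "0 < \<epsilon>" "\<epsilon> \<le> 1" using elim(3) by auto
    have cond: "a m ^ (k + 3) \<le> 1 / \<epsilon> \<or> a m \<le> (\<epsilon> * a m)\<^sup>2" for m using elim(2) by blast
    show ?case
    proof
      fix x
      show "norm (nth_deriv k (dist_conv T (scaled_mollifier \<phi> \<epsilon>)) x) \<le> D / \<epsilon>"
        using norm_nth_deriv_lac_dist_conv[OF p_def e g cond B[unfolded nth_deriv_0], of x]
        unfolding conv[OF elim(3)] unfolding scaled_mollifier_def D_def by (simp only: times_divide_eq_left times_divide_eq_right)
    qed
  qed
  then show "\<exists>D. \<forall>\<^sub>F \<epsilon> in U. \<forall>x. norm (nth_deriv k (dist_conv T (scaled_mollifier \<phi> \<epsilon>)) x) \<le> D / \<epsilon>" ..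
qed

end

text \<open>Both branches become one sequence with residue \<open>r\<close>: 5 if
  \<open>S_set\<close> belongs to \<open>U\<close> (as \<open>6 * Suc m - 1 = 6 * m + 5\<close>),
  otherwise 2. The ultrafilter property is what puts the complement into \<open>U\<close> in the
  second case.\<close>

lemma T_hat_cases:
  fixes U :: "real filter"
  assumes uf: "free_ultrafilter_on {0<..1} U"
    and U: "\<And>\<delta>::real. \<delta> > 0 \<Longrightarrow> \<forall>\<^sub>F \<epsilon> in U. \<epsilon> \<in> {0<..\<delta>}"
  obtains r where "r \<ge> 2" "T_hat U \<psi> = (\<lambda>\<xi>. \<Sum>m. \<psi> (\<xi> - 1 / eps_seq (6 * m + r)))"
    "\<And>k. \<forall>\<^sub>F \<epsilon> in U. \<forall>m. (1 / eps_seq (6 * m + r)) ^ (k + 3) \<le> 1 / \<epsilon> \<or>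
        1 / eps_seq (6 * m + r) \<le> (\<epsilon> * (1 / eps_seq (6 * m + r)))\<^sup>2"
proof -
  have *: "\<forall>\<^sub>F \<epsilon> in U. \<forall>m. (1 / eps_seq (6 * m + r)) ^ (k + 3) \<le> 1 / \<epsilon> \<or>
        1 / eps_seq (6 * m + r) \<le> (\<epsilon> * (1 / eps_seq (6 * m + r)))\<^sup>2"
    if win: "\<forall>\<^sub>F \<epsilon> in U. \<exists>N. eps_seq (N + 3) < \<epsilon> \<and> \<epsilon> \<le> eps_seq N \<and> (\<forall>m. 6 * m + r < N \<or> N + 5 \<le> 6 * m + r)" for r k
    using win U[OF eps_seq_pos[of "k + 6"]]
  proof eventually_elim
    case (elim \<epsilon>)
    then obtain N where N: "eps_seq (N + 3) < \<epsilon>" "\<epsilon> \<le> eps_seq N" "\<And>m. 6 * m + r < N \<or> N + 5 \<le> 6 * m + r"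
      by blast
    \<comment> \<open>From \<open>eps_seq (N + 3) < \<epsilon> <= eps_seq (k + 6)\<close>: this is
      where \<epsilon> must be small depending on \<open>k\<close>.\<close>
    have "N \<ge> k + 3"
    proof (rule ccontr)
      assume "\<not> ?thesis"
      then have "eps_seq (k + 6) \<le> eps_seq (N + 3)" by (intro eps_seq_antimono) simp
      with N(1) elim(2) show False by simp
    qed
    then show ?case using frequency_separation[OF N(1,2) _ N(3)] by blast
  qed
  show ?thesis
  proof (cases "eventually (\<lambda>\<epsilon>. \<epsilon> \<in> S_set) U")
    case True
    show ?thesis
    proof (rule that[of 5])
      show "T_hat U \<psi> = (\<lambda>\<xi>. \<Sum>m. \<psi> (\<xi> - 1 / eps_seq (6 * m + 5)))"
        using True by (simp add: T_hat_def fun_eq_iff add.commute)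
      show "\<forall>\<^sub>F \<epsilon> in U. \<forall>m. (1 / eps_seq (6 * m + 5)) ^ (k + 3) \<le> 1 / \<epsilon> \<or>
        1 / eps_seq (6 * m + 5) \<le> (\<epsilon> * (1 / eps_seq (6 * m + 5)))\<^sup>2" for k
        by (rule *) (rule eventually_mono[OF True], erule window_in_S, blast)
    qed simp
  next
    case False
    then have notS: "eventually (\<lambda>\<epsilon>. \<epsilon> \<notin> S_set) U"
      using uf unfolding free_ultrafilter_on_def by blast
    show ?thesis
    proof (rule that[of 2])
      show "T_hat U \<psi> = (\<lambda>\<xi>. \<Sum>m. \<psi> (\<xi> - 1 / eps_seq (6 * m + 2)))"
        using False by (simp add: T_hat_def fun_eq_iff)
      show "\<forall>\<^sub>F \<epsilon> in U. \<forall>m. (1 / eps_seq (6 * m + 2)) ^ (k + 3) \<le> 1 / \<epsilon> \<or>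
        1 / eps_seq (6 * m + 2) \<le> (\<epsilon> * (1 / eps_seq (6 * m + 2)))\<^sup>2" for k
      proof (rule *)
        show "\<forall>\<^sub>F \<epsilon> in U. \<exists>N. eps_seq (N + 3) < \<epsilon> \<and> \<epsilon> \<le> eps_seq N \<and> (\<forall>m. 6 * m + 2 < N \<or> N + 5 \<le> 6 * m + 2)"
          using notS U[OF eps_seq_pos[of 0]]
        proof eventually_elim
          case (elim \<epsilon>)
          then have "0 < \<epsilon>" "\<epsilon> \<le> eps_seq 0" by auto
          from window_outside_S[OF elim(1) this] show ?case by blast
        qed
      qed
    qed simp
  qed
qed

theorem mainTheorem1:
  fixes U :: "real filter"
    and \<phi> :: "real \<Rightarrow> real \<Rightarrow> complex"
    and \<psi> :: "real \<Rightarrow> complex"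
  assumes "free_ultrafilter_on {0<..1} U"
    and "\<And>\<delta>::real. \<delta> > 0 \<Longrightarrow> eventually (\<lambda>\<epsilon>. \<epsilon> \<in> {0<..\<delta>}) U"
    and "\<And>\<epsilon>. \<epsilon> \<in> {0<..1} \<Longrightarrow> smooth_fun (\<phi> \<epsilon>)"
    and "\<And>p::nat. \<exists>C::real. \<forall>\<^sub>F \<epsilon> in U. \<exists>g. has_fourier_fun (\<phi> \<epsilon>) g \<and>
           (\<forall>\<xi>. norm (g \<xi>) \<le> C * japanese_bracket \<xi> powr (- real p))"
    and "\<psi> \<in> schwartz_funs"
    and "fourier \<psi> \<in> test_funs"
    and "\<exists>x. \<psi> x \<noteq> 0"
  shows "(\<exists>T. tempered_distribution T \<and> tempered_given_by (T_hat U \<psi>) (fourier_dist T)) \<and>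
         (\<forall>T. tempered_distribution T \<and> tempered_given_by (T_hat U \<psi>) (fourier_dist T) \<longrightarrow>
            T \<in> compactly_supported_dists - smooth_dists \<and>
            colombeau_embed U \<phi> T \<in> colombeau_regular U)"
proof -
  obtain r where r: "r \<ge> 2"
    and That: "T_hat U \<psi> = (\<lambda>\<xi>. \<Sum>m. \<psi> (\<xi> - 1 / eps_seq (6 * m + r)))"
    and sep: "\<And>k. \<forall>\<^sub>F \<epsilon> in U. \<forall>m. (1 / eps_seq (6 * m + r)) ^ (k + 3) \<le> 1 / \<epsilon> \<or>
        1 / eps_seq (6 * m + r) \<le> (\<epsilon> * (1 / eps_seq (6 * m + r)))\<^sup>2"
    using T_hat_cases[OF assms(1,2), where \<psi>=\<psi>] by blast
  define \<eta> where "\<eta> = inverse_fourier \<psi>"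
  have \<eta>\<psi>: "fourier \<eta> = \<psi>"
    unfolding \<eta>_def by (rule fourier_inverse_fourier[OF assms(5)])
  have "(\<lambda>x. fourier \<psi> (0 + (- 1) * x) * (1 / (2 * pi))) \<in> test_funs"
    by (rule mult_test_funs[OF affine_test_funs[OF assms(6)] smooth_fun_const]) simp
  then have "\<eta> \<in> test_funs"
    by (simp add: \<eta>_def inverse_fourier_altdef[abs_def])
  then interpret lacunary_test_fun "\<lambda>m. 1 / eps_seq (6 * m + r)" \<eta>
    by (intro lacunary_test_fun.intro lacunary_eps_seq[OF r] lacunary_test_fun_axioms.intro)
  \<comment> \<open>Nonvanishing of \<psi> enters here. It gives a nonzero limit in the
    non-smoothness argument and the raw material for the cutoff.\<close>
  obtain y0 where y0: "\<eta> y0 \<noteq> 0"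
  proof (rule ccontr)
    assume "\<not> thesis"
    then have "\<eta> y = 0" for y using that by blast
    then have "\<psi> x = 0" for x unfolding \<eta>\<psi>[symmetric] fourier_def by simp
    with assms(7) show False by blast
  qed
  show ?thesis
  proof (intro conjI allI impI)
    show "\<exists>T. tempered_distribution T \<and> tempered_given_by (T_hat U \<psi>) (fourier_dist T)"
      using tempered_lac_dist tempered_given_by_lac_dist unfolding \<eta>\<psi> That by blast
    fix T assume "tempered_distribution T \<and> tempered_given_by (T_hat U \<psi>) (fourier_dist T)"
    then have T: "T \<theta> = lac_dist \<theta>" if "\<theta> \<in> test_funs" for \<theta>
      using eq_lac_dist_on_test_funs[OF _ that, of T] unfolding \<eta>\<psi> That by blast
    show "T \<in> compactly_supported_dists - smooth_dists"
      using compactly_supported_T[OF T] not_smooth_T[OF T y0] by blast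
    show "colombeau_embed U \<phi> T \<in> colombeau_regular U"
      by (rule colombeau_embed_lac_dist_regular[OF y0 T assms(2,3,4) sep])
  qed
qed

end
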